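(* Let $N$ be a Hawkes process with exogenous density $\mu_0>0$ and kernel $\phi\in L^1(\mathbb{R}_+;\mathbb{R}_+)$, and let $m=\int_0^\infty\phi(s)\,ds$, $\Phi(t)=\int_t^\infty\phi(s)\,ds$, $\Psi_1(t)=\int_0^t s\,\phi(s)\,ds$ and $\sigma=\Psi_1(\infty)\in(0,\infty]$. The following regimes arise for the long-term behavior of $\mathbf{E}[N(t)]$ and $\mathrm{Var}(N(t))$. (1) (Subcritical case) When $m<1$, as $t\to\infty$, $$\mathbf{E}[N(t)]\sim\frac{\mu_0\cdot t}{1-m}\quad\text{and}\quad \mathrm{Var}(N(t))\sim\frac{\mu_0\cdot t}{(1-m)^3}.$$ (2) (Weakly critical case) When $m=1$ and $\sigma<\infty$, as $t\to\infty$, $$\mathbf{E}[N(t)]\sim\frac{\mu_0}{2\sigma}\cdot t^2\quad\text{and}\quad \mathrm{Var}(N(t))\sim\frac{\mu_0}{12\sigma^3}\cdot t^4.$$ (3) (Strongly critical case) When $m=1$ and $\sigma=\infty$, as $t\to\infty$: (3.a) if $\Phi\in\mathrm{RV}^\infty_{-\alpha}$ with $\alpha\in[0,1)$, then $$\mathbf{E}[N(t)]\sim\frac{\mu_0}{\Gamma(1-\alpha)\Gamma(2+\alpha)}\cdot\frac{t}{\Phi(t)}\quad\text{and}\quad \mathrm{Var}(N(t))\sim\frac{\mu_0\,\mathrm{B}(2\alpha+1,\alpha+1)}{|\Gamma(1-\alpha)\Gamma(1+\alpha)|^3}\cdot\frac{t}{|\Phi(t)|^3};$$ (3.b) if $\Phi\in\mathrm{RV}^\infty_{-1}$,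 then $$\mathbf{E}[N(t)]\sim\frac{\mu_0}{2}\cdot\frac{t^2}{\Psi_1(t)}\quad\text{and}\quad \mathrm{Var}(N(t))\sim\frac{\mu_0}{12}\cdot\frac{t^4}{|\Psi_1(t)|^3}.$$
   Context: A Hawkes process $\{N(t):t\ge0\}$ on a complete filtered probability space $(\Omega,\mathscr{F},(\mathscr{F}_t)_{t\ge0},\mathbf{P})$ satisfying the usual hypotheses is a random point process (with event arrival times $\tau_1,\tau_2,\dots$, $N(t)$ being the number of events in $(0,t]$) whose $(\mathscr{F}_t)$-intensity is $$\Lambda(t)=\mu_0+\sum_{0<\tau_i<t}\phi(t-\tau_i),\qquad t\ge0 .$$ A measurable function $F:\mathbb{R}_+\to\mathbb{R}$ belongs to $\mathrm{RV}^\infty_\beta$, $\beta\in\mathbb{R}$, if it has constant sign near infinity and $\lim_{t\to\infty}F(tx)/F(t)=x^\beta$ for every $x>0$. $\Gamma$ and $\mathrm{B}$ denote the gamma and beta functions, $\mathrm{B}(a,b)=\Gamma(a)\Gamma(b)/\Gamma(a+b)$. $f\sim g$ means $f(t)/g(t)\to1$. *)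

theory Defs
  imports "HOL-Probability.Probability"
begin

text \<open>
  Time is the half-line of nonnegative reals. The library locale \<^locale>\<open>filtration\<close> is indexed by
  all of \<^typ>\<open>real\<close>; the members with negative index play no role below (a filtration indexed by
  the nonnegative reals extends by \<open>F t = F 0\<close> for \<open>t < 0\<close>).
\<close>

locale usual_filtered_prob_space =
  prob_space M + complete_measure M + filtration "space M" F
  for M :: "'a measure" and F :: "real \<Rightarrow> 'a measure" +
  assumes subalgebra_F: "\<And>t. 0 \<le> t \<Longrightarrow> subalgebra M (F t)"
    and null_sets_F: "null_sets M \<subseteq> sets (F 0)"
    and right_continuous_F: "\<And>t. 0 \<le> t \<Longrightarrow> (\<Inter>s\<in>{t<..}. sets (F s)) = sets (F t)"

definition predictable_sigma :: "'a set \<Rightarrow> (real \<Rightarrow> 'a measure) \<Rightarrow> (real \<times> 'a) measure" where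
  "predictable_sigma \<Omega> F = sigma ({0..} \<times> \<Omega>)
     ({{0} \<times> A |A. A \<in> sets (F 0)} \<union> {{s<..t} \<times> A |s t A. 0 \<le> s \<and> s \<le> t \<and> A \<in> sets (F s)})"

definition predictable :: "'a set \<Rightarrow> (real \<Rightarrow> 'a measure) \<Rightarrow> (real \<Rightarrow> 'a \<Rightarrow> ennreal) \<Rightarrow> bool" where
  "predictable \<Omega> F C \<longleftrightarrow> (\<lambda>(t, \<omega>). C t \<omega>) \<in> borel_measurable (predictable_sigma \<Omega> F)"

definition progressive :: "(real \<Rightarrow> 'a measure) \<Rightarrow> (real \<Rightarrow> 'a \<Rightarrow> real) \<Rightarrow> bool" where
  "progressive F X \<longleftrightarrow>
     (\<forall>T\<ge>0. (\<lambda>(t, \<omega>). X t \<omega>) \<in> borel_measurable (restrict_space borel {0..T} \<Otimes>\<^sub>M F T))"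

text \<open>
  The arrival times are \<open>\<tau> 0, \<tau> 1, \<dots>\<close> (so \<open>\<tau> i\<close> is the \<open>(i + 1)\<close>-st event);
  \<open>\<tau> i \<omega> = \<infinity>\<close> means that fewer than \<open>i + 1\<close> events occur.
\<close>

definition event_count :: "(nat \<Rightarrow> 'a \<Rightarrow> ereal) \<Rightarrow> real \<Rightarrow> 'a \<Rightarrow> nat" where
  "event_count \<tau> t \<omega> = card {i. 0 < \<tau> i \<omega> \<and> \<tau> i \<omega> \<le> ereal t}"

locale point_process = usual_filtered_prob_space M F
  for M :: "'a measure" and F :: "real \<Rightarrow> 'a measure" +
  fixes \<tau> :: "nat \<Rightarrow> 'a \<Rightarrow> ereal"
  assumes arrival_pos: "\<And>i \<omega>. \<omega> \<in> space M \<Longrightarrow> 0 < \<tau> i \<omega>"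
    and arrival_less: "\<And>i \<omega>. \<omega> \<in> space M \<Longrightarrow> \<tau> i \<omega> < \<infinity> \<Longrightarrow> \<tau> i \<omega> < \<tau> (Suc i) \<omega>"
    and arrival_infinity: "\<And>i \<omega>. \<omega> \<in> space M \<Longrightarrow> \<tau> i \<omega> = \<infinity> \<Longrightarrow> \<tau> (Suc i) \<omega> = \<infinity>"
    and locally_finite: "\<And>t \<omega>. \<omega> \<in> space M \<Longrightarrow> finite {i. \<tau> i \<omega> \<le> ereal t}"
    and adapted: "\<And>t. 0 \<le> t \<Longrightarrow> event_count \<tau> t \<in> F t \<rightarrow>\<^sub>M count_space UNIV"

text \<open>
  The stochastic intensity in the sense of Bremaud: for all nonnegative predictable \<open>C\<close>,
  \<open>E[\<integral> C\<^sub>s dN(s)] = E[\<integral> C\<^sub>s \<Lambda>(s) ds]\<close>, the integral against \<open>dN\<close> being the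
  sum of the values of \<open>C\<close> over the (finite) arrival times.
\<close>

definition has_intensity ::
  "'a measure \<Rightarrow> (real \<Rightarrow> 'a measure) \<Rightarrow> (nat \<Rightarrow> 'a \<Rightarrow> ereal) \<Rightarrow> (real \<Rightarrow> 'a \<Rightarrow> real) \<Rightarrow> bool" where
  "has_intensity M F \<tau> \<Lambda> \<longleftrightarrow>
     progressive F \<Lambda> \<and>
     (\<forall>t\<ge>0. \<forall>\<omega>\<in>space M. 0 \<le> \<Lambda> t \<omega>) \<and>
     (\<forall>t\<ge>0. AE \<omega> in M. (\<integral>\<^sup>+s\<in>{0..t}. ennreal (\<Lambda> s \<omega>) \<partial>lborel) < \<infinity>) \<and>
     (\<forall>C. predictable (space M) F C \<longrightarrow>
        (\<integral>\<^sup>+\<omega>. (\<Sum>i. if \<tau> i \<omega> < \<infinity> then C (real_of_ereal (\<tau> i \<omega>)) \<omega> else 0) \<partial>M) =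
        (\<integral>\<^sup>+\<omega>. (\<integral>\<^sup>+s\<in>{0..}. C s \<omega> * ennreal (\<Lambda> s \<omega>) \<partial>lborel) \<partial>M))"

definition hawkes_intensity ::
  "real \<Rightarrow> (real \<Rightarrow> real) \<Rightarrow> (nat \<Rightarrow> 'a \<Rightarrow> ereal) \<Rightarrow> real \<Rightarrow> 'a \<Rightarrow> real" where
  "hawkes_intensity \<mu>\<^sub>0 \<phi> \<tau> t \<omega> =
     \<mu>\<^sub>0 + (\<Sum>i | 0 < \<tau> i \<omega> \<and> \<tau> i \<omega> < ereal t. \<phi> (t - real_of_ereal (\<tau> i \<omega>)))"

locale hawkes_process = point_process M F \<tau>
  for M :: "'a measure" and F :: "real \<Rightarrow> 'a measure" and \<tau> :: "nat \<Rightarrow> 'a \<Rightarrow> ereal" +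
  fixes \<mu>\<^sub>0 :: real and \<phi> :: "real \<Rightarrow> real"
  assumes intensity: "has_intensity M F \<tau> (hawkes_intensity \<mu>\<^sub>0 \<phi> \<tau>)"

text \<open>
  A function on the nonnegative half-line is represented by a function on \<^typ>\<open>real\<close> whose values
  at negative arguments are irrelevant.
\<close>

definition kernel_mass :: "(real \<Rightarrow> real) \<Rightarrow> real" where
  "kernel_mass \<phi> = (LINT s:{0..}|lborel. \<phi> s)"

definition kernel_tail :: "(real \<Rightarrow> real) \<Rightarrow> real \<Rightarrow> real" where
  "kernel_tail \<phi> t = (LINT s:{t..}|lborel. \<phi> s)"

definition kernel_Psi1 :: "(real \<Rightarrow> real) \<Rightarrow> real \<Rightarrow> real" where
  "kernel_Psi1 \<phi> t = (LINT s:{0..t}|lborel. s * \<phi> s)"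

definition kernel_sigma :: "(real \<Rightarrow> real) \<Rightarrow> ennreal" where
  "kernel_sigma \<phi> = (\<integral>\<^sup>+s\<in>{0..}. ennreal (s * \<phi> s) \<partial>lborel)"

definition RV_infinity :: "real \<Rightarrow> (real \<Rightarrow> real) set" where
  "RV_infinity \<beta> = {G. set_borel_measurable borel {0..} G \<and>
     ((\<forall>\<^sub>F t in at_top. 0 < G t) \<or> (\<forall>\<^sub>F t in at_top. G t < 0)) \<and>
     (\<forall>x>0. ((\<lambda>t. G (t * x) / G t) \<longlongrightarrow> x powr \<beta>) at_top)}"

end

theory Submission
  imports Defs "HOL-Real_Asymp.Real_Asymp"
begin

text \<open>
  Let \<open>J = 1 + \<phi> * J\<close> be the renewal function of the kernel. Writing \<open>N(t) - E N(t)\<close> as the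
  stochastic integral of the deterministic function \<open>s \<mapsto> J(t - s)\<close> against the compensated
  process gives \<open>E N(t) = \<mu>\<^sub>0 \<integral>\<^sub>0\<^sup>t J\<close> and \<open>Var N(t) = \<mu>\<^sub>0 \<integral>\<^sub>0\<^sup>t J(t - s)\<^sup>2 J(s) ds\<close>.
  Let \<open>K(t) = \<integral>\<^sub>0\<^sup>t (1 - \<integral>\<^sub>0\<^sup>u \<phi>) du\<close>. The Laplace transforms of \<open>J\<close>
  and \<open>K\<close> at \<open>z\<close> multiply to \<open>1 / z\<^sup>3\<close>, and \<open>K\<close> is regularly varying of some index
  \<open>\<rho> \<in> [0, 1]\<close> in each regime. As \<open>J\<close> is monotone, Karamata's Tauberian theorem yields
  \<open>J(t) \<sim> t / (\<Gamma>(1 + \<rho>) \<Gamma>(2 - \<rho>) K(t))\<close>, and dominated convergence (\<open>J(tx) \<le> J(t)\<close> for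
  \<open>x \<le> 1\<close>) turns this into the asymptotics of both moments.
\<close>

section \<open>The renewal function\<close>

text \<open>The obstacle is that the intensity identity yields only equations in [0, \<infinity>],
  and a priori every moment of N(t) may be infinite: the renewal equation for E N(t) also admits the
  solution \<infinity>, and the terms of E (X - Y)^2 cannot be separated before square integrability
  is known. Hence the identities are arranged without subtraction, and where finiteness is at stake
  they are first used for the process stopped at the arrival time \<open>\<tau> n\<close>, where the
  stochastic integral and its compensator are bounded; the limit in n comes afterwards. K carries
  all regimes at once: it is asymptotic to (1 - m) t, to \<sigma>, to t \<Phi>(t) / (1 - \<alpha>)
  and to \<open>\<Psi>\<^sub>1 t\<close>, with \<rho> = 1, 0, 1 - \<alpha> and 0. Of the two Gamma
  factors, \<Gamma>(1 + \<rho>) is the Abelian limit of the transform of K, and \<Gamma>(2 - \<rho>)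
  stems from the transform of t^(1 - \<rho>) in Karamata's theorem. The Beta factors are integrals
  over [0, 1] of the limits x^(1 - \<rho>) of J(tx)/J(t).\<close>

primrec renewal_iter :: "(real \<Rightarrow> ennreal) \<Rightarrow> nat \<Rightarrow> real \<Rightarrow> ennreal" where
  "renewal_iter p 0 t = indicator {0..} t"
| "renewal_iter p (Suc n) t = (\<integral>\<^sup>+v. p v * renewal_iter p n (t - v) \<partial>lborel)"

text \<open>For \<open>p\<close> supported on the positive half-line, term n is the mass that the
  n-fold convolution power of \<open>p\<close> gives to [0, t]. Values in \<open>ennreal\<close>
  make the series meaningful before its convergence is known.\<close>

definition renewal_fun :: "(real \<Rightarrow> ennreal) \<Rightarrow> real \<Rightarrow> ennreal" where
  "renewal_fun p t = (\<Sum>n. renewal_iter p n t)"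

abbreviation cumulative :: "(real \<Rightarrow> real) \<Rightarrow> real \<Rightarrow> real" where
  "cumulative j t \<equiv> LBINT u. indicator {0..t} u * j u"

abbreviation square_convolution :: "(real \<Rightarrow> real) \<Rightarrow> real \<Rightarrow> real" where
  "square_convolution j t \<equiv> LBINT u. indicator {0..t} u * (j (t - u) ^ 2 * j u)"

text \<open>The integrals run over the whole line, so \<open>t\<close> occurs only in the shifted
  argument \<open>t - v\<close> and monotonicity passes through the recursion. This is the source of
  the monotonicity of J on which the Tauberian step rests.\<close>

lemma mono_renewal_iter: "mono (renewal_iter p n)"
proof (induction n)
  case 0
  show ?case by (auto simp: mono_def indicator_def)
next
  case (Suc n)
  then show ?case
    by (auto simp: mono_def intro!: nn_integral_mono mult_left_mono)
qed

lemma mono_renewal_fun: "mono (renewal_fun p)"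
  unfolding renewal_fun_def using mono_renewal_iter[of p]
  by (auto simp: mono_def intro!: suminf_le)

lemma borel_measurable_renewal_iter [measurable]:
  assumes [measurable]: "p \<in> borel_measurable borel"
  shows "renewal_iter p n \<in> borel_measurable borel"
proof (induction n)
  case 0
  show ?case by simp
next
  case (Suc n)
  note [measurable] = Suc
  show ?case by simp
qed

lemma borel_measurable_renewal_fun [measurable]:
  assumes [measurable]: "p \<in> borel_measurable borel"
  shows "renewal_fun p \<in> borel_measurable borel"
  unfolding renewal_fun_def by measurable

lemma renewal_iter_neg:
  assumes "\<And>s. s \<le> 0 \<Longrightarrow> p s = 0" "t < 0"
  shows "renewal_iter p n t = 0"
  using assms(2)
proof (induction n arbitrary: t)
  case (Suc n)
  have "p v * renewal_iter p n (t - v) = 0" for v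
    using assms(1)[of v] Suc.IH[of "t - v"] Suc.prems by (cases "v \<le> 0") auto
  then have "(\<lambda>v. p v * renewal_iter p n (t - v)) = (\<lambda>v. 0)" by blast
  then show ?case by simp
qed auto

lemma renewal_fun_neg:
  assumes "\<And>s. s \<le> 0 \<Longrightarrow> p s = 0" "t < 0"
  shows "renewal_fun p t = 0"
  using renewal_iter_neg[OF assms] by (simp add: renewal_fun_def)

lemma renewal_equation:
  assumes [measurable]: "p \<in> borel_measurable borel"
  shows "renewal_fun p t = indicator {0..} t + (\<integral>\<^sup>+v. p v * renewal_fun p (t - v) \<partial>lborel)"
proof -
  have "(\<integral>\<^sup>+v. p v * renewal_fun p (t - v) \<partial>lborel)
      = (\<integral>\<^sup>+v. (\<Sum>n. p v * renewal_iter p n (t - v)) \<partial>lborel)"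
    by (simp add: renewal_fun_def)
  also have "\<dots> = (\<Sum>n. renewal_iter p (Suc n) t)"
    by (subst nn_integral_suminf) simp_all
  finally show ?thesis
    using suminf_offset[of "\<lambda>n. renewal_iter p n t" 1]
    by (simp add: renewal_fun_def add.commute)
qed

lemma renewal_fun_ge_1:
  assumes [measurable]: "p \<in> borel_measurable borel" and "0 \<le> t"
  shows "1 \<le> renewal_fun p t"
  by (subst renewal_equation) (use assms in auto)

section \<open>Laplace transform of the renewal function\<close>

definition laplace :: "(real \<Rightarrow> ennreal) \<Rightarrow> real \<Rightarrow> ennreal" where
  "laplace g z = (\<integral>\<^sup>+t. ennreal (exp (- z * t)) * g t \<partial>lborel)"

lemma nn_integral_lborel_shift:
  fixes f :: "real \<Rightarrow> ennreal"
  assumes [measurable]: "f \<in> borel_measurable borel"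
  shows "(\<integral>\<^sup>+t. f (t - v) \<partial>lborel) = (\<integral>\<^sup>+t. f t \<partial>lborel)"
  using nn_integral_real_affine[of f 1 "-v"] by simp

text \<open>The transform is two-sided, so this is Tonelli's theorem and a translation by
  \<open>v\<close>, with exp(-zt) = exp(-zv) exp(-z(t - v)).\<close>

lemma laplace_convolution:
  assumes [measurable]: "p \<in> borel_measurable borel" "g \<in> borel_measurable borel"
  shows "laplace (\<lambda>t. \<integral>\<^sup>+v. p v * g (t - v) \<partial>lborel) z = laplace p z * laplace g z"
proof -
  have "laplace (\<lambda>t. \<integral>\<^sup>+v. p v * g (t - v) \<partial>lborel) z
      = (\<integral>\<^sup>+t. (\<integral>\<^sup>+v. ennreal (exp (- z * t)) * (p v * g (t - v)) \<partial>lborel) \<partial>lborel)"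
    by (simp add: laplace_def nn_integral_cmult)
  also have "\<dots> = (\<integral>\<^sup>+v. (\<integral>\<^sup>+t. ennreal (exp (- z * t)) * (p v * g (t - v)) \<partial>lborel) \<partial>lborel)"
    by (rule lborel_pair.Fubini') measurable
  also have "\<dots> = (\<integral>\<^sup>+v. (\<integral>\<^sup>+t. (ennreal (exp (- z * v)) * p v) * (ennreal (exp (- z * (t - v))) * g (t - v)) \<partial>lborel) \<partial>lborel)"
  proof (intro nn_integral_cong)
    fix v t
    have "ennreal (exp (- z * t)) = ennreal (exp (- z * v)) * ennreal (exp (- z * (t - v)))"
      by (subst ennreal_mult[symmetric]) (auto simp: exp_add[symmetric] algebra_simps)
    then show "ennreal (exp (- z * t)) * (p v * g (t - v))
      = (ennreal (exp (- z * v)) * p v) * (ennreal (exp (- z * (t - v))) * g (t - v))"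
      by (simp add: mult_ac)
  qed
  also have "\<dots> = (\<integral>\<^sup>+v. (ennreal (exp (- z * v)) * p v) * laplace g z \<partial>lborel)"
  proof (intro nn_integral_cong)
    fix v
    have "(\<integral>\<^sup>+t. ennreal (exp (- z * (t - v))) * g (t - v) \<partial>lborel) = laplace g z"
      unfolding laplace_def
      by (rule nn_integral_lborel_shift[of "\<lambda>t. ennreal (exp (- z * t)) * g t"]) simp
    then show "(\<integral>\<^sup>+t. (ennreal (exp (- z * v)) * p v) * (ennreal (exp (- z * (t - v))) * g (t - v)) \<partial>lborel)
      = (ennreal (exp (- z * v)) * p v) * laplace g z"
      by (subst nn_integral_cmult) simp_all
  qed
  finally show ?thesis
    by (simp add: nn_integral_multc laplace_def)
qed

lemma laplace_indicator:
  assumes "0 < z"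
  shows "laplace (indicator {0..}) z = ennreal (1 / z)"
proof -
  have "(\<integral>\<^sup>+t. ennreal (exp (- z * t)) * indicator {0..} t \<partial>lborel) = ennreal (0 - (- (1 / z) * exp (- z * 0)))"
  proof (rule nn_integral_FTC_atLeast)
    show "((\<lambda>t. - (1 / z) * exp (- z * t)) \<longlongrightarrow> 0) at_top"
      using assms by real_asymp
    show "DERIV (\<lambda>t. - (1 / z) * exp (- z * t)) x :> exp (- z * x)" for x
      using assms by (auto intro!: derivative_eq_intros)
  qed auto
  then show ?thesis by (simp add: laplace_def)
qed

text \<open>Each convolution with \<open>p\<close> multiplies the transform by \<open>l\<close>, and
  the initial indicator contributes 1/z; the sum is a geometric series.\<close>

lemma laplace_renewal_fun:
  assumes [measurable]: "p \<in> borel_measurable borel" and "0 < z"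
    and l: "laplace p z = ennreal l" "0 \<le> l" "l < 1"
  shows "laplace (renewal_fun p) z = ennreal (1 / (z * (1 - l)))"
proof -
  have it: "laplace (renewal_iter p n) z = ennreal (l ^ n * (1 / z))" for n
  proof (induction n)
    case 0
    have "laplace (renewal_iter p 0) z = laplace (indicator {0..}) z"
      by (simp add: laplace_def)
    then show ?case using laplace_indicator[OF assms(2)] by simp
  next
    case (Suc n)
    have "laplace (renewal_iter p (Suc n)) z = laplace p z * laplace (renewal_iter p n) z"
      by (subst laplace_convolution[symmetric]) (simp_all add: laplace_def)
    also have "\<dots> = ennreal (l ^ Suc n * (1 / z))"
      using Suc l assms(2) by (simp add: ennreal_mult[symmetric])
    finally show ?case .
  qed
  have "laplace (renewal_fun p) z = (\<Sum>n. laplace (renewal_iter p n) z)"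
    unfolding laplace_def renewal_fun_def
    by (subst nn_integral_suminf[symmetric]) simp_all
  also have "\<dots> = ennreal (\<Sum>n. l ^ n * (1 / z))"
    unfolding it using l assms(2)
    by (intro suminf_ennreal2) (auto intro!: summable_divide summable_geometric)
  also have "(\<Sum>n. l ^ n * (1 / z)) = 1 / (z * (1 - l))"
    using l assms(2) by (subst suminf_mult2[symmetric]) (auto simp: suminf_geometric field_simps)
  finally show ?thesis .
qed

text \<open>A single transform value controls J everywhere: by monotonicity an infinite value at
  \<open>t\<close> would persist on all of [t, \<infinity>) and make the integral infinite.\<close>

lemma renewal_fun_finite:
  assumes [measurable]: "p \<in> borel_measurable borel" and "laplace (renewal_fun p) z < \<infinity>"
  shows "renewal_fun p t < \<infinity>"
proof (rule ccontr)
  assume "\<not> renewal_fun p t < \<infinity>"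
  then have inf: "renewal_fun p s = \<infinity>" if "t \<le> s" for s
    using monoD[OF mono_renewal_fun that, of p] by (simp add: less_top[symmetric] top_unique)
  have "AE s in lborel. ennreal (exp (- z * s)) * renewal_fun p s \<noteq> \<infinity>"
    using assms(2) by (intro nn_integral_noteq_infinite) (auto simp: laplace_def)
  then have "AE s in lborel. s \<notin> {t..t+1}"
    by eventually_elim (auto simp: inf ennreal_mult_eq_top_iff)
  then have "emeasure lborel {t..t+1} = 0"
    by (subst (asm) AE_iff_measurable[where N = "{t..t+1}"]) auto
  then show False by simp
qed

section \<open>Karamata's Tauberian theorem\<close>

text \<open>Polynomials are dense in the continuous functions on [0, 1], so convergence of moments
  passes to every continuous test function; the total masses, which multiply the approximation
  error, are controlled by the moments of order 0. The measures stay on their own space, and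
  \<open>X\<close> plays the role of a push-forward to [0, 1].\<close>

lemma moments_determine_limit:
  fixes M :: "'i \<Rightarrow> 'b measure" and X :: "'b \<Rightarrow> real" and g :: "real \<Rightarrow> real"
  assumes fin: "\<forall>\<^sub>F i in F. finite_measure (M i)" and finL: "finite_measure L"
    and XM: "\<And>i. X \<in> borel_measurable (M i)" and XL: "X \<in> borel_measurable L"
    and rM: "\<And>i. AE x in M i. X x \<in> {0..1}" and rL: "AE x in L. X x \<in> {0..1}"
    and mom: "\<And>n. ((\<lambda>i. \<integral>x. X x ^ n \<partial>M i) \<longlongrightarrow> (\<integral>x. X x ^ n \<partial>L)) F"
    and g: "continuous_on UNIV g"
  shows "((\<lambda>i. \<integral>x. g (X x) \<partial>M i) \<longlongrightarrow> (\<integral>x. g (X x) \<partial>L)) F"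
proof -
  have [measurable]: "g \<in> borel_measurable borel"
    using g by (rule borel_measurable_continuous_onI)
  have bounded_int: "integrable N (\<lambda>x. f (X x))"
    if "finite_measure N" "X \<in> borel_measurable N" "AE x in N. X x \<in> {0..1}" "continuous_on UNIV f"
    for N and f :: "real \<Rightarrow> real"
  proof -
    interpret finite_measure N by fact
    have [measurable]: "f \<in> borel_measurable borel" "X \<in> borel_measurable N"
      using that by (auto intro: borel_measurable_continuous_onI)
    have "compact (f ` {0..1})"
      by (intro compact_continuous_image continuous_on_subset[OF that(4)]) auto
    then obtain B where B: "\<And>u. u \<in> {0..1} \<Longrightarrow> norm (f u) \<le> B"
      by (meson bounded_iff compact_imp_bounded imageI)
    show ?thesis
      by (rule integrable_const_bound[where B = B]) (use that(3) B in auto)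
  qed
  \<comment> \<open>Exceeds the mass of \<open>L\<close>, and eventually that of \<open>M i\<close>,
    since the moments of order 0 converge.\<close>
  define C where "C = measure L (space L) + 1"
  have C: "C > 0" by (simp add: C_def add_nonneg_pos)
  have approx: "\<bar>(\<integral>x. g (X x) \<partial>N) - (\<integral>x. p (X x) \<partial>N)\<bar> \<le> d * measure N (space N)"
    if N: "finite_measure N" "X \<in> borel_measurable N" "AE x in N. X x \<in> {0..1}"
      and p: "continuous_on UNIV p" "\<And>u. u \<in> {0..1} \<Longrightarrow> \<bar>g u - p u\<bar> \<le> d"
    for N p d
  proof -
    interpret finite_measure N by fact
    have i: "integrable N (\<lambda>x. g (X x))" "integrable N (\<lambda>x. p (X x))"
      using N g p by (auto intro!: bounded_int)
    have "\<bar>(\<integral>x. g (X x) \<partial>N) - (\<integral>x. p (X x) \<partial>N)\<bar> = \<bar>\<integral>x. g (X x) - p (X x) \<partial>N\<bar>"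
      using i by simp
    also have "\<dots> \<le> (\<integral>x. \<bar>g (X x) - p (X x)\<bar> \<partial>N)"
      using integral_norm_bound[of N "\<lambda>x. g (X x) - p (X x)"] by simp
    also have "\<dots> \<le> (\<integral>x. d \<partial>N)"
      using i N(3) p(2) by (intro integral_mono_AE) auto
    finally show ?thesis by (simp add: mult.commute)
  qed
  show ?thesis
  proof (rule tendstoI)
    fix e :: real assume e: "e > 0"
    \<comment> \<open>Each of the two replacements of \<open>g\<close> by \<open>p\<close> costs at
      most \<open>d * C\<close>, a third of \<open>e\<close>; the last third is for the moments of
      \<open>p\<close>.\<close>
    define d where "d = e / (3 * C)"
    have d: "d > 0" using e C by (simp add: d_def)
    obtain p where p: "real_polynomial_function p" "\<And>u. u \<in> {0..1} \<Longrightarrow> \<bar>g u - p u\<bar> < d"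
      using Stone_Weierstrass_real_polynomial_function[of "{0..1::real}" g d] d
        continuous_on_subset[OF g] by auto
    obtain a n where pa: "p = (\<lambda>x. \<Sum>i\<le>n. a i * x ^ i)"
      using p(1) real_polynomial_function_iff_sum by blast
    have pc: "continuous_on UNIV p"
      unfolding pa by (intro continuous_intros)
    have p_int: "(\<integral>x. p (X x) \<partial>N) = (\<Sum>i\<le>n. a i * (\<integral>x. X x ^ i \<partial>N))"
      if "finite_measure N" "X \<in> borel_measurable N" "AE x in N. X x \<in> {0..1}" for N
    proof -
      have "integrable N (\<lambda>x. X x ^ i)" for i
        using that by (intro bounded_int[of N "\<lambda>u. u ^ i"]) (auto intro!: continuous_intros)
      then show ?thesis
        unfolding pa by (subst Bochner_Integration.integral_sum) auto
    qed
    have "((\<lambda>i. \<Sum>k\<le>n. a k * (\<integral>x. X x ^ k \<partial>M i)) \<longlongrightarrow> (\<Sum>k\<le>n. a k * (\<integral>x. X x ^ k \<partial>L))) F"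
      by (intro tendsto_intros mom)
    then have "\<forall>\<^sub>F i in F. dist (\<Sum>k\<le>n. a k * (\<integral>x. X x ^ k \<partial>M i)) (\<Sum>k\<le>n. a k * (\<integral>x. X x ^ k \<partial>L)) < e / 3"
      using e by (intro tendstoD) auto
    moreover have "\<forall>\<^sub>F i in F. dist (\<integral>x. X x ^ 0 \<partial>M i) (\<integral>x. X x ^ 0 \<partial>L) < 1"
      by (intro tendstoD mom) auto
    ultimately show "\<forall>\<^sub>F i in F. dist (\<integral>x. g (X x) \<partial>M i) (\<integral>x. g (X x) \<partial>L) < e"
      using fin
    proof eventually_elim
      case (elim i)
      have mass: "measure (M i) (space (M i)) < C"
        using elim(2) by (auto simp: C_def dist_real_def)
      have 1: "\<bar>(\<integral>x. g (X x) \<partial>M i) - (\<integral>x. p (X x) \<partial>M i)\<bar> \<le> d * measure (M i) (space (M i))"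
        by (rule approx[OF elim(3) XM rM pc]) (use p(2) in \<open>auto intro: less_imp_le\<close>)
      have 2: "\<bar>(\<integral>x. g (X x) \<partial>L) - (\<integral>x. p (X x) \<partial>L)\<bar> \<le> d * measure L (space L)"
        by (rule approx[OF finL XL rL pc]) (use p(2) in \<open>auto intro: less_imp_le\<close>)
      have 3: "\<bar>(\<integral>x. p (X x) \<partial>M i) - (\<integral>x. p (X x) \<partial>L)\<bar> < e / 3"
        using elim(1) p_int[OF elim(3) XM rM] p_int[OF finL XL rL] by (simp add: dist_real_def)
      have "d * measure (M i) (space (M i)) \<le> d * C" "d * measure L (space L) \<le> d * C"
        using d mass by (auto simp: C_def)
      moreover have "d * C = e / 3" using C by (simp add: d_def)
      ultimately show ?case using 1 2 3 unfolding dist_real_def by linarith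
    qed
  qed
qed

lemma has_bochner_integral_exp_powr:
  fixes a \<alpha> :: real
  assumes "0 < a" "0 \<le> \<alpha>"
  shows "has_bochner_integral lborel (\<lambda>x. indicator {0..} x * (exp (- (a * x)) * x powr \<alpha>))
    (Gamma (1 + \<alpha>) / a powr (1 + \<alpha>))"
proof (rule has_bochner_integral_nn_integral)
  have "(\<integral>\<^sup>+x. ennreal (indicator {0..} x * (exp (- (a * x)) * x powr \<alpha>)) \<partial>lborel)
      = ennreal (1 / a) * (\<integral>\<^sup>+y. ennreal (indicator {0..} (y / a) * (exp (- y) * (y / a) powr \<alpha>)) \<partial>lborel)"
    using nn_integral_real_affine[of "\<lambda>x. ennreal (indicator {0..} x * (exp (- (a * x)) * x powr \<alpha>))" "1 / a" 0] assms
    by simp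
  also have "(\<integral>\<^sup>+y. ennreal (indicator {0..} (y / a) * (exp (- y) * (y / a) powr \<alpha>)) \<partial>lborel)
    = (\<integral>\<^sup>+y. ennreal (1 / a powr \<alpha>) * ennreal (indicator {0..} y * y powr (1 + \<alpha> - 1) / exp y) \<partial>lborel)"
    using assms
    by (intro nn_integral_cong)
      (auto simp: indicator_def ennreal_mult[symmetric] powr_divide exp_minus field_simps zero_le_divide_iff)
  also have "\<dots> = ennreal (1 / a powr \<alpha>) * ennreal (Gamma (1 + \<alpha>))"
    using Gamma_conv_nn_integral_real[of "1 + \<alpha>"] assms by (subst nn_integral_cmult) auto
  finally show "(\<integral>\<^sup>+x. ennreal (indicator {0..} x * (exp (- (a * x)) * x powr \<alpha>)) \<partial>lborel)
      = ennreal (Gamma (1 + \<alpha>) / a powr (1 + \<alpha>))"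
    using assms by (simp add: ennreal_mult[symmetric] Gamma_real_pos less_imp_le powr_add mult.commute)
qed (use assms in \<open>auto simp: Gamma_real_pos less_imp_le\<close>)

text \<open>A parabola arc, positive exactly between its roots \<open>a\<close> and
  \<open>b\<close>: a continuous substitute for the indicator of an interval, to which polynomial
  approximation applies.\<close>

definition bump :: "real \<Rightarrow> real \<Rightarrow> real \<Rightarrow> real" where
  "bump a b u = max 0 ((u - a) * (b - u))"

text \<open>With u = exp(-x), the hypothesis \<open>lim\<close> says that the measures with density
  exp(-x) j(Tx)/h(T) have asymptotically the same moments in u as c x^\<alpha> exp(-x). By
  \<open>moments_determine_limit\<close>, weighted averages of j(Tx)/h(T) over short intervals next
  to x = 1 converge, and monotonicity of \<open>j\<close> squeezes j(T)/h(T) between averages to the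
  left and to the right of 1.\<close>

theorem karamata_monotone:
  fixes j h :: "real \<Rightarrow> real" and c \<alpha> :: real
  assumes j: "mono j" "\<And>t. 0 \<le> j t" and \<alpha>: "0 \<le> \<alpha>" and c: "0 \<le> c" and h: "\<And>T. 0 < T \<Longrightarrow> 0 < h T"
    and int: "\<And>T n. 0 < T \<Longrightarrow> integrable lborel (\<lambda>x. indicator {0..} x * (exp (- (real (Suc n) * x)) * j (T * x)))"
    and lim: "\<And>n. ((\<lambda>T. (LBINT x. indicator {0..} x * (exp (- (real (Suc n) * x)) * j (T * x))) / h T)
        \<longlongrightarrow> c * (Gamma (1 + \<alpha>) / real (Suc n) powr (1 + \<alpha>))) at_top"
  shows "((\<lambda>T. j T / h T) \<longlongrightarrow> c) at_top"
proof -
  have [measurable]: "j \<in> borel_measurable borel"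
    using j(1) by (rule borel_measurable_mono)
  \<comment> \<open>One factor exp(-x) belongs to the measure, so its n-th moment in exp(-x) is a
    transform at n + 1; this is why \<open>Suc n\<close> appears in the hypotheses.\<close>
  define w where "w g x = indicator {0..} x * (exp (- x) * g (exp (- x)))" for g :: "real \<Rightarrow> real" and x :: real
  have w_meas [measurable]: "w g \<in> borel_measurable borel" if "g \<in> borel_measurable borel" for g
    using that unfolding w_def by measurable
  \<comment> \<open>The absolute value keeps the density nonnegative for every \<open>T\<close>;
    \<open>h\<close> is known to be positive for positive \<open>T\<close> only.\<close>
  define M where "M T = density lborel (\<lambda>x. ennreal (indicator {0..} x * (exp (- x) * (j (T * x) / \<bar>h T\<bar>))))" for T
  define L where "L = density lborel (\<lambda>x. ennreal (indicator {0..} x * (exp (- x) * (c * x powr \<alpha>))))"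
  have M_int: "(\<integral>x. g (exp (- x)) \<partial>M T) = (LBINT x. w g x * j (T * x)) / \<bar>h T\<bar>"
    if [measurable]: "g \<in> borel_measurable borel" for g T
    unfolding M_def using j
    by (subst integral_density) (auto simp: w_def mult_ac)
  have L_int: "(\<integral>x. g (exp (- x)) \<partial>L) = c * (LBINT x. w g x * x powr \<alpha>)"
    if [measurable]: "g \<in> borel_measurable borel" for g
    unfolding L_def using c
    by (subst integral_density) (auto simp: w_def mult_ac simp flip: integral_mult_right_zero)
  have w_power: "w (\<lambda>u. u ^ n) x = indicator {0..} x * exp (- (real (Suc n) * x))" for n x
    by (simp add: w_def algebra_simps flip: exp_of_nat_mult exp_add)
  have M_fin: "finite_measure (M T)" if "0 < T" for T
  proof
    have "integrable lborel (\<lambda>x. (indicator {0..} x * (exp (- (real (Suc 0) * x)) * j (T * x))) / \<bar>h T\<bar>)"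
      by (intro integrable_divide int that)
    then have "(\<integral>\<^sup>+x. ennreal (indicator {0..} x * (exp (- x) * (j (T * x) / \<bar>h T\<bar>))) \<partial>lborel) < \<infinity>"
      by (subst (asm) integrable_iff_bounded) (use j in \<open>simp add: abs_mult\<close>)
    then show "emeasure (M T) (space (M T)) \<noteq> \<infinity>"
      by (simp add: M_def emeasure_density)
  qed
  have L_fin: "finite_measure L"
  proof
    have "integrable lborel (\<lambda>x. c * (indicator {0..} x * (exp (- (1 * x)) * x powr \<alpha>)))"
      using has_bochner_integral_exp_powr[of 1 \<alpha>] \<alpha>
      by (intro integrable_mult_right) (auto simp: has_bochner_integral_iff)
    then have "(\<integral>\<^sup>+x. ennreal (indicator {0..} x * (exp (- x) * (c * x powr \<alpha>))) \<partial>lborel) < \<infinity>"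
      by (subst (asm) integrable_iff_bounded) (use c in \<open>simp add: abs_mult mult_ac\<close>)
    then show "emeasure L (space L) \<noteq> \<infinity>"
      by (simp add: L_def emeasure_density)
  qed
  have conv: "((\<lambda>T. (LBINT x. w g x * j (T * x)) / h T) \<longlongrightarrow> c * (LBINT x. w g x * x powr \<alpha>)) at_top"
    if g: "continuous_on UNIV g" for g
  proof -
    have [measurable]: "g \<in> borel_measurable borel"
      using g by (rule borel_measurable_continuous_onI)
    have "((\<lambda>T. \<integral>x. g (exp (- x)) \<partial>M T) \<longlongrightarrow> (\<integral>x. g (exp (- x)) \<partial>L)) at_top"
    proof (rule moments_determine_limit[OF _ L_fin _ _ _ _ _ g])
      show "\<forall>\<^sub>F T in at_top. finite_measure (M T)"
        using eventually_gt_at_top[of 0] by eventually_elim (rule M_fin)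
      show "AE x in M T. exp (- x) \<in> {0..1}" for T
        unfolding M_def by (subst AE_density) (auto intro!: AE_I2 simp: indicator_def)
      show "AE x in L. exp (- x) \<in> {0..1}"
        unfolding L_def by (subst AE_density) (auto intro!: AE_I2 simp: indicator_def)
      fix n
      have "\<forall>\<^sub>F T in at_top. (LBINT x. indicator {0..} x * (exp (- (real (Suc n) * x)) * j (T * x))) / h T
          = (\<integral>x. exp (- x) ^ n \<partial>M T)"
        using eventually_gt_at_top[of 0]
      proof eventually_elim
        case (elim T)
        then show ?case
          using h[of T] M_int[of "\<lambda>u. u ^ n" T] by (simp add: w_power mult.assoc)
      qed
      moreover have "c * (Gamma (1 + \<alpha>) / real (Suc n) powr (1 + \<alpha>)) = (\<integral>x. exp (- x) ^ n \<partial>L)"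
        using has_bochner_integral_exp_powr[of "real (Suc n)" \<alpha>] \<alpha> L_int[of "\<lambda>u. u ^ n"]
        by (simp add: w_power has_bochner_integral_iff mult.assoc)
      ultimately show "((\<lambda>T. \<integral>x. exp (- x) ^ n \<partial>M T) \<longlongrightarrow> (\<integral>x. exp (- x) ^ n \<partial>L)) at_top"
        using lim[of n] by (auto elim!: Lim_transform_eventually)
    qed (auto simp: M_def L_def)
    moreover have "\<forall>\<^sub>F T in at_top. (\<integral>x. g (exp (- x)) \<partial>M T) = (LBINT x. w g x * j (T * x)) / h T"
      using eventually_gt_at_top[of 0]
    proof eventually_elim
      case (elim T)
      then show ?case using h[of T] M_int[of g T] by simp
    qed
    moreover have "(\<integral>x. g (exp (- x)) \<partial>L) = c * (LBINT x. w g x * x powr \<alpha>)"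
      by (rule L_int) simp
    ultimately show ?thesis
      by (simp add: Lim_transform_eventually)
  qed
  \<comment> \<open>On (r, s) the values j(Tx) lie between j(rT) and j(sT), and \<open>W\<close> is
    the total weight of the bump. The case s = 1 gives the lower bound on j(T), the case r = 1 the
    upper one.\<close>
  have sandwich: "\<exists>W I J. W > 0 \<and> (I \<longlongrightarrow> J) at_top \<and> c * r powr \<alpha> * W \<le> J \<and> J \<le> c * s powr \<alpha> * W \<and>
      (\<forall>T>0. j (r * T) / h T * W \<le> I T \<and> I T \<le> j (s * T) / h T * W)" if rs: "0 < r" "r < s" for r s
  proof -
    \<comment> \<open>The endpoints are swapped because exp(-x) decreases in x; as a function of
      \<open>x\<close> the bump lives on (r, s).\<close>
    define g where "g = bump (exp (- s)) (exp (- r))"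
    have g: "continuous_on UNIV g"
      unfolding g_def bump_def by (intro continuous_intros)
    have [measurable]: "g \<in> borel_measurable borel"
      using g by (rule borel_measurable_continuous_onI)
    have g_nonneg: "0 \<le> w g x" for x by (simp add: w_def g_def bump_def)
    have g_supp: "r < x \<and> x < s" if "w g x \<noteq> 0" for x
    proof (rule ccontr)
      assume "\<not> (r < x \<and> x < s)"
      then have "(exp (- x) - exp (- s)) * (exp (- r) - exp (- x)) \<le> 0"
        using rs by (auto simp: mult_le_0_iff)
      then show False using that by (simp add: w_def g_def bump_def)
    qed
    have g_pos: "0 < w g x" if "r < x" "x < s" for x
      using that rs by (auto simp: w_def g_def bump_def less_max_iff_disj)
    have gb: "w g x \<le> indicator {r..s} x" for x
    proof (cases "r < x \<and> x < s")
      case True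
      then have "exp (- x) \<le> 1" "exp (- r) \<le> 1" using rs by auto
      then have "exp (- x) - exp (- s) \<le> 1" "exp (- r) - exp (- x) \<le> 1"
        by (smt (verit) exp_gt_zero)+
      then have "(exp (- x) - exp (- s)) * (exp (- r) - exp (- x)) \<le> 1 * 1"
        using rs True by (intro mult_mono) auto
      then have "exp (- x) * g (exp (- x)) \<le> 1 * 1"
        using True rs by (intro mult_mono) (auto simp: g_def bump_def)
      then show ?thesis using True rs by (auto simp: w_def)
    next
      case False
      then have "w g x = 0" using g_supp[of x] by blast
      then show ?thesis by simp
    qed
    have bint: "integrable lborel (\<lambda>x. w g x * f x)"
      if [measurable]: "f \<in> borel_measurable borel" and B: "\<And>x. r \<le> x \<Longrightarrow> x \<le> s \<Longrightarrow> \<bar>f x\<bar> \<le> B" for f :: "real \<Rightarrow> real" and B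
    proof (rule Bochner_Integration.integrable_bound)
      show "integrable lborel (\<lambda>x. B * indicator {r..s} x)"
        using rs by (intro integrable_mult_right integrable_real_indicator) auto
      have "norm (w g x * f x) \<le> norm (B * indicator {r..s} x)" for x
      proof (cases "w g x = 0")
        case False
        with g_supp[of x] have "r \<le> x" "x \<le> s" by auto
        then have "\<bar>w g x\<bar> * \<bar>f x\<bar> \<le> 1 * B"
          using B[of x] gb[of x] g_nonneg[of x] by (intro mult_mono) auto
        then show ?thesis using \<open>r \<le> x\<close> \<open>x \<le> s\<close> by (simp add: abs_mult)
      qed simp
      then show "AE x in lborel. norm (w g x * f x) \<le> norm (B * indicator {r..s} x)" by simp
    qed simp
    have i1: "integrable lborel (w g)" using bint[of "\<lambda>_. 1" 1] by simp
    define W where "W = (LBINT x. w g x)"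
    have "W \<noteq> 0"
    proof
      assume "W = 0"
      then have "AE x in lborel. w g x = 0"
        using integral_nonneg_eq_0_iff_AE[OF i1] g_nonneg by (simp add: W_def)
      then have "AE x in lborel. x \<notin> {r<..<s}"
        by eventually_elim (use g_pos in force)
      then have "emeasure lborel {r<..<s} = 0"
        by (subst (asm) AE_iff_measurable[where N = "{r<..<s}"]) auto
      then show False using rs by simp
    qed
    then have W: "W > 0"
      using g_nonneg by (simp add: W_def less_le integral_nonneg_AE)
    have mono_int: "(LBINT x. w g x * f1 x) \<le> (LBINT x. w g x * f2 x)"
      if "integrable lborel (\<lambda>x. w g x * f1 x)" "integrable lborel (\<lambda>x. w g x * f2 x)"
        "\<And>x. r \<le> x \<Longrightarrow> x \<le> s \<Longrightarrow> f1 x \<le> f2 x" for f1 f2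
    proof (rule integral_mono[OF that(1,2)])
      show "w g x * f1 x \<le> w g x * f2 x" for x
      proof (cases "w g x = 0")
        case False
        with g_supp[of x] that(3)[of x] g_nonneg[of x] show ?thesis by (intro mult_left_mono) auto
      qed simp
    qed
    have cst: "(LBINT x. w g x * k) = k * W" "integrable lborel (\<lambda>x. w g x * k)" for k
      using i1 by (auto simp: W_def mult.commute)
    define J where "J = (LBINT x. w g x * x powr \<alpha>)"
    have ip: "integrable lborel (\<lambda>x. w g x * x powr \<alpha>)"
      by (rule bint[where B = "s powr \<alpha>"]) (use rs \<alpha> in \<open>auto intro!: powr_mono2\<close>)
    have "r powr \<alpha> * W \<le> J" "J \<le> s powr \<alpha> * W"
      using mono_int[OF cst(2) ip, of "r powr \<alpha>"] mono_int[OF ip cst(2), of "s powr \<alpha>"] rs \<alpha>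
      by (simp_all add: W_def J_def powr_mono2 mult.commute)
    then have J: "c * r powr \<alpha> * W \<le> c * J" "c * J \<le> c * s powr \<alpha> * W"
      using c by (auto simp: mult.assoc intro!: mult_left_mono)
    define I where "I T = (LBINT x. w g x * j (T * x))" for T
    have "j (r * T) / h T * W \<le> I T / h T \<and> I T / h T \<le> j (s * T) / h T * W" if T: "T > 0" for T
    proof -
      have ij: "integrable lborel (\<lambda>x. w g x * j (T * x))"
        by (rule bint[where B = "j (T * s)"]) (use j T in \<open>auto intro!: monoD[OF j(1)]\<close>)
      have "j (r * T) * W \<le> I T" "I T \<le> j (s * T) * W"
        using mono_int[OF cst(2) ij, of "j (r * T)"] mono_int[OF ij cst(2), of "j (s * T)"] T
        by (simp_all add: W_def I_def monoD[OF j(1)] mult.commute)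
      then show ?thesis using h[OF T] by (auto simp: divide_right_mono)
    qed
    moreover have "((\<lambda>T. I T / h T) \<longlongrightarrow> c * J) at_top"
      unfolding I_def J_def by (rule conv[OF g])
    ultimately show ?thesis using W J by blast
  qed
  show ?thesis
  proof (rule order_tendstoI)
    fix y assume y: "y < c"
    have "((\<lambda>x. c * x powr \<alpha>) \<longlongrightarrow> c * 1 powr \<alpha>) (at_left 1)"
      by (intro tendsto_intros) auto
    then have "\<forall>\<^sub>F x in at_left 1. y < c * x powr \<alpha>"
      using y by (intro order_tendstoD) auto
    moreover have "\<forall>\<^sub>F x in at_left (1::real). 0 < x" "\<forall>\<^sub>F x in at_left (1::real). x < 1"
      by (rule eventually_at_leftI[of "0::real"]; simp) (rule eventually_at_leftI[of "0::real"]; simp)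
    ultimately have "\<forall>\<^sub>F x in at_left 1. y < c * x powr \<alpha> \<and> 0 < x \<and> x < 1"
      by eventually_elim auto
    then obtain r where r: "y < c * r powr \<alpha>" "0 < r" "r < 1"
      using eventually_happens[of _ "at_left (1::real)"] by auto
    obtain W I J where WIJ: "W > 0" "(I \<longlongrightarrow> J) at_top" "c * r powr \<alpha> * W \<le> J"
      "\<And>T. T > 0 \<Longrightarrow> I T \<le> j (1 * T) / h T * W"
      using sandwich[OF r(2,3)] by blast
    have "y * W < J"
      using r(1) WIJ(1,3) by (smt (verit) mult_strict_right_mono)
    then have "\<forall>\<^sub>F T in at_top. y * W < I T"
      using WIJ(2) by (rule order_tendstoD(1)[rotated])
    then show "\<forall>\<^sub>F T in at_top. y < j T / h T"
      using eventually_gt_at_top[of 0]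
    proof eventually_elim
      case (elim T)
      then have "y * W < j T / h T * W" using WIJ(4)[of T] by simp
      then show ?case using WIJ(1) mult_less_cancel_right_pos by blast
    qed
  next
    fix y assume y: "c < y"
    have "((\<lambda>x. c * x powr \<alpha>) \<longlongrightarrow> c * 1 powr \<alpha>) (at_right 1)"
      by (intro tendsto_intros) auto
    then have "\<forall>\<^sub>F x in at_right 1. c * x powr \<alpha> < y"
      using y by (intro order_tendstoD) auto
    moreover have "\<forall>\<^sub>F x in at_right (1::real). 1 < x"
      by (rule eventually_at_rightI[of _ "2::real"]; simp)
    ultimately have "\<forall>\<^sub>F x in at_right 1. c * x powr \<alpha> < y \<and> 1 < x"
      by eventually_elim auto
    then obtain s where s: "c * s powr \<alpha> < y" "1 < s"
      using eventually_happens[of _ "at_right (1::real)"] by auto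
    obtain W I J where WIJ: "W > 0" "(I \<longlongrightarrow> J) at_top" "J \<le> c * s powr \<alpha> * W"
      "\<And>T. T > 0 \<Longrightarrow> j (1 * T) / h T * W \<le> I T"
      using sandwich[OF _ s(2)] by (metis zero_less_one)
    have "J < y * W"
      using s(1) WIJ(1,3) by (smt (verit) mult_strict_right_mono)
    then have "\<forall>\<^sub>F T in at_top. I T < y * W"
      using WIJ(2) by (rule order_tendstoD(2)[rotated])
    then show "\<forall>\<^sub>F T in at_top. j T / h T < y"
      using eventually_gt_at_top[of 0]
    proof eventually_elim
      case (elim T)
      then have "j T / h T * W < y * W" using WIJ(4)[of T] by simp
      then show ?case using WIJ(1) mult_less_cancel_right_pos by blast
    qed
  qed
qed

section \<open>Growth of the renewal function\<close>

locale hawkes_kernel =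
  fixes \<phi> :: "real \<Rightarrow> real"
  assumes phi_integrable: "integrable lborel \<phi>"
    and phi_nonneg: "\<And>s. 0 \<le> \<phi> s"
    and phi_zero: "\<And>s. s \<le> 0 \<Longrightarrow> \<phi> s = 0"
    and phi_mass: "(LBINT s. \<phi> s) \<le> 1"
    and phi_pos: "(LBINT s. \<phi> s) > 0"
begin

definition mass :: real where
  "mass = (LBINT s. \<phi> s)"

definition tail :: "real \<Rightarrow> real" where
  "tail t = (LBINT s. indicator {t..} s * \<phi> s)"

definition lap :: "real \<Rightarrow> real" where
  "lap z = (LBINT s. exp (- z * s) * \<phi> s)"

text \<open>The primitive of \<open>t \<mapsto> 1 - \<integral>\<^sub>0\<^sup>t \<phi>\<close>.\<close>

definition K :: "real \<Rightarrow> real" where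
  "K t = (1 - mass) * t + (LBINT s. \<phi> s * min s t)"

lemma phi_measurable [measurable]: "\<phi> \<in> borel_measurable borel"
  using phi_integrable by auto

lemma mass: "mass \<le> 1" "0 < mass"
  using phi_mass phi_pos by (auto simp: mass_def)

lemma integrable_phi_times:
  assumes [measurable]: "f \<in> borel_measurable borel" and B: "\<And>s. 0 < s \<Longrightarrow> \<bar>f s\<bar> \<le> B"
  shows "integrable lborel (\<lambda>s. f s * \<phi> s)"
proof (rule Bochner_Integration.integrable_bound)
  show "integrable lborel (\<lambda>s. B * \<phi> s)"
    using phi_integrable by simp
  have "norm (f s * \<phi> s) \<le> norm (B * \<phi> s)" for s
  proof (cases "s \<le> 0")
    case False
    then have "\<bar>f s\<bar> * \<phi> s \<le> \<bar>B\<bar> * \<phi> s"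
      using B[of s] phi_nonneg by (intro mult_right_mono) auto
    then show ?thesis using phi_nonneg by (simp add: abs_mult)
  qed (simp add: phi_zero)
  then show "AE s in lborel. norm (f s * \<phi> s) \<le> norm (B * \<phi> s)" by simp
qed simp

lemma integrable_phi_min: "0 \<le> t \<Longrightarrow> integrable lborel (\<lambda>s. \<phi> s * min s t)"
  using integrable_phi_times[of "\<lambda>s. min s t" t] by (simp add: mult.commute)

lemma phi_min_nonneg: "0 \<le> t \<Longrightarrow> 0 \<le> \<phi> s * min s t"
  using phi_nonneg[of s] phi_zero[of s] by (cases "s \<le> 0") auto

lemma K_integral_nonneg: "0 \<le> t \<Longrightarrow> 0 \<le> (LBINT s. \<phi> s * min s t)"
  by (intro integral_nonneg_AE AE_I2 phi_min_nonneg)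

lemma K_pos:
  assumes "0 < t"
  shows "0 < K t"
proof -
  have "(LBINT s. \<phi> s * min s t) \<noteq> 0"
  proof
    assume "(LBINT s. \<phi> s * min s t) = 0"
    then have "AE s in lborel. \<phi> s * min s t = 0"
      using integral_nonneg_eq_0_iff_AE[OF integrable_phi_min[of t]] phi_min_nonneg[of t] assms by auto
    then have "AE s in lborel. \<phi> s = 0"
      by eventually_elim (use phi_zero assms in \<open>force simp: min_def split: if_splits\<close>)
    then have "mass = 0"
      unfolding mass_def by (rule integral_eq_zero_AE)
    then show False using mass by simp
  qed
  then have "0 < (LBINT s. \<phi> s * min s t)"
    using K_integral_nonneg[of t] assms by simp
  then show ?thesis
    using mass assms by (simp add: K_def add_nonneg_pos)
qed

lemma K_nonneg: "0 \<le> t \<Longrightarrow> 0 \<le> K t"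
  using mass K_integral_nonneg[of t] by (simp add: K_def)

text \<open>On the support of \<phi> one has min(s, Tx) \<le> max(1, x) min(s, T). This provides the
  dominating function in \<open>abelian\<close>.\<close>

lemma K_scale:
  assumes "0 \<le> T" "0 \<le> x"
  shows "K (T * x) \<le> max 1 x * K T"
proof -
  have "(LBINT s. \<phi> s * min s (T * x)) \<le> (LBINT s. max 1 x * (\<phi> s * min s T))"
  proof (rule integral_mono)
    fix s
    show "\<phi> s * min s (T * x) \<le> max 1 x * (\<phi> s * min s T)"
    proof (cases "s \<le> 0")
      case False
      have "1 * s \<le> max 1 x * s" "x * T \<le> max 1 x * T"
        using False assms by (intro mult_right_mono; simp)+
      then have "min s (T * x) \<le> max 1 x * min s T"
        by (simp add: min_def mult.commute)
      then have "\<phi> s * min s (T * x) \<le> \<phi> s * (max 1 x * min s T)"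
        using phi_nonneg by (rule mult_left_mono)
      then show ?thesis by (simp add: mult_ac)
    qed (simp add: phi_zero)
  qed (use assms integrable_phi_min[of "T * x"] integrable_phi_min[of T] in auto)
  moreover have "(1 - mass) * (T * x) \<le> max 1 x * ((1 - mass) * T)"
    using mass assms mult_left_mono[of x "max 1 x" "(1 - mass) * T"] by (simp add: mult_ac)
  ultimately show ?thesis
    by (simp add: K_def distrib_left)
qed

lemma K_mono:
  assumes "0 \<le> a" "a \<le> b"
  shows "K a \<le> K b"
proof -
  have "(LBINT s. \<phi> s * min s a) \<le> (LBINT s. \<phi> s * min s b)"
    using assms phi_nonneg by (intro integral_mono integrable_phi_min mult_left_mono) auto
  then show ?thesis
    using mass assms mult_left_mono[of a b "1 - mass"] by (simp add: K_def)
qed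

lemma K_measurable [measurable]: "(\<lambda>x. K (f x)) \<in> borel_measurable borel"
  if [measurable]: "f \<in> borel_measurable borel" for f :: "real \<Rightarrow> real"
  unfolding K_def by measurable

lemma lap_integrable: "0 < z \<Longrightarrow> integrable lborel (\<lambda>s. exp (- z * s) * \<phi> s)"
  by (rule integrable_phi_times[where B = 1]) auto

lemma lap_nonneg: "0 \<le> lap z"
  unfolding lap_def by (intro integral_nonneg_AE AE_I2) (simp add: phi_nonneg)

text \<open>The integral is cut at the kink t = s, and both pieces have explicit primitives.\<close>

lemma nn_integral_exp_min:
  assumes "0 < z" "0 \<le> s"
  shows "(\<integral>\<^sup>+t. ennreal (indicator {0..} t * (exp (- z * t) * min s t)) \<partial>lborel)
    = ennreal ((1 - exp (- z * s)) / z ^ 2)"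
proof -
  have "(\<integral>\<^sup>+t. ennreal (indicator {0..} t * (exp (- z * t) * min s t)) \<partial>lborel)
      = (\<integral>\<^sup>+t. ennreal (exp (- z * t) * t) * indicator {0..s} t + ennreal (exp (- z * t) * s) * indicator {s..} t \<partial>lborel)"
  proof (intro nn_integral_cong_AE)
    have "AE t in lborel. t \<noteq> s" by (rule AE_lborel_singleton)
    then show "AE t in lborel. ennreal (indicator {0..} t * (exp (- z * t) * min s t))
      = ennreal (exp (- z * t) * t) * indicator {0..s} t + ennreal (exp (- z * t) * s) * indicator {s..} t"
      by eventually_elim (use assms in \<open>auto simp: indicator_def min_def\<close>)
  qed
  also have "\<dots> = (\<integral>\<^sup>+t. ennreal (exp (- z * t) * t) * indicator {0..s} t \<partial>lborel)
      + (\<integral>\<^sup>+t. ennreal (exp (- z * t) * s) * indicator {s..} t \<partial>lborel)"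
    by (rule nn_integral_add) auto
  also have "(\<integral>\<^sup>+t. ennreal (exp (- z * t) * t) * indicator {0..s} t \<partial>lborel)
      = ennreal (- (s / z + 1 / z ^ 2) * exp (- z * s) - (- (0 / z + 1 / z ^ 2) * exp (- z * 0)))"
  proof (rule nn_integral_FTC_Icc[where F = "\<lambda>t. - (t / z + 1 / z ^ 2) * exp (- z * t)"])
    show "DERIV (\<lambda>t. - (t / z + 1 / z ^ 2) * exp (- z * t)) x :> exp (- z * x) * x" for x :: real
      using assms by (auto intro!: derivative_eq_intros simp: field_simps power2_eq_square)
  qed (use assms in auto)
  also have "(\<integral>\<^sup>+t. ennreal (exp (- z * t) * s) * indicator {s..} t \<partial>lborel)
      = ennreal (0 - (- (s / z) * exp (- z * s)))"
  proof (rule nn_integral_FTC_atLeast[where F = "\<lambda>t. - (s / z) * exp (- z * t)"])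
    show "((\<lambda>t. - (s / z) * exp (- z * t)) \<longlongrightarrow> 0) at_top"
      using assms by real_asymp
    show "DERIV (\<lambda>t. - (s / z) * exp (- z * t)) x :> exp (- z * x) * s" for x
      using assms by (auto intro!: derivative_eq_intros simp: field_simps)
  qed (use assms in auto)
  also have "ennreal (- (s / z + 1 / z ^ 2) * exp (- z * s) - (- (0 / z + 1 / z ^ 2) * exp (- z * 0)))
      + ennreal (0 - (- (s / z) * exp (- z * s))) = ennreal ((1 - exp (- z * s)) / z ^ 2)"
  proof (subst ennreal_plus[symmetric])
    \<comment> \<open>Adding the two values in \<open>ennreal\<close> requires both to be
      nonnegative; for the first one this is the inequality (1 + zs) exp(-zs) \<le> 1.\<close>
    have "exp (- z * s) * (1 + z * s) \<le> exp (- z * s) * exp (z * s)"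
      using exp_ge_add_one_self[of "z * s"] by (intro mult_left_mono) auto
    then have "exp (- z * s) * (1 + z * s) \<le> 1"
      by (simp add: exp_add[symmetric])
    then have "(exp (- z * s) * (1 + z * s)) / z ^ 2 \<le> 1 / z ^ 2"
      using assms by (intro divide_right_mono) auto
    moreover have "(exp (- z * s) * (1 + z * s)) / z ^ 2 = (s / z + 1 / z ^ 2) * exp (- z * s)"
      using assms by (simp add: field_simps power2_eq_square)
    ultimately show "0 \<le> - (s / z + 1 / z ^ 2) * exp (- z * s) - (- (0 / z + 1 / z ^ 2) * exp (- z * 0))"
      by (simp add: distrib_right left_diff_distrib)
  qed (use assms in \<open>auto simp: field_simps\<close>)
  finally show ?thesis .
qed

text \<open>The linear part contributes (1 - mass)/z^2, and Tonelli's theorem with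
  \<open>nn_integral_exp_min\<close> gives (mass - lap z)/z^2 for the rest. The mass cancels, so the
  formula has the same shape in all regimes.\<close>

lemma laplace_K:
  assumes "0 < z"
  shows "has_bochner_integral lborel (\<lambda>t. indicator {0..} t * (exp (- z * t) * K t)) ((1 - lap z) / z ^ 2)"
proof (rule has_bochner_integral_nn_integral)
  let ?M = "\<lambda>t. \<integral>\<^sup>+s. ennreal (\<phi> s * min s t) \<partial>lborel"
    and ?e = "\<lambda>t. ennreal (indicator {0..} t * exp (- z * t))"
    and ?g = "\<lambda>t. ennreal (indicator {0..} t * (exp (- (z * t)) * t powr 1))"
    and ?h = "\<lambda>s. (1 - exp (- z * s)) / z ^ 2"
  have l: "lap z \<le> mass"
    unfolding lap_def mass_def
  proof (intro integral_mono lap_integrable phi_integrable assms)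
    fix s
    show "exp (- z * s) * \<phi> s \<le> \<phi> s"
      using assms phi_nonneg[of s] phi_zero[of s] by (cases "s \<le> 0") (auto intro!: mult_left_le_one_le)
  qed
  have "(\<integral>\<^sup>+t. ennreal (indicator {0..} t * (exp (- z * t) * K t)) \<partial>lborel)
      = (\<integral>\<^sup>+t. ennreal (1 - mass) * ?g t
        + ?e t * ?M t \<partial>lborel)"
  proof (intro nn_integral_cong)
    fix t
    show "ennreal (indicator {0..} t * (exp (- z * t) * K t))
      = ennreal (1 - mass) * ?g t
        + ?e t * ?M t"
    proof (cases "0 \<le> t")
      case True
      have "?M t = ennreal (LBINT s. \<phi> s * min s t)"
        using phi_min_nonneg[OF True] by (intro nn_integral_eq_integral integrable_phi_min True) auto
      then show ?thesis
        using True mass K_integral_nonneg[OF True]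
          ennreal_plus[of "(1 - mass) * (exp (- (z * t)) * t)" "exp (- (z * t)) * (LBINT s. \<phi> s * min s t)"]
        by (simp add: K_def ennreal_mult[symmetric] distrib_left mult.left_commute del: ennreal_plus)
    qed simp
  qed
  also have "\<dots> = (\<integral>\<^sup>+t. ennreal (1 - mass) * ?g t \<partial>lborel)
      + (\<integral>\<^sup>+t. ?e t * ?M t \<partial>lborel)"
    by (rule nn_integral_add) auto
  also have "(\<integral>\<^sup>+t. ennreal (1 - mass) * ?g t \<partial>lborel)
      = ennreal (1 - mass) * ennreal (1 / z ^ 2)"
  proof -
    have "(\<integral>\<^sup>+t. ?g t \<partial>lborel) = ennreal (Gamma (1 + 1) / z powr (1 + 1))"
      using has_bochner_integral_exp_powr[OF assms, of 1]
      by (subst nn_integral_eq_integral) (auto simp: has_bochner_integral_iff intro!: AE_I2)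
    also have "Gamma (1 + 1) / z powr (1 + 1) = 1 / z ^ 2"
      using assms Gamma_fact[of 1, where 'a = real] by (simp add: powr_numeral)
    finally show ?thesis by (subst nn_integral_cmult) auto
  qed
  also have "(\<integral>\<^sup>+t. ?e t * ?M t \<partial>lborel)
      = (\<integral>\<^sup>+t. (\<integral>\<^sup>+s. ?e t * ennreal (\<phi> s * min s t) \<partial>lborel) \<partial>lborel)"
    by (intro nn_integral_cong nn_integral_cmult[symmetric]) auto
  also have "\<dots> = (\<integral>\<^sup>+s. (\<integral>\<^sup>+t. ?e t * ennreal (\<phi> s * min s t) \<partial>lborel) \<partial>lborel)"
    by (rule lborel_pair.Fubini') measurable
  also have "\<dots> = (\<integral>\<^sup>+s. ennreal (\<phi> s * ?h s) \<partial>lborel)"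
  proof (intro nn_integral_cong)
    fix s
    show "(\<integral>\<^sup>+t. ?e t * ennreal (\<phi> s * min s t) \<partial>lborel)
      = ennreal (\<phi> s * ?h s)"
    proof (cases "s \<le> 0")
      case False
      have "(\<integral>\<^sup>+t. ?e t * ennreal (\<phi> s * min s t) \<partial>lborel)
        = (\<integral>\<^sup>+t. ennreal (\<phi> s) * ennreal (indicator {0..} t * (exp (- z * t) * min s t)) \<partial>lborel)"
        using False phi_nonneg by (intro nn_integral_cong) (auto simp: ennreal_mult[symmetric] indicator_def mult_ac)
      also have "\<dots> = ennreal (\<phi> s) * ennreal (?h s)"
        using nn_integral_exp_min[OF assms, of s] False by (subst nn_integral_cmult) auto
      finally show ?thesis by (simp only: ennreal_mult'[OF phi_nonneg])
    qed (simp add: phi_zero)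
  qed
  also have "\<dots> = ennreal (LBINT s. \<phi> s * ?h s)"
  proof (rule nn_integral_eq_integral)
    show "integrable lborel (\<lambda>s. \<phi> s * ?h s)"
      using phi_integrable lap_integrable[OF assms] by (simp add: algebra_simps diff_divide_distrib)
    show "AE s in lborel. 0 \<le> \<phi> s * ?h s"
    proof (rule AE_I2)
      fix s
      show "0 \<le> \<phi> s * ?h s"
        using assms phi_nonneg[of s] phi_zero[of s] by (cases "s \<le> 0") auto
    qed
  qed
  also have "(LBINT s. \<phi> s * ?h s) = (mass - lap z) / z ^ 2"
    using phi_integrable lap_integrable[OF assms]
    by (simp add: algebra_simps diff_divide_distrib mass_def lap_def)
  also have "ennreal (1 - mass) * ennreal (1 / z ^ 2) + ennreal ((mass - lap z) / z ^ 2) = ennreal ((1 - lap z) / z ^ 2)"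
    using mass l assms ennreal_plus[of "(1 - mass) / z ^ 2" "(mass - lap z) / z ^ 2"]
    by (simp add: ennreal_mult[symmetric] add_divide_distrib[symmetric] del: ennreal_plus)
  finally show "(\<integral>\<^sup>+t. ennreal (indicator {0..} t * (exp (- z * t) * K t)) \<partial>lborel) = ennreal ((1 - lap z) / z ^ 2)" .
  show "0 \<le> (1 - lap z) / z ^ 2"
    using l mass by simp
qed (auto intro!: AE_I2 simp: indicator_def K_nonneg)

lemma has_bochner_integral_scaled:
  fixes f :: "real \<Rightarrow> real"
  assumes "has_bochner_integral lborel f I" "0 < T"
  shows "has_bochner_integral lborel (\<lambda>x. f (T * x)) (I / T)"
  using lborel_has_bochner_integral_real_affine_iff[of T f I 0] assms by (simp add: divide_inverse mult.commute)

lemma K_scaled: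
  assumes "0 < T"
  shows "has_bochner_integral lborel (\<lambda>x. indicator {0..} x * (exp (- x) * K (T * x))) (T * (1 - lap (1 / T)))"
  using has_bochner_integral_scaled[OF laplace_K[of "1 / T"] assms] assms
  by (simp add: indicator_def zero_le_mult_iff power2_eq_square mult.commute cong: if_cong)

text \<open>Strictness comes from \<open>laplace_K\<close>: the transform of \<open>K\<close> cannot
  vanish, because \<open>K\<close> is positive on (0, 1).\<close>

lemma lap_less_1:
  assumes "0 < z"
  shows "lap z < 1"
proof -
  define f where "f t = indicator {0..} t * (exp (- z * t) * K t)" for t
  have f: "has_bochner_integral lborel f ((1 - lap z) / z ^ 2)" "\<And>t. 0 \<le> f t"
    using laplace_K[OF assms] by (auto simp: f_def[abs_def] K_nonneg split: split_indicator)
  have "(1 - lap z) / z ^ 2 \<noteq> 0"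
  proof
    assume "(1 - lap z) / z ^ 2 = 0"
    then have "AE t in lborel. f t = 0"
      using f integral_nonneg_eq_0_iff_AE[of lborel f] by (auto simp: has_bochner_integral_iff)
    then have "AE t in lborel. t \<notin> {0<..<1::real}"
      by eventually_elim (use K_pos in \<open>force simp: f_def\<close>)
    then have "emeasure lborel {0<..<1::real} = 0"
      by (subst (asm) AE_iff_measurable[where N = "{0<..<1}"]) auto
    then show False by simp
  qed
  moreover have "0 \<le> (1 - lap z) / z ^ 2"
    using f(1) integral_nonneg_AE[of f lborel] f(2) by (simp add: has_bochner_integral_iff)
  ultimately have "0 < (1 - lap z) / z ^ 2" by linarith
  then show ?thesis using assms by (simp add: zero_less_divide_iff)
qed

text \<open>After the substitution t = Tx the quotient is the integral of exp(-x) K(Tx)/K(T), which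
  \<open>K_scale\<close> dominates by exp(-x) (1 + x).\<close>

lemma abelian:
  assumes RV: "\<And>x. 0 < x \<Longrightarrow> ((\<lambda>T. K (T * x) / K T) \<longlongrightarrow> x powr \<rho>) at_top" and \<rho>: "0 \<le> \<rho>"
  shows "((\<lambda>T. T * (1 - lap (1 / T)) / K T) \<longlongrightarrow> Gamma (1 + \<rho>)) at_top"
proof -
  define s where "s T x = indicator {0..} x * (exp (- x) * (K (T * x) / K T))" for T x
  define f where "f x = indicator {0..} x * (exp (- x) * x powr \<rho>)" for x :: real
  define w where "w x = indicator {0..} x * (exp (- x) * x powr 0) + indicator {0..} x * (exp (- x) * x powr 1)" for x :: real
  have "((\<lambda>T. integral\<^sup>L lborel (s T)) \<longlongrightarrow> integral\<^sup>L lborel f) at_top"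
  proof (rule integral_dominated_convergence_at_top)
    show "f \<in> borel_measurable lborel" "\<And>T. s T \<in> borel_measurable lborel"
      unfolding f_def s_def by measurable
    show "integrable lborel w"
      using has_bochner_integral_exp_powr[of 1 0] has_bochner_integral_exp_powr[of 1 1]
      unfolding w_def by (intro Bochner_Integration.integrable_add) (auto simp: has_bochner_integral_iff)
    show "\<forall>\<^sub>F T in at_top. AE x in lborel. norm (s T x) \<le> w x"
      using eventually_gt_at_top[of 0]
    proof eventually_elim
      case (elim T)
      have "norm (s T x) \<le> w x" if "x \<noteq> 0" for x
      proof (cases "0 < x")
        case True
        have "K (T * x) / K T \<le> max 1 x"
          using K_scale[of T x] K_pos[of T] elim True by (simp add: divide_le_eq)
        then have "K (T * x) / K T \<le> 1 + x" using True by simp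
        then have "exp (- x) * (K (T * x) / K T) \<le> exp (- x) * (1 + x)"
          by (intro mult_left_mono) auto
        then show ?thesis
          using True K_pos[of "T * x"] K_pos[of T] elim by (simp add: s_def w_def abs_mult algebra_simps)
      qed (use that in \<open>simp add: s_def w_def\<close>)
      moreover have "AE x in lborel. x \<noteq> (0::real)" by (rule AE_lborel_singleton)
      ultimately show ?case by auto
    qed
    have "((\<lambda>T. s T x) \<longlongrightarrow> f x) at_top" if "x \<noteq> 0" for x
    proof (cases "0 < x")
      case True
      then show ?thesis unfolding s_def f_def by (intro tendsto_intros RV)
    qed (use that in \<open>simp add: s_def f_def\<close>)
    moreover have "AE x in lborel. x \<noteq> (0::real)" by (rule AE_lborel_singleton)
    ultimately show "AE x in lborel. ((\<lambda>T. s T x) \<longlongrightarrow> f x) at_top" by auto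
  qed
  moreover have "integral\<^sup>L lborel f = Gamma (1 + \<rho>)"
    using has_bochner_integral_exp_powr[of 1 \<rho>] \<rho> by (simp add: f_def[abs_def] has_bochner_integral_iff)
  moreover have "\<forall>\<^sub>F T in at_top. integral\<^sup>L lborel (s T) = T * (1 - lap (1 / T)) / K T"
    using eventually_gt_at_top[of 0]
  proof eventually_elim
    case (elim T)
    have "integral\<^sup>L lborel (s T) = (LBINT x. (indicator {0..} x * (exp (- x) * K (T * x))) / K T)"
      by (simp add: s_def[abs_def])
    also have "\<dots> = T * (1 - lap (1 / T)) / K T"
      using K_scaled[OF elim] by (simp add: has_bochner_integral_iff)
    finally show ?case .
  qed
  ultimately show ?thesis by (auto elim: Lim_transform_eventually)
qed

text \<open>Karamata's theorem with exponent 1 - \<rho> and h(T) = T/K(T). The transforms of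
  \<open>j\<close> are known through \<open>lap\<close>, and \<open>abelian\<close> expresses
  \<open>lap\<close> through \<open>K\<close>. The constant collects the Abelian factor \<Gamma>(1 +
  \<rho>) and the factor \<Gamma>(2 - \<rho>) from the transform of x^(1 - \<rho>).\<close>

theorem renewal_growth:
  assumes j: "mono j" "\<And>t. 0 \<le> j t"
    and lj: "\<And>z. 0 < z \<Longrightarrow> has_bochner_integral lborel (\<lambda>t. indicator {0..} t * (exp (- z * t) * j t)) (1 / (z * (1 - lap z)))"
    and RV: "\<And>x. 0 < x \<Longrightarrow> ((\<lambda>T. K (T * x) / K T) \<longlongrightarrow> x powr \<rho>) at_top" and \<rho>: "0 \<le> \<rho>" "\<rho> \<le> 1"
  shows "((\<lambda>T. j T * K T / T) \<longlongrightarrow> 1 / (Gamma (1 + \<rho>) * Gamma (2 - \<rho>))) at_top"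
proof -
  have hb: "has_bochner_integral lborel (\<lambda>x. indicator {0..} x * (exp (- (real (Suc n) * x)) * j (T * x)))
     (1 / (real (Suc n) * (1 - lap (real (Suc n) / T))))" if "0 < T" for T n
    using has_bochner_integral_scaled[OF lj[of "real (Suc n) / T"] that] that
    by (simp add: indicator_def zero_le_mult_iff mult.commute cong: if_cong)
  have G: "Gamma (1 + \<rho>) > 0" "Gamma (2 - \<rho>) > 0"
    using \<rho> by (auto intro!: Gamma_real_pos)
  have "((\<lambda>T. j T / (T / K T)) \<longlongrightarrow> 1 / (Gamma (1 + \<rho>) * Gamma (2 - \<rho>))) at_top"
  proof (rule karamata_monotone[OF j])
    show "0 \<le> 1 - \<rho>" using \<rho> by simp
    show "0 \<le> 1 / (Gamma (1 + \<rho>) * Gamma (2 - \<rho>))" using G by simp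
    show "0 < T / K T" if "0 < T" for T using K_pos that by simp
    show "integrable lborel (\<lambda>x. indicator {0..} x * (exp (- (real (Suc n) * x)) * j (T * x)))" if "0 < T" for T n
      using hb[OF that, of n] by (simp add: has_bochner_integral_iff)
    fix n
    define N where "N = real (Suc n)"
    have N: "N > 0" by (simp add: N_def)
    have lim: "filterlim (\<lambda>T. T / N) at_top at_top"
      using N by real_asymp
    \<comment> \<open>The Abelian limit is taken along T/N, where \<open>lap\<close> is evaluated at
      N/T as required; the quotient of \<open>K\<close> at T and at T/N then returns to the
      normalisation at \<open>T\<close>.\<close>
    have "((\<lambda>T. K (T / N * N) / K (T / N)) \<longlongrightarrow> N powr \<rho>) at_top"
      using filterlim_compose[OF RV[OF N] lim] .
    moreover have "((\<lambda>T. (T / N) * (1 - lap (1 / (T / N))) / K (T / N)) \<longlongrightarrow> Gamma (1 + \<rho>)) at_top"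
      using filterlim_compose[OF abelian[OF RV \<rho>(1)] lim] .
    ultimately have "((\<lambda>T. (K (T / N * N) / K (T / N)) / ((T / N) * (1 - lap (1 / (T / N))) / K (T / N)) / N ^ 2)
        \<longlongrightarrow> N powr \<rho> / Gamma (1 + \<rho>) / N ^ 2) at_top"
      using G N by (intro tendsto_intros) auto
    moreover have "N powr \<rho> / Gamma (1 + \<rho>) / N ^ 2
        = 1 / (Gamma (1 + \<rho>) * Gamma (2 - \<rho>)) * (Gamma (1 + (1 - \<rho>)) / N powr (1 + (1 - \<rho>)))"
    proof -
      have "N powr (2 - \<rho>) = N ^ 2 / N powr \<rho>" using N by (simp add: powr_diff powr_numeral)
      then show ?thesis using G N by (simp add: field_simps)
    qed
    moreover have "\<forall>\<^sub>F T in at_top. (K (T / N * N) / K (T / N)) / ((T / N) * (1 - lap (1 / (T / N))) / K (T / N)) / N ^ 2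
       = (LBINT x. indicator {0..} x * (exp (- (real (Suc n) * x)) * j (T * x))) / (T / K T)"
      using eventually_gt_at_top[of 0]
    proof eventually_elim
      case (elim T)
      have "K (T / N) > 0" "1 - lap (N / T) > 0" "K T > 0"
        using elim N K_pos lap_less_1[of "N / T"] by auto
      then show ?case
        using hb[OF elim, of n] N elim
        by (simp add: has_bochner_integral_iff N_def[symmetric] power2_eq_square del: of_nat_Suc)
    qed
    ultimately show "((\<lambda>T. (LBINT x. indicator {0..} x * (exp (- (real (Suc n) * x)) * j (T * x))) / (T / K T))
      \<longlongrightarrow> 1 / (Gamma (1 + \<rho>) * Gamma (2 - \<rho>)) * (Gamma (1 + (1 - \<rho>)) / real (Suc n) powr (1 + (1 - \<rho>)))) at_top"
      unfolding N_def[symmetric] by (auto elim: Lim_transform_eventually)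
  qed
  then show ?thesis by simp
qed

end

section \<open>Regular variation\<close>

lemma has_bochner_integral_Beta:
  fixes a b :: real
  assumes "0 \<le> a" "0 \<le> b"
  shows "has_bochner_integral lborel (\<lambda>x. indicator {0..1} x * (x powr a * (1 - x) powr b)) (Beta (a + 1) (b + 1))"
proof (rule has_bochner_integral_nn_integral)
  have "((\<lambda>x. x powr (a + 1 - 1) * (1 - x) powr (b + 1 - 1)) has_integral Beta (a + 1) (b + 1)) {0..1}"
    using assms by (intro has_integral_Beta_real) auto
  then have "(\<integral>\<^sup>+x. ennreal (indicator {0..1} x * (x powr a * (1 - x) powr b)) \<partial>lborel) = ennreal (Beta (a + 1) (b + 1))"
    using nn_integral_has_integral_lebesgue[of "{0..1}" "\<lambda>x. x powr a * (1 - x) powr b"] by simp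
  then show "(\<integral>\<^sup>+x. ennreal (indicator {0..1} x * (x powr a * (1 - x) powr b)) \<partial>lborel) = ennreal (Beta (a + 1) (b + 1))" .
  show "0 \<le> Beta (a + 1) (b + 1)"
    using assms by (simp add: Beta_def Gamma_real_pos less_imp_le)
qed auto

text \<open>With u = tx the quotient is the integral over [0, 1] of powers of j(t(1 - x))/j(t) and
  j(tx)/j(t), both at most 1 by monotonicity. The exponents are general because the mean is the case
  p = 0, q = 1 and the variance the case p = 2, q = 1.\<close>

lemma rv_convolution:
  fixes j :: "real \<Rightarrow> real" and \<alpha> :: real
  assumes j: "mono j" "\<And>t. 0 \<le> j t" "\<And>t. 0 < t \<Longrightarrow> 0 < j t"
    and RV: "\<And>x. 0 < x \<Longrightarrow> ((\<lambda>T. j (T * x) / j T) \<longlongrightarrow> x powr \<alpha>) at_top" and \<alpha>: "0 \<le> \<alpha>"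
  shows "((\<lambda>t. (LBINT u. indicator {0..t} u * (j (t - u) ^ p * j u ^ q)) / (t * j t ^ (p + q)))
    \<longlongrightarrow> Beta (real p * \<alpha> + 1) (real q * \<alpha> + 1)) at_top"
proof -
  have [measurable]: "j \<in> borel_measurable borel"
    using j(1) by (rule borel_measurable_mono)
  define s where "s t x = indicator {0..1} x * ((j (t * (1 - x)) / j t) ^ p * (j (t * x) / j t) ^ q)" for t x :: real
  define f where "f x = indicator {0..1} x * ((1 - x) powr (real p * \<alpha>) * x powr (real q * \<alpha>))" for x :: real
  have ratio: "0 \<le> j (t * x) / j t \<and> j (t * x) / j t \<le> 1" if "0 < t" "x \<le> 1" for t x
    using that j(2,3) monoD[OF j(1), of "t * x" t] by (simp add: divide_le_eq)
  have "((\<lambda>t. integral\<^sup>L lborel (s t)) \<longlongrightarrow> integral\<^sup>L lborel f) at_top"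
  proof (rule integral_dominated_convergence_at_top[where w = "indicator {0..1}"])
    show "f \<in> borel_measurable lborel" "\<And>t. s t \<in> borel_measurable lborel"
      unfolding f_def s_def by measurable
    show "\<forall>\<^sub>F t in at_top. AE x in lborel. norm (s t x) \<le> indicator {0..1} x"
      using eventually_gt_at_top[of 0]
    proof eventually_elim
      case (elim t)
      have "norm (s t x) \<le> indicator {0..1} x" for x
      proof (cases "x \<in> {0..1}")
        case True
        then show ?thesis
          using ratio[OF elim, of x] ratio[OF elim, of "1 - x"]
          by (auto simp: s_def abs_mult power_abs intro!: mult_le_one power_le_one)
      qed (simp add: s_def)
      then show ?case by simp
    qed
    \<comment> \<open>At each endpoint one of the two ratios is taken at the argument 0, which
      \<open>RV\<close> does not cover.\<close>
    have "((\<lambda>t. s t x) \<longlongrightarrow> f x) at_top" if "x \<noteq> 0" "x \<noteq> 1" for x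
    proof (cases "x \<in> {0..1}")
      case True
      have "((\<lambda>t. s t x) \<longlongrightarrow> indicator {0..1} x * (((1 - x) powr \<alpha>) ^ p * (x powr \<alpha>) ^ q)) at_top"
        unfolding s_def using that True by (intro tendsto_intros RV) auto
      then show ?thesis
        using that True by (simp add: f_def powr_power mult.commute)
    qed (simp add: s_def f_def)
    moreover have "AE x in lborel. x \<noteq> (0::real)" "AE x in lborel. x \<noteq> (1::real)"
      by (rule AE_lborel_singleton)+
    ultimately show "AE x in lborel. ((\<lambda>t. s t x) \<longlongrightarrow> f x) at_top" by auto
  qed simp
  moreover have "integral\<^sup>L lborel f = Beta (real p * \<alpha> + 1) (real q * \<alpha> + 1)"
    using has_bochner_integral_Beta[of "real q * \<alpha>" "real p * \<alpha>"] \<alpha>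
    by (simp add: f_def[abs_def] has_bochner_integral_iff mult_ac Beta_commute)
  moreover have "\<forall>\<^sub>F t in at_top. integral\<^sup>L lborel (s t)
      = (LBINT u. indicator {0..t} u * (j (t - u) ^ p * j u ^ q)) / (t * j t ^ (p + q))"
    using eventually_gt_at_top[of 0]
  proof eventually_elim
    case (elim t)
    have "(LBINT u. indicator {0..t} u * (j (t - u) ^ p * j u ^ q))
      = t * (LBINT x. indicator {0..t} (t * x) * (j (t - t * x) ^ p * j (t * x) ^ q))"
      using lborel_integral_real_affine[of t "\<lambda>u. indicator {0..t} u * (j (t - u) ^ p * j u ^ q)" 0] elim by simp
    also have "(\<lambda>x. indicator {0..t} (t * x) * (j (t - t * x) ^ p * j (t * x) ^ q)) = (\<lambda>x. s t x * j t ^ (p + q))"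
      using elim j(3)[OF elim] by (auto simp: s_def indicator_def power_divide power_add algebra_simps zero_le_mult_iff fun_eq_iff)
    finally show ?case
      using elim j(3)[OF elim] by simp
  qed
  ultimately show ?thesis by (auto elim: Lim_transform_eventually)
qed

text \<open>Every large \<open>T\<close> reaches [r T0, T0] after finitely many multiplications by
  \<open>r\<close>, and each step gains the factor \<open>a\<close>. In
  \<open>K_limit_rv_tail\<close> this turns an approximate recursion between T and rT into a
  limit.\<close>

lemma geometric_decay:
  fixes D :: "real \<Rightarrow> real"
  assumes r: "0 < r" "r < 1" and a: "0 \<le> a" "a < 1" and T0: "0 < T0"
    and step: "\<And>T. T0 \<le> T \<Longrightarrow> D T \<le> a * D (r * T)"
    and bound: "\<And>T. r * T0 \<le> T \<Longrightarrow> T \<le> T0 \<Longrightarrow> D T \<le> B"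
    and e: "0 < e"
  shows "\<forall>\<^sub>F T in at_top. D T < e"
proof -
  \<comment> \<open>Kept nonnegative, since a C \<le> C would fail for negative C.\<close>
  define C where "C = max B 0"
  have bd: "D T \<le> C" if "r * T0 \<le> T" "r ^ n * T \<le> T0" for T n
    using that
  proof (induction n arbitrary: T)
    case 0
    then show ?case using bound[of T] by (simp add: C_def)
  next
    case (Suc n)
    show ?case
    proof (cases "T \<le> T0")
      case True
      then show ?thesis using bound[of T] Suc by (simp add: C_def)
    next
      case False
      have "D (r * T) \<le> C"
        using Suc False r by (intro Suc.IH) (auto simp: mult_ac)
      then have "a * D (r * T) \<le> 1 * C"
        using a mult_left_mono[of "D (r * T)" C a] mult_right_mono[of a 1 C] by (auto simp: C_def)
      then show ?thesis using step[of T] False by simp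
    qed
  qed
  have bd': "D T \<le> C" if "r * T0 \<le> T" for T
  proof -
    have "(\<lambda>n. r ^ n * T) \<longlonglongrightarrow> 0 * T"
      using r by (intro tendsto_intros LIMSEQ_power_zero) auto
    then have "\<forall>\<^sub>F n in sequentially. r ^ n * T < T0"
      using T0 by (intro order_tendstoD) auto
    then obtain n where "r ^ n * T < T0"
      using eventually_happens trivial_limit_sequentially by blast
    then show ?thesis using bd[OF that, of n] by simp
  qed
  have decay: "D T \<le> a ^ n * C" if "T0 \<le> r ^ n * T" for T n
    using that
  proof (induction n arbitrary: T)
    case 0
    have "r * T0 \<le> 1 * T" using 0 r T0 by (intro mult_mono) auto
    then show ?case using bd' by simp
  next
    case (Suc n)
    have "T0 \<le> r ^ n * (r * T)" using Suc by (simp add: mult_ac)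
    from Suc.IH[OF this] have "a * D (r * T) \<le> a * (a ^ n * C)" using a by (intro mult_left_mono)
    moreover have "T0 \<le> T"
    proof -
      have "0 < r ^ Suc n * T" using Suc.prems T0 by linarith
      then have "0 < T" using r zero_less_mult_pos[of "r ^ Suc n" T] by simp
      then have "r ^ Suc n * T \<le> 1 * T"
        using r by (intro mult_right_mono power_le_one) auto
      then show ?thesis using Suc.prems by simp
    qed
    ultimately show ?case using step[of T] by (simp add: mult.assoc)
  qed
  have "(\<lambda>n. a ^ n * C) \<longlonglongrightarrow> 0 * C"
    using a by (intro tendsto_intros LIMSEQ_power_zero) auto
  then have "\<forall>\<^sub>F n in sequentially. a ^ n * C < e"
    using e by (intro order_tendstoD) auto
  then obtain n where n: "a ^ n * C < e"
    using eventually_happens trivial_limit_sequentially by blast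
  show ?thesis
    using eventually_ge_at_top[of "T0 / r ^ n"]
  proof eventually_elim
    case (elim T)
    then have "T0 \<le> r ^ n * T" using r by (simp add: field_simps)
    then show ?case using decay n by fastforce
  qed
qed

text \<open>The derivative of x^\<beta> at 1; it is the origin of the constant 1/(1 - \<alpha>) in
  \<open>K_limit_rv_tail\<close>.\<close>

lemma powr_difference_quotient:
  "((\<lambda>x. (1 - x powr \<beta>) / (1 - x)) \<longlongrightarrow> (\<beta>::real)) (at_left 1)"
proof -
  have "((\<lambda>x. x powr \<beta>) has_real_derivative \<beta> * 1 powr (\<beta> - 1)) (at 1)"
    by (rule has_real_derivative_powr) simp
  then have "((\<lambda>x. (x powr \<beta> - 1 powr \<beta>) / (x - 1)) \<longlongrightarrow> \<beta>) (at 1)"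
    by (simp add: has_field_derivative_iff)
  then have "((\<lambda>x. (x powr \<beta> - 1) / (x - 1)) \<longlongrightarrow> \<beta>) (at_left 1)"
    by (auto intro: filterlim_mono[OF _ order_refl at_le])
  moreover have "(x powr \<beta> - 1) / (x - 1) = (1 - x powr \<beta>) / (1 - x)" for x :: real
    by (metis minus_diff_eq minus_divide_divide)
  ultimately show ?thesis by simp
qed

section \<open>Asymptotics of \<open>K\<close> in the four regimes\<close>

context hawkes_kernel
begin

definition Psi1 :: "real \<Rightarrow> real" where
  "Psi1 t = (LBINT s. indicator {0..t} s * (s * \<phi> s))"

lemma tail_integrable: "integrable lborel (\<lambda>s. indicator {t..} s * \<phi> s)"
  by (rule integrable_phi_times[where B = 1]) auto

lemma tail_nonneg: "0 \<le> tail t"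
  unfolding tail_def by (intro integral_nonneg_AE AE_I2) (simp add: phi_nonneg)

lemma tail_antimono: "a \<le> b \<Longrightarrow> tail b \<le> tail a"
  unfolding tail_def by (intro integral_mono tail_integrable) (auto simp: indicator_def phi_nonneg)

text \<open>For mass 1, \<open>K\<close> is a primitive of the decreasing function
  \<open>tail\<close>. On the level of integrands, min(s, b) - min(s, a) equals b - a for s \<ge> b,
  vanishes for s < a and never exceeds b - a.\<close>

lemma K_diff_bounds:
  assumes "mass = 1" "0 \<le> a" "a \<le> b"
  shows "(b - a) * tail b \<le> K b - K a" "K b - K a \<le> (b - a) * tail a"
proof -
  have K: "K b - K a = (LBINT s. \<phi> s * min s b - \<phi> s * min s a)"
    using assms by (simp add: K_def Bochner_Integration.integral_diff integrable_phi_min)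
  have t: "(b - a) * tail t = (LBINT s. (b - a) * (indicator {t..} s * \<phi> s))" for t
    by (simp add: tail_def)
  have *: "integrable lborel (\<lambda>s. (b - a) * (indicator {t..} s * \<phi> s))" for t
    using tail_integrable[of t] by simp
  have **: "integrable lborel (\<lambda>s. \<phi> s * min s b - \<phi> s * min s a)"
    using assms by (intro Bochner_Integration.integrable_diff integrable_phi_min) auto
  have 1: "(b - a) * (indicator {b..} s * \<phi> s) \<le> \<phi> s * min s b - \<phi> s * min s a" for s
  proof -
    have "\<phi> s * ((b - a) * indicator {b..} s) \<le> \<phi> s * (min s b - min s a)"
      using assms by (intro mult_left_mono phi_nonneg) (auto simp: indicator_def)
    then show ?thesis by (simp add: algebra_simps)
  qed
  have 2: "\<phi> s * min s b - \<phi> s * min s a \<le> (b - a) * (indicator {a..} s * \<phi> s)" for s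
  proof -
    have "\<phi> s * (min s b - min s a) \<le> \<phi> s * ((b - a) * indicator {a..} s)"
      using assms by (intro mult_left_mono phi_nonneg) (auto simp: indicator_def)
    then show ?thesis by (simp add: algebra_simps)
  qed
  show "(b - a) * tail b \<le> K b - K a" unfolding K t using 1 by (intro integral_mono * **)
  show "K b - K a \<le> (b - a) * tail a" unfolding K t using 2 by (intro integral_mono * **)
qed

text \<open>Integration by parts, carried out on the integrands: min(s, t) minus t for s \<ge> t is
  s below t and 0 above. The two sides may differ at s = t, hence the almost everywhere
  argument.\<close>

lemma Psi1_eq:
  assumes "mass = 1" "0 \<le> t"
  shows "Psi1 t = K t - t * tail t"
proof -
  have "K t - t * tail t = (LBINT s. \<phi> s * min s t - t * (indicator {t..} s * \<phi> s))"
    using assms tail_integrable integrable_phi_min by (simp add: K_def tail_def)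
  also have "\<dots> = (LBINT s. indicator {0..t} s * (s * \<phi> s))"
  proof (rule integral_cong_AE)
    have "AE s in lborel. s \<noteq> t" by (rule AE_lborel_singleton)
    then show "AE s in lborel. \<phi> s * min s t - t * (indicator {t..} s * \<phi> s) = indicator {0..t} s * (s * \<phi> s)"
      by eventually_elim (auto simp: indicator_def phi_zero min_def)
  qed auto
  finally show ?thesis by (simp add: Psi1_def)
qed

text \<open>The bounded factor min(s/t, 1) tends to 0, so dominated convergence leaves only the
  linear part of \<open>K\<close>.\<close>

lemma K_limit_subcritical: "((\<lambda>t. K t / t) \<longlongrightarrow> 1 - mass) at_top"
proof -
  have "((\<lambda>t. LBINT s. \<phi> s * min (s / t) 1) \<longlongrightarrow> (\<integral>s. 0 \<partial>(lborel :: real measure))) at_top"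
  proof (rule integral_dominated_convergence_at_top[where w = \<phi>])
    show "\<forall>\<^sub>F t in at_top. AE s in lborel. norm (\<phi> s * min (s / t) 1) \<le> \<phi> s"
      using eventually_gt_at_top[of 0]
    proof eventually_elim
      case (elim t)
      have "norm (\<phi> s * min (s / t) 1) \<le> \<phi> s" for s
        using elim phi_nonneg[of s] phi_zero[of s]
        by (cases "s \<le> 0") (auto simp: abs_mult mult_left_le)
      then show ?case by simp
    qed
    have "((\<lambda>t. \<phi> s * min (s / t) 1) \<longlongrightarrow> \<phi> s * min 0 1) at_top" for s
      by (intro tendsto_intros) real_asymp
    then show "AE s in lborel. ((\<lambda>t. \<phi> s * min (s / t) 1) \<longlongrightarrow> 0) at_top" by simp
  qed (auto simp: phi_integrable)
  then have "((\<lambda>t. (1 - mass) + (LBINT s. \<phi> s * min (s / t) 1)) \<longlongrightarrow> (1 - mass) + 0) at_top"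
    by (intro tendsto_intros) simp
  moreover have "\<forall>\<^sub>F t in at_top. (1 - mass) + (LBINT s. \<phi> s * min (s / t) 1) = K t / t"
    using eventually_gt_at_top[of 0]
  proof eventually_elim
    case (elim t)
    have "(LBINT s. \<phi> s * min (s / t) 1) = (LBINT s. (\<phi> s * min s t) / t)"
      using elim by (intro Bochner_Integration.integral_cong) (auto simp: min_def field_simps)
    then show ?case using elim by (simp add: K_def field_simps)
  qed
  ultimately show ?thesis by (auto elim: Lim_transform_eventually)
qed

lemma K_limit_finite_mean:
  assumes "mass = 1" and i: "integrable lborel (\<lambda>s. s * \<phi> s)"
  shows "(K \<longlongrightarrow> (LBINT s. s * \<phi> s)) at_top"
proof -
  have "((\<lambda>t. LBINT s. \<phi> s * min s t) \<longlongrightarrow> (LBINT s. s * \<phi> s)) at_top"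
  proof (rule integral_dominated_convergence_at_top[OF _ _ i])
    show "\<forall>\<^sub>F t in at_top. AE s in lborel. norm (\<phi> s * min s t) \<le> s * \<phi> s"
      using eventually_gt_at_top[of 0]
    proof eventually_elim
      case (elim t)
      have "norm (\<phi> s * min s t) \<le> s * \<phi> s" for s
        using elim phi_nonneg[of s] phi_zero[of s] mult_left_mono[of "min s t" s "\<phi> s"]
        by (cases "s \<le> 0") (auto simp: abs_mult mult.commute)
      then show ?case by simp
    qed
    have "((\<lambda>t. \<phi> s * min s t) \<longlongrightarrow> s * \<phi> s) at_top" for s
    proof (rule tendsto_eventually)
      show "\<forall>\<^sub>F t in at_top. \<phi> s * min s t = s * \<phi> s"
        using eventually_ge_at_top[of s] by eventually_elim simp
    qed
    then show "AE s in lborel. ((\<lambda>t. \<phi> s * min s t) \<longlongrightarrow> s * \<phi> s) at_top" by simp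
  qed auto
  moreover have "K = (\<lambda>t. LBINT s. \<phi> s * min s t)"
    using assms by (simp add: K_def fun_eq_iff)
  ultimately show ?thesis by simp
qed

text \<open>A zero of the decreasing \<open>tail\<close> would persist to the right, and then the
  quotients 0/0 = 0 would contradict the limit 1 at x = 1.\<close>

lemma tail_pos:
  assumes RV: "\<And>x. 0 < x \<Longrightarrow> ((\<lambda>t. tail (t * x) / tail t) \<longlongrightarrow> x powr \<beta>) at_top"
  shows "0 < tail t"
proof (rule ccontr)
  assume "\<not> 0 < tail t"
  then have 0: "tail s = 0" if "t \<le> s" for s
    using tail_antimono[OF that] tail_nonneg[of s] by linarith
  have "\<forall>\<^sub>F s in at_top. tail (s * 1) / tail s = 0"
    using eventually_ge_at_top[of t] by eventually_elim (simp add: 0)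
  then have "((\<lambda>s. tail (s * 1) / tail s) \<longlongrightarrow> 0) at_top"
    by (rule tendsto_eventually)
  then show False
    using tendsto_unique[OF _ RV[of 1]] by fastforce
qed

text \<open>This is Karamata's theorem on integrals, for a monotone integrand. The bounds of
  \<open>K_diff_bounds\<close> on [lt, t] give a recursion r(t) = l q r(lt) + remainder, where l q
  tends to l^(1 - \<alpha>) < 1 and the remainder lies between 1 - l and (1 - l) q. Its limiting
  fixed points (1 - l)/(1 - l^(1 - \<alpha>)) and l^(-\<alpha>) times this value enclose the limit
  points of r, and both tend to 1/(1 - \<alpha>) as l -> 1.\<close>

lemma K_limit_rv_tail:
  assumes m: "mass = 1" and \<alpha>: "0 \<le> \<alpha>" "\<alpha> < 1"
    and RV: "\<And>x. 0 < x \<Longrightarrow> ((\<lambda>t. tail (t * x) / tail t) \<longlongrightarrow> x powr (- \<alpha>)) at_top"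
  shows "((\<lambda>t. K t / (t * tail t)) \<longlongrightarrow> 1 / (1 - \<alpha>)) at_top"
proof -
  note pos = tail_pos[OF RV]
  define r where "r t = K t / (t * tail t)" for t
  define q where "q l t = tail (l * t) / tail t" for l t
  have q: "((\<lambda>t. q l t) \<longlongrightarrow> l powr (- \<alpha>)) at_top" if "0 < l" for l
    using RV[OF that] by (simp add: q_def mult.commute)
  have rec: "l * q l t * r (l * t) + (1 - l) \<le> r t" "r t \<le> l * q l t * r (l * t) + (1 - l) * q l t"
    if l: "0 < l" "l < 1" and t: "0 < t" for l t
  proof -
    have d: "l * q l t * r (l * t) = K (l * t) / (t * tail t)"
      using l t pos[of t] pos[of "l * t"] by (simp add: q_def r_def)
    have "(t - l * t) * tail t \<le> K t - K (l * t)" "K t - K (l * t) \<le> (t - l * t) * tail (l * t)"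
      using K_diff_bounds[OF m, of "l * t" t] l t by auto
    then have "((t - l * t) * tail t) / (t * tail t) \<le> (K t - K (l * t)) / (t * tail t)"
      "(K t - K (l * t)) / (t * tail t) \<le> ((t - l * t) * tail (l * t)) / (t * tail t)"
      using t pos[of t] by (intro divide_right_mono; simp)+
    moreover have "((t - l * t) * tail t) / (t * tail t) = 1 - l"
      "((t - l * t) * tail (l * t)) / (t * tail t) = (1 - l) * q l t"
      using t pos[of t] by (auto simp: q_def field_simps)
    ultimately show "l * q l t * r (l * t) + (1 - l) \<le> r t" "r t \<le> l * q l t * r (l * t) + (1 - l) * q l t"
      unfolding d by (auto simp: r_def diff_divide_distrib)
  qed
  have r_nonneg: "0 \<le> r t" if "0 < t" for t
    using K_pos[OF that] pos[of t] that by (simp add: r_def)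
  have \<beta>: "l * l powr (- \<alpha>) = l powr (1 - \<alpha>)" if "0 < l" for l :: real
    using that by (simp add: powr_diff powr_minus divide_inverse)
  have l_less: "l powr (1 - \<alpha>) < 1" if "0 < l" "l < 1" for l :: real
    using that \<alpha> powr_less_mono2[of "1 - \<alpha>" l 1] by simp
  \<comment> \<open>The numbers \<open>a\<close> and \<open>b\<close> exceed the limiting
    coefficients slightly, and b/(1 - a) is the fixed point of x \<mapsto> a x + b, so the excess of
    r over it shrinks by the factor \<open>a\<close>.\<close>
  have upper: "\<forall>\<^sub>F t in at_top. r t < y"
    if l: "0 < l" "l < 1" and a: "l powr (1 - \<alpha>) < a" "a < 1" and b: "(1 - l) * l powr (- \<alpha>) < b" and y: "b / (1 - a) < y" for l a b y
  proof -
    have lq: "((\<lambda>t. l * q l t) \<longlongrightarrow> l powr (1 - \<alpha>)) at_top" "((\<lambda>t. (1 - l) * q l t) \<longlongrightarrow> (1 - l) * l powr (- \<alpha>)) at_top"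
      unfolding \<beta>[OF l(1), symmetric] using l by (intro tendsto_intros q; simp)+
    have "\<forall>\<^sub>F t in at_top. l * q l t < a" "\<forall>\<^sub>F t in at_top. (1 - l) * q l t < b"
      by (rule order_tendstoD(2)[OF lq(1) a(1)], rule order_tendstoD(2)[OF lq(2) b])
    then have "\<forall>\<^sub>F t in at_top. l * q l t < a \<and> (1 - l) * q l t < b \<and> 0 < t"
      using eventually_gt_at_top[of 0] by eventually_elim auto
    then obtain T0' where T0': "\<And>t. T0' \<le> t \<Longrightarrow> l * q l t < a \<and> (1 - l) * q l t < b \<and> 0 < t"
      by (auto simp: eventually_at_top_linorder)
    define T0 where "T0 = T0'"
    have T0: "0 < T0" using T0'[of T0'] by (simp add: T0_def)
    have a0: "0 \<le> a" using a(1) powr_ge_zero[of l "1 - \<alpha>"] by linarith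
    have "\<forall>\<^sub>F t in at_top. r t - b / (1 - a) < y - b / (1 - a)"
    proof (rule geometric_decay[OF l a0 a(2) T0])
      fix t assume t: "T0 \<le> t"
      then have *: "l * q l t < a" "(1 - l) * q l t < b" "0 < t" using T0' by (auto simp: T0_def)
      have "l * q l t * r (l * t) \<le> a * r (l * t)"
        using * l r_nonneg[of "l * t"] by (intro mult_right_mono) auto
      then have "r t \<le> a * r (l * t) + b" using rec(2)[OF l *(3)] *(2) by linarith
      moreover have "a * (r (l * t) - b / (1 - a)) = a * r (l * t) + b - b / (1 - a)"
        using a by (simp add: field_simps)
      ultimately show "r t - b / (1 - a) \<le> a * (r (l * t) - b / (1 - a))" by simp
    next
      fix t assume t: "l * T0 \<le> t" "t \<le> T0"
      have t0: "0 < t" using t(1) T0 l mult_pos_pos[of l T0] by linarith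
      \<comment> \<open>On [l T0, T0] the numerator is at most K(T0), and in the denominator t \<ge>
        l T0 and tail(t) \<ge> tail(T0).\<close>
      have "K t / (t * tail t) \<le> K T0 / ((l * T0) * tail T0)"
      proof (rule frac_le)
        show "l * T0 * tail T0 \<le> t * tail t"
          using t t0 tail_antimono[of t T0] T0 l tail_nonneg by (intro mult_mono) auto
      qed (use t t0 T0 l pos[of T0] K_mono[of t T0] K_nonneg in auto)
      then show "r t - b / (1 - a) \<le> K T0 / ((l * T0) * tail T0) - b / (1 - a)" by (simp add: r_def)
    qed (use y in simp)
    then show ?thesis by eventually_elim simp
  qed
  \<comment> \<open>The mirror image, for the deficit (1 - l)/(1 - a) - r; its upper bound on
    [l T0, T0] is just r \<ge> 0.\<close>
  have lower: "\<forall>\<^sub>F t in at_top. y < r t"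
    if l: "0 < l" "l < 1" and a: "0 \<le> a" "a < l powr (1 - \<alpha>)" and y: "y < (1 - l) / (1 - a)" for l a y
  proof -
    have a1: "a < 1" using a(2) l_less[OF l] by linarith
    have "((\<lambda>t. l * q l t) \<longlongrightarrow> l * l powr (- \<alpha>)) at_top"
      using l by (intro tendsto_intros q)
    then have "\<forall>\<^sub>F t in at_top. a < l * q l t"
      using a l by (auto simp: \<beta> dest: order_tendstoD)
    then have "\<forall>\<^sub>F t in at_top. a < l * q l t \<and> 0 < t"
      using eventually_gt_at_top[of 0] by eventually_elim auto
    then obtain T0 where T0': "\<And>t. T0 \<le> t \<Longrightarrow> a < l * q l t \<and> 0 < t"
      by (auto simp: eventually_at_top_linorder)
    have T0: "0 < T0" using T0'[of T0] by simp
    have "\<forall>\<^sub>F t in at_top. (1 - l) / (1 - a) - r t < (1 - l) / (1 - a) - y"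
    proof (rule geometric_decay[OF l a(1) a1 T0])
      fix t assume t: "T0 \<le> t"
      then have *: "a < l * q l t" "0 < t" using T0' by auto
      have "a * r (l * t) \<le> l * q l t * r (l * t)"
        using * l r_nonneg[of "l * t"] by (intro mult_right_mono) auto
      then have "a * r (l * t) + (1 - l) \<le> r t" using rec(1)[OF l *(2)] by linarith
      moreover have "a * ((1 - l) / (1 - a) - r (l * t)) = (1 - l) / (1 - a) - (a * r (l * t) + (1 - l))"
        using a1 by (simp add: field_simps)
      ultimately show "(1 - l) / (1 - a) - r t \<le> a * ((1 - l) / (1 - a) - r (l * t))" by simp
    next
      fix t assume t: "l * T0 \<le> t" "t \<le> T0"
      have "0 < t" using t(1) T0 l mult_pos_pos[of l T0] by linarith
      then show "(1 - l) / (1 - a) - r t \<le> (1 - l) / (1 - a)" using r_nonneg[of t] by simp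
    qed (use y in simp)
    then show ?thesis by eventually_elim simp
  qed
  have ev01: "\<forall>\<^sub>F l in at_left (1::real). 0 < l \<and> l < 1"
    by (rule eventually_at_leftI[of "0::real"]) auto
  have lim1: "((\<lambda>l. (1 - l) / (1 - l powr (1 - \<alpha>))) \<longlongrightarrow> 1 / (1 - \<alpha>)) (at_left 1)"
    using tendsto_divide[OF tendsto_const[of 1] powr_difference_quotient[of "1 - \<alpha>"]] \<alpha> by simp
  have "((\<lambda>l. (1 - l) / (1 - l powr (1 - \<alpha>)) * l powr (- \<alpha>)) \<longlongrightarrow> 1 / (1 - \<alpha>) * 1 powr (- \<alpha>)) (at_left 1)"
    by (intro tendsto_intros lim1) auto
  then have lim2: "((\<lambda>l. (1 - l) * l powr (- \<alpha>) / (1 - l powr (1 - \<alpha>))) \<longlongrightarrow> 1 / (1 - \<alpha>)) (at_left 1)"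
    by simp
  have "(r \<longlongrightarrow> 1 / (1 - \<alpha>)) at_top"
  proof (rule order_tendstoI)
    fix y assume y: "1 / (1 - \<alpha>) < y"
    have "\<forall>\<^sub>F l in at_left 1. (1 - l) * l powr (- \<alpha>) / (1 - l powr (1 - \<alpha>)) < y \<and> 0 < l \<and> l < 1"
      using order_tendstoD(2)[OF lim2 y] ev01 by eventually_elim auto
    then obtain l where l: "(1 - l) * l powr (- \<alpha>) / (1 - l powr (1 - \<alpha>)) < y" "0 < l" "l < 1"
      using eventually_happens[of _ "at_left (1::real)"] by auto
    \<comment> \<open>First \<open>l\<close> is fixed close to 1, and only then is the slack
      \<open>d\<close>, added to both limiting coefficients, sent to 0.\<close>
    have "((\<lambda>d. ((1 - l) * l powr (- \<alpha>) + d) / (1 - (l powr (1 - \<alpha>) + d))) \<longlongrightarrow>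
        ((1 - l) * l powr (- \<alpha>) + 0) / (1 - (l powr (1 - \<alpha>) + 0))) (at_right 0)"
      using l_less[OF l(2,3)] by (intro tendsto_intros) auto
    then have "\<forall>\<^sub>F d in at_right 0. ((1 - l) * l powr (- \<alpha>) + d) / (1 - (l powr (1 - \<alpha>) + d)) < y"
      using l(1) by (intro order_tendstoD) auto
    moreover have "\<forall>\<^sub>F d in at_right 0. 0 < d \<and> d < 1 - l powr (1 - \<alpha>)"
      using l_less[OF l(2,3)] by (intro eventually_at_rightI[of 0 "1 - l powr (1 - \<alpha>)"]) auto
    ultimately have "\<forall>\<^sub>F d in at_right 0. ((1 - l) * l powr (- \<alpha>) + d) / (1 - (l powr (1 - \<alpha>) + d)) < y
        \<and> 0 < d \<and> d < 1 - l powr (1 - \<alpha>)"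
      by eventually_elim auto
    then obtain d where d: "((1 - l) * l powr (- \<alpha>) + d) / (1 - (l powr (1 - \<alpha>) + d)) < y" "0 < d" "d < 1 - l powr (1 - \<alpha>)"
      using eventually_happens[of _ "at_right (0::real)"] by auto
    show "\<forall>\<^sub>F t in at_top. r t < y"
      by (rule upper[OF l(2,3) _ _ _ d(1)]) (use d in auto)
  next
    fix y assume y: "y < 1 / (1 - \<alpha>)"
    have "\<forall>\<^sub>F l in at_left 1. y < (1 - l) / (1 - l powr (1 - \<alpha>)) \<and> 0 < l \<and> l < 1"
      using order_tendstoD(1)[OF lim1 y] ev01 by eventually_elim auto
    then obtain l where l: "y < (1 - l) / (1 - l powr (1 - \<alpha>))" "0 < l" "l < 1"
      using eventually_happens[of _ "at_left (1::real)"] by auto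
    have "((\<lambda>d. (1 - l) / (1 - (l powr (1 - \<alpha>) - d))) \<longlongrightarrow>
        (1 - l) / (1 - (l powr (1 - \<alpha>) - 0))) (at_right 0)"
      using l_less[OF l(2,3)] by (intro tendsto_intros) auto
    then have "\<forall>\<^sub>F d in at_right 0. y < (1 - l) / (1 - (l powr (1 - \<alpha>) - d))"
      using l(1) by (intro order_tendstoD) auto
    moreover have "\<forall>\<^sub>F d in at_right 0. 0 < d \<and> d < l powr (1 - \<alpha>)"
      using l by (intro eventually_at_rightI[of 0 "l powr (1 - \<alpha>)"]) auto
    ultimately have "\<forall>\<^sub>F d in at_right 0. y < (1 - l) / (1 - (l powr (1 - \<alpha>) - d)) \<and> 0 < d \<and> d < l powr (1 - \<alpha>)"
      by eventually_elim auto
    then obtain d where d: "y < (1 - l) / (1 - (l powr (1 - \<alpha>) - d))" "0 < d" "d < l powr (1 - \<alpha>)"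
      using eventually_happens[of _ "at_right (0::real)"] by auto
    show "\<forall>\<^sub>F t in at_top. y < r t"
      by (rule lower[OF l(2,3) _ _ d(1)]) (use d in auto)
  qed
  then show ?thesis by (simp add: r_def[abs_def])
qed

text \<open>At \<alpha> = 1 the factor l^(1 - \<alpha>) is 1 and the recursion of
  \<open>K_limit_rv_tail\<close> does not contract. Instead, the dyadic block from t/2^(k+1) to
  t/2^k contributes asymptotically at least t tail(t)/2 to K(t), for each k, so K(t)/(t tail(t))
  exceeds every bound. The increment of \<open>K\<close> between t and tx is then negligible against
  K(t), which is slow variation.\<close>

lemma K_limit_rv_minus_one:
  assumes m: "mass = 1"
    and RV: "\<And>x. 0 < x \<Longrightarrow> ((\<lambda>t. tail (t * x) / tail t) \<longlongrightarrow> x powr (- 1)) at_top"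
  shows "((\<lambda>t. t * tail t / K t) \<longlongrightarrow> 0) at_top"
    and "0 < x \<Longrightarrow> ((\<lambda>t. K (t * x) / K t) \<longlongrightarrow> 1) at_top"
proof -
  note pos = tail_pos[OF RV]
  have low: "(\<Sum>k<n. (1 / 2) ^ Suc k * (tail (t * (1 / 2) ^ k) / tail t)) \<le> K t / (t * tail t)" if t: "0 < t" for t n
  proof -
    have "(\<Sum>k<n. t * (1 / 2) ^ Suc k * tail (t * (1 / 2) ^ k)) \<le> K t - K (t * (1 / 2) ^ n)"
    proof (induction n)
      case (Suc n)
      have "(t * (1 / 2) ^ n - t * (1 / 2) ^ Suc n) * tail (t * (1 / 2) ^ n) \<le> K (t * (1 / 2) ^ n) - K (t * (1 / 2) ^ Suc n)"
        using t by (intro K_diff_bounds[OF m]) auto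
      moreover have "t * (1 / 2) ^ n - t * (1 / 2) ^ Suc n = t * (1 / 2) ^ Suc n" by simp
      ultimately show ?case using Suc by simp
    qed simp
    also have "\<dots> \<le> K t" using K_nonneg[of "t * (1 / 2) ^ n"] t by simp
    finally have "(\<Sum>k<n. t * (1 / 2) ^ Suc k * tail (t * (1 / 2) ^ k)) / (t * tail t) \<le> K t / (t * tail t)"
      using t pos[of t] by (intro divide_right_mono) auto
    then show ?thesis using t pos[of t] by (simp add: sum_divide_distrib)
  qed
  have inf: "filterlim (\<lambda>t. K t / (t * tail t)) at_top at_top"
    unfolding filterlim_at_top
  proof
    fix Z :: real
    obtain n :: nat where n: "2 * Z + 1 < real n" using reals_Archimedean2 by blast
    have "((\<lambda>t. \<Sum>k<n. (1 / 2) ^ Suc k * (tail (t * (1 / 2) ^ k) / tail t)) \<longlongrightarrow> (\<Sum>k<n. (1 / 2) ^ Suc k * ((1 / 2) ^ k) powr (- 1))) at_top"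
      by (intro tendsto_intros RV) auto
    moreover have "(\<Sum>k<n. (1 / 2) ^ Suc k * ((1 / 2::real) ^ k) powr (- 1)) = real n / 2"
      by (simp add: powr_minus)
    moreover have "Z < real n / 2" using n by simp
    ultimately have "\<forall>\<^sub>F t in at_top. Z < (\<Sum>k<n. (1 / 2) ^ Suc k * (tail (t * (1 / 2) ^ k) / tail t))"
      by (auto dest: order_tendstoD)
    then show "\<forall>\<^sub>F t in at_top. Z \<le> K t / (t * tail t)"
      using eventually_gt_at_top[of 0]
    proof eventually_elim
      case (elim t)
      then show ?case using low[of t n] by linarith
    qed
  qed
  have "((\<lambda>t. inverse (K t / (t * tail t))) \<longlongrightarrow> 0) at_top"
    using inf by (rule tendsto_inverse_0_at_top)
  then show z: "((\<lambda>t. t * tail t / K t) \<longlongrightarrow> 0) at_top" by simp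
  assume x: "0 < x"
  show "((\<lambda>t. K (t * x) / K t) \<longlongrightarrow> 1) at_top"
  proof (cases "1 \<le> x")
    case True
    show ?thesis
    proof (rule tendsto_sandwich[where f = "\<lambda>t. 1" and h = "\<lambda>t. 1 + (x - 1) * (t * tail t / K t)"])
      show "((\<lambda>t. 1 + (x - 1) * (t * tail t / K t)) \<longlongrightarrow> 1) at_top"
        using tendsto_add[OF tendsto_const[of 1] tendsto_mult[OF tendsto_const[of "x - 1"] z]] by simp
      show "((\<lambda>t. 1) \<longlongrightarrow> (1::real)) at_top" by simp
      show "\<forall>\<^sub>F t in at_top. 1 \<le> K (t * x) / K t"
        using eventually_gt_at_top[of 0]
        by eventually_elim (use True K_mono K_pos in \<open>simp add: mult_le_cancel_left1 le_divide_eq\<close>)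
      show "\<forall>\<^sub>F t in at_top. K (t * x) / K t \<le> 1 + (x - 1) * (t * tail t / K t)"
        using eventually_gt_at_top[of 0]
      proof eventually_elim
        case (elim t)
        have "K (t * x) - K t \<le> (t * x - t) * tail t"
          using True elim by (intro K_diff_bounds[OF m]) auto
        then show ?case using K_pos[OF elim] by (simp add: field_simps)
      qed
    qed
  next
    case False
    \<comment> \<open>For x < 1 the increment from tx to t is bounded by \<open>tail\<close> at its
      left end tx, so the smallness of t tail(t)/K(t) is used at tx.\<close>
    have "filterlim (\<lambda>t. t * x) at_top at_top"
      using x by real_asymp
    note z' = filterlim_compose[OF z this]
    show ?thesis
    proof (rule tendsto_sandwich[where f = "\<lambda>t. 1 - (1 / x - 1) * (t * x * tail (t * x) / K (t * x))" and h = "\<lambda>t. 1"])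
      show "((\<lambda>t. 1 - (1 / x - 1) * (t * x * tail (t * x) / K (t * x))) \<longlongrightarrow> 1) at_top"
        using tendsto_diff[OF tendsto_const[of 1] tendsto_mult[OF tendsto_const[of "1 / x - 1"] z']] by simp
      show "((\<lambda>t. 1) \<longlongrightarrow> (1::real)) at_top" by simp
      show "\<forall>\<^sub>F t in at_top. K (t * x) / K t \<le> 1"
        using eventually_gt_at_top[of 0]
        by eventually_elim (use False x K_mono K_pos in \<open>simp add: mult_left_le divide_le_eq\<close>)
      show "\<forall>\<^sub>F t in at_top. 1 - (1 / x - 1) * (t * x * tail (t * x) / K (t * x)) \<le> K (t * x) / K t"
        using eventually_gt_at_top[of 0]
      proof eventually_elim
        case (elim t)
        have Kp: "0 < K (t * x)" "0 < K t" using K_pos elim x by auto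
        have "K t - K (t * x) \<le> (t - t * x) * tail (t * x)"
          using False elim x by (intro K_diff_bounds[OF m]) (auto simp: mult_left_le)
        then have "(K t - K (t * x)) / K t \<le> (t - t * x) * tail (t * x) / K t"
          using Kp by (intro divide_right_mono) auto
        then have "1 - K (t * x) / K t \<le> (t - t * x) * tail (t * x) / K t"
          using Kp by (simp add: diff_divide_distrib)
        also have "\<dots> \<le> (t - t * x) * tail (t * x) / K (t * x)"
          using Kp elim x False tail_nonneg
          by (intro divide_left_mono K_mono mult_nonneg_nonneg) (auto simp: mult_left_le)
        also have "\<dots> = (1 / x - 1) * (t * x * tail (t * x) / K (t * x))"
          using x Kp by (simp add: field_simps)
        finally show ?case by simp
      qed
    qed
  qed
qed

section \<open>Asymptotics of the two moment integrals\<close>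

lemma moment_growth:
  assumes j: "mono j" "\<And>t. 0 \<le> j t" "\<And>t. 0 < t \<Longrightarrow> 0 < j t"
    and lj: "\<And>z. 0 < z \<Longrightarrow> has_bochner_integral lborel (\<lambda>t. indicator {0..} t * (exp (- z * t) * j t)) (1 / (z * (1 - lap z)))"
    and RV: "\<And>x. 0 < x \<Longrightarrow> ((\<lambda>T. K (T * x) / K T) \<longlongrightarrow> x powr \<rho>) at_top" and \<rho>: "0 \<le> \<rho>" "\<rho> \<le> 1"
  shows "((\<lambda>t. cumulative j t * (K t / t ^ 2))
      \<longlongrightarrow> 1 / (Gamma (1 + \<rho>) * Gamma (3 - \<rho>))) at_top"
    and "((\<lambda>t. square_convolution j t * (K t ^ 3 / t ^ 4))
      \<longlongrightarrow> Beta (3 - 2 * \<rho>) (2 - \<rho>) / (Gamma (1 + \<rho>) * Gamma (2 - \<rho>)) ^ 3) at_top"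
proof -
  define c where "c = 1 / (Gamma (1 + \<rho>) * Gamma (2 - \<rho>))"
  have G: "Gamma (1 + \<rho>) > 0" "Gamma (2 - \<rho>) > 0" "Gamma (3 - \<rho>) > 0"
    using \<rho> by (auto intro!: Gamma_real_pos)
  then have c: "c > 0" by (simp add: c_def)
  have jc: "((\<lambda>T. j T * K T / T) \<longlongrightarrow> c) at_top"
    unfolding c_def by (rule renewal_growth[OF j(1,2) lj RV \<rho>])
  \<comment> \<open>The index of \<open>j\<close> follows by dividing the limit \<open>jc\<close>
    along Tx by the limit along T.\<close>
  have jRV: "((\<lambda>T. j (T * x) / j T) \<longlongrightarrow> x powr (1 - \<rho>)) at_top" if x: "0 < x" for x
  proof -
    have "filterlim (\<lambda>T. T * x) at_top at_top" using x by real_asymp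
    note jc' = filterlim_compose[OF jc this]
    have "((\<lambda>T. (j (T * x) * K (T * x) / (T * x)) / (j T * K T / T) * x / (K (T * x) / K T)) \<longlongrightarrow> c / c * x / x powr \<rho>) at_top"
      using c x by (intro tendsto_intros jc jc' RV) auto
    moreover have "c / c * x / x powr \<rho> = x powr (1 - \<rho>)" using c x by (simp add: powr_diff)
    moreover have "\<forall>\<^sub>F T in at_top. (j (T * x) * K (T * x) / (T * x)) / (j T * K T / T) * x / (K (T * x) / K T) = j (T * x) / j T"
      using eventually_gt_at_top[of 0]
    proof eventually_elim
      case (elim T)
      then show ?case using x K_pos[of T] K_pos[of "T * x"] by simp
    qed
    ultimately show ?thesis by (auto elim: Lim_transform_eventually)
  qed
  have \<alpha>: "0 \<le> 1 - \<rho>" using \<rho> by simp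
  \<comment> \<open>Relative to t j(t), and below to t j(t)^3, the integrals have Beta limits; the
    second factor trades j(t) for c t/K(t).\<close>
  have 1: "((\<lambda>t. cumulative j t / (t * j t) * (j t * K t / t))
      \<longlongrightarrow> Beta 1 (1 - \<rho> + 1) * c) at_top"
    using rv_convolution[OF j jRV \<alpha>, of 0 1] by (intro tendsto_mult jc) simp
  have 2: "((\<lambda>t. square_convolution j t / (t * j t ^ 3) * (j t * K t / t) ^ 3)
      \<longlongrightarrow> Beta (2 * (1 - \<rho>) + 1) (1 - \<rho> + 1) * c ^ 3) at_top"
    using rv_convolution[OF j jRV \<alpha>, of 2 1] by (intro tendsto_mult tendsto_power jc) simp
  \<comment> \<open>Beta(1, 2 - \<rho>) = \<Gamma>(2 - \<rho>)/\<Gamma>(3 - \<rho>), whose numerator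
    cancels against \<open>c\<close>.\<close>
  have "Beta 1 (1 - \<rho> + 1) * c = 1 / (Gamma (1 + \<rho>) * Gamma (3 - \<rho>))"
    using G by (simp add: Beta_def c_def)
  moreover have "\<forall>\<^sub>F t in at_top. cumulative j t / (t * j t) * (j t * K t / t)
    = cumulative j t * (K t / t ^ 2)"
    using eventually_gt_at_top[of 0]
  proof eventually_elim
    case (elim t)
    then show ?case using j(3)[OF elim] by (simp add: power2_eq_square)
  qed
  ultimately show "((\<lambda>t. cumulative j t * (K t / t ^ 2))
      \<longlongrightarrow> 1 / (Gamma (1 + \<rho>) * Gamma (3 - \<rho>))) at_top"
    using 1 by (auto elim: Lim_transform_eventually)
  have "Beta (2 * (1 - \<rho>) + 1) (1 - \<rho> + 1) * c ^ 3 = Beta (3 - 2 * \<rho>) (2 - \<rho>) / (Gamma (1 + \<rho>) * Gamma (2 - \<rho>)) ^ 3"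
    by (simp add: c_def power_divide)
  moreover have "\<forall>\<^sub>F t in at_top. square_convolution j t / (t * j t ^ 3) * (j t * K t / t) ^ 3
    = square_convolution j t * (K t ^ 3 / t ^ 4)"
    using eventually_gt_at_top[of 0]
  proof eventually_elim
    case (elim t)
    then show ?case using j(3)[OF elim] by (simp add: power_mult_distrib power_divide power_numeral_reduce)
  qed
  ultimately show "((\<lambda>t. square_convolution j t * (K t ^ 3 / t ^ 4))
      \<longlongrightarrow> Beta (3 - 2 * \<rho>) (2 - \<rho>) / (Gamma (1 + \<rho>) * Gamma (2 - \<rho>)) ^ 3) at_top"
    using 2 by (auto elim: Lim_transform_eventually)
qed

end

section \<open>Predictable integrands\<close>

context point_process
begin

lemma sets_F_M: "0 \<le> t \<Longrightarrow> sets (F t) \<subseteq> sets M"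
  using subalgebra_F[of t] by (simp add: subalgebra_def)

lemma arrival_mono:
  assumes "w \<in> space M" "i \<le> j"
  shows "\<tau> i w \<le> \<tau> j w"
  using assms(2)
proof (induction j rule: dec_induct)
  case (step j)
  then show ?case
    using arrival_less[OF assms(1), of j] arrival_infinity[OF assms(1), of j]
    by (cases "\<tau> j w = \<infinity>") (auto intro: order_trans less_imp_le)
qed simp

lemma arrival_strict: "w \<in> space M \<Longrightarrow> i < j \<Longrightarrow> \<tau> i w < \<infinity> \<Longrightarrow> \<tau> i w < \<tau> j w"
  using arrival_less[of w i] arrival_mono[of w "Suc i" j] by (auto intro: less_le_trans)

lemma arrival_less_iff:
  assumes "w \<in> space M" "\<tau> i w < \<infinity>"
  shows "\<tau> j w < \<tau> i w \<longleftrightarrow> j < i"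
proof (cases "j < i")
  case True
  then have "\<tau> j w < \<infinity>"
    using arrival_mono[OF assms(1), of j i] assms(2) by (auto intro: le_less_trans)
  then show ?thesis
    using arrival_strict[OF assms(1) True] True by simp
next
  case False
  then show ?thesis
    using arrival_mono[OF assms(1), of i j] by (simp add: not_less)
qed

lemma finite_down_closed_eq_lessThan:
  assumes "finite A" "\<And>i j::nat. i \<le> j \<Longrightarrow> j \<in> A \<Longrightarrow> i \<in> A"
  shows "A = {..<card A}"
proof (cases "A = {}")
  case False
  have "A = {..Max A}"
    using assms False by (auto intro: assms(2)[OF _ Max_in])
  then have "A = {..<Suc (Max A)}" unfolding lessThan_Suc_atMost .
  then show ?thesis by (metis card_lessThan)
qed simp

text \<open>The arrivals up to \<open>t\<close> occupy an initial segment of the indices, whose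
  length is the count; as indices start at 0, the inequality is strict. Through it the adaptedness
  of the count becomes a property of the arrival times.\<close>

lemma arrival_le_iff:
  assumes "w \<in> space M"
  shows "\<tau> i w \<le> ereal t \<longleftrightarrow> i < event_count \<tau> t w"
proof -
  have "{i. \<tau> i w \<le> ereal t} = {..<card {i. \<tau> i w \<le> ereal t}}"
    using locally_finite[OF assms] arrival_mono[OF assms]
    by (intro finite_down_closed_eq_lessThan) (auto intro: order_trans)
  moreover have "event_count \<tau> t w = card {i. \<tau> i w \<le> ereal t}"
    using assms arrival_pos by (simp add: event_count_def)
  ultimately show ?thesis by (metis lessThan_iff mem_Collect_eq)
qed

lemma arrival_le_sets:
  assumes "0 \<le> t"
  shows "{w \<in> space M. \<tau> i w \<le> ereal t} \<in> sets (F t)"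
proof -
  have "event_count \<tau> t -` {i<..} \<inter> space (F t) \<in> sets (F t)"
    using adapted[OF assms] by (rule measurable_sets) auto
  also have "event_count \<tau> t -` {i<..} \<inter> space (F t) = {w \<in> space M. \<tau> i w \<le> ereal t}"
    using assms by (auto simp: space_F arrival_le_iff)
  finally show ?thesis .
qed

lemma arrival_le_sets_min:
  assumes "0 \<le> t"
  shows "{w \<in> space M. \<tau> i w \<le> ereal t \<and> \<tau> i w \<le> c} \<in> sets (F t)"
proof (cases "c \<le> 0")
  case True
  then have "\<not> \<tau> i w \<le> c" if "w \<in> space M" for w
    using arrival_pos[OF that, of i] by (metis leD order_less_le_trans)
  then have eq: "{w \<in> space M. \<tau> i w \<le> ereal t \<and> \<tau> i w \<le> c} = {}"
    by blast
  show ?thesis unfolding eq by simp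
next
  case False
  define s where "s = min (ereal t) c"
  have s: "0 \<le> real_of_ereal s" "real_of_ereal s \<le> t" "ereal (real_of_ereal s) = s"
    using False assms by (cases c; auto simp: s_def min_def)+
  have "{w \<in> space M. \<tau> i w \<le> ereal t \<and> \<tau> i w \<le> c} = {w \<in> space M. \<tau> i w \<le> ereal (real_of_ereal s)}"
    unfolding s(3) by (auto simp: s_def)
  then show ?thesis
    using arrival_le_sets[OF s(1)] sets_F_mono[OF s(2)] by auto
qed

lemma borel_measurable_arrival [measurable]: "\<tau> i \<in> borel_measurable M"
proof (rule borel_measurableI_le)
  fix c
  have "{w \<in> space M. \<tau> i w \<le> ereal t} \<in> sets M" for t
  proof (cases "0 \<le> t")
    case False
    then have "\<not> \<tau> i w \<le> ereal t" if "w \<in> space M" for w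
      using arrival_pos[OF that, of i] by (cases "\<tau> i w") auto
    then have eq: "{w \<in> space M. \<tau> i w \<le> ereal t} = {}" by blast
    show ?thesis unfolding eq by simp
  qed (use arrival_le_sets[of t i] sets_F_M[of t] in auto)
  then show "{w \<in> space M. \<tau> i w \<le> c} \<in> sets M"
  proof (cases c)
    case MInf
    then have eq: "{w \<in> space M. \<tau> i w \<le> c} = {}" using arrival_pos[of _ i] by force
    show ?thesis unfolding eq by simp
  qed auto
qed

text \<open>
  As a function of \<open>(s, w)\<close> this is predictable, unlike \<open>\<tau> i\<close> itself.
\<close>

definition past_arrival :: "nat \<Rightarrow> real \<Rightarrow> 'a \<Rightarrow> ereal" where
  "past_arrival i s w = (if \<tau> i w < ereal s then \<tau> i w else \<infinity>)"

text \<open>A rational \<open>q\<close> between the arrival and \<open>s\<close> replaces \<tau> < s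
  by countably many events, each already decided at the time q < s. This one decomposition gives
  both \<open>F s\<close>-measurability and predictability. The value c = \<infinity> is set apart,
  being the default for arrivals not in the past.\<close>

lemma past_arrival_le_iff:
  assumes "c \<noteq> \<infinity>" "w \<in> space M"
  shows "past_arrival i s w \<le> c \<longleftrightarrow> (\<exists>q\<in>\<rat> \<inter> {0..}. q < s \<and> \<tau> i w \<le> ereal q \<and> \<tau> i w \<le> c)"
proof
  assume "past_arrival i s w \<le> c"
  then have *: "\<tau> i w < ereal s" "\<tau> i w \<le> c"
    using assms by (auto simp: past_arrival_def top_unique split: if_splits)
  then obtain r where r: "\<tau> i w = ereal r" "0 < r" "r < s"
    using arrival_pos[OF assms(2), of i] by (cases "\<tau> i w") auto
  then obtain q where "q \<in> \<rat>" "r < q" "q < s" using Rats_dense_in_real by blast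
  then show "\<exists>q\<in>\<rat> \<inter> {0..}. q < s \<and> \<tau> i w \<le> ereal q \<and> \<tau> i w \<le> c"
    using r * by (intro bexI[of _ q]) auto
next
  assume "\<exists>q\<in>\<rat> \<inter> {0..}. q < s \<and> \<tau> i w \<le> ereal q \<and> \<tau> i w \<le> c"
  then show "past_arrival i s w \<le> c"
    by (auto simp: past_arrival_def intro: le_less_trans)
qed

lemma borel_measurable_past_arrival:
  assumes "0 \<le> s"
  shows "past_arrival i s \<in> borel_measurable (F s)"
proof (rule borel_measurableI_le)
  fix c
  show "{w \<in> space (F s). past_arrival i s w \<le> c} \<in> sets (F s)"
  proof (cases "c = \<infinity>")
    case False
    have "{w \<in> space (F s). past_arrival i s w \<le> c}
        = (\<Union>q\<in>\<rat> \<inter> {0..<s}. {w \<in> space M. \<tau> i w \<le> ereal q \<and> \<tau> i w \<le> c})"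
      using past_arrival_le_iff[OF False] unfolding space_F by fastforce
    also have "\<dots> \<in> sets (F s)"
    proof (rule sets.countable_UN'')
      show "countable (\<rat> \<inter> {0..<s})" by (simp add: countable_rat)
      show "{w \<in> space M. \<tau> i w \<le> ereal q \<and> \<tau> i w \<le> c} \<in> sets (F s)" if "q \<in> \<rat> \<inter> {0..<s}" for q
        using arrival_le_sets_min[of q i c] sets_F_mono[of q s] that by auto
    qed
    finally show ?thesis .
  qed simp
qed

abbreviation P :: "(real \<times> 'a) measure" where
  "P \<equiv> predictable_sigma (space M) F"

lemma space_P: "space P = {0..} \<times> space M"
  by (simp add: predictable_sigma_def space_measure_of_conv)

lemma predictable_generators_Pow:
  "({{0} \<times> A |A. A \<in> sets (F 0)} \<union> {{s<..t} \<times> A |s t A. 0 \<le> s \<and> s \<le> t \<and> A \<in> sets (F s)}) \<subseteq> Pow ({0..} \<times> space M)"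
  using sets.sets_into_space space_F by fastforce

lemma predictable_Ioc:
  "0 \<le> s \<Longrightarrow> s \<le> t \<Longrightarrow> A \<in> sets (F s) \<Longrightarrow> {s<..t} \<times> A \<in> sets P"
  unfolding predictable_sigma_def sets_measure_of[OF predictable_generators_Pow]
  by (rule sigma_sets.Basic) auto

lemma predictable_zero: "A \<in> sets (F 0) \<Longrightarrow> {0} \<times> A \<in> sets P"
  unfolding predictable_sigma_def sets_measure_of[OF predictable_generators_Pow]
  by (rule sigma_sets.Basic) auto

lemma predictable_Ioi:
  assumes "0 \<le> s" "A \<in> sets (F s)"
  shows "{s<..} \<times> A \<in> sets P"
proof -
  have "(\<Union>n::nat. {s<..s + real n} \<times> A) \<in> sets P"
    using assms predictable_Ioc[of s _ A] by (intro sets.countable_UN) auto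
  also have "(\<Union>n::nat. {s<..s + real n} \<times> A) = {s<..} \<times> A"
  proof -
    have "\<exists>n. x \<le> s + real n" for x
      using real_arch_simple[of "x - s"] by (auto simp: algebra_simps)
    then show ?thesis by auto
  qed
  finally show ?thesis .
qed

lemma space_M_F: "0 \<le> t \<Longrightarrow> space M \<in> sets (F t)"
  using sets.top[of "F t"] by (simp add: space_F)

lemma predictable_fst [measurable]: "fst \<in> borel_measurable P"
proof (rule borel_measurableI_le)
  fix c :: real
  show "{x \<in> space P. fst x \<le> c} \<in> sets P"
  proof (cases "0 \<le> c")
    case True
    have "{0} \<times> space M \<union> {0<..c} \<times> space M \<in> sets P"
      using True by (intro sets.Un predictable_zero predictable_Ioc space_M_F) auto
    also have "{0} \<times> space M \<union> {0<..c} \<times> space M = {x \<in> space P. fst x \<le> c}"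
      using True by (auto simp: space_P)
    finally show ?thesis .
  next
    case False
    then have eq: "{x \<in> space P. fst x \<le> c} = {}" by (auto simp: space_P)
    show ?thesis unfolding eq by simp
  qed
qed

lemma predictable_past_arrival [measurable]: "(\<lambda>x. past_arrival i (fst x) (snd x)) \<in> borel_measurable P"
proof (rule borel_measurableI_le)
  fix c
  show "{x \<in> space P. past_arrival i (fst x) (snd x) \<le> c} \<in> sets P"
  proof (cases "c = \<infinity>")
    case False
    have "{x \<in> space P. past_arrival i (fst x) (snd x) \<le> c}
        = (\<Union>q\<in>\<rat> \<inter> {0..}. {q<..} \<times> {w \<in> space M. \<tau> i w \<le> ereal q \<and> \<tau> i w \<le> c})"
      using past_arrival_le_iff[OF False] by (auto simp: space_P)
    also have "\<dots> \<in> sets P"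
    proof (rule sets.countable_UN'')
      show "countable (\<rat> \<inter> {0::real..})" by (simp add: countable_rat)
      show "{q<..} \<times> {w \<in> space M. \<tau> i w \<le> ereal q \<and> \<tau> i w \<le> c} \<in> sets P" if "q \<in> \<rat> \<inter> {0..}" for q
        using arrival_le_sets_min[of q i c] that by (intro predictable_Ioi) auto
    qed
    finally show ?thesis .
  qed simp
qed

text \<open>A random factor known at time \<open>u\<close> is predictable when it acts only after
  \<open>u\<close>. It serves for the factor frozen at \<open>u\<close> in
  \<open>cross_sum\<close>.\<close>

lemma predictable_after:
  fixes Z :: "'a \<Rightarrow> ennreal"
  assumes u: "0 \<le> u" and Z: "Z \<in> borel_measurable (F u)"
  shows "(\<lambda>x. if u < fst x then Z (snd x) else 0) \<in> borel_measurable P"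
proof (rule borel_measurableI_greater)
  fix a :: ennreal
  have "Z -` {a<..} \<inter> space (F u) \<in> sets (F u)"
    using Z by (rule measurable_sets) auto
  also have "Z -` {a<..} \<inter> space (F u) = {w \<in> space M. a < Z w}"
    by (auto simp: space_F)
  finally have "{w \<in> space M. a < Z w} \<in> sets (F u)" .
  from predictable_Ioi[OF u this]
  have "{u<..} \<times> {w \<in> space M. a < Z w} \<in> sets P" .
  also have "{u<..} \<times> {w \<in> space M. a < Z w} = {x \<in> space P. a < (if u < fst x then Z (snd x) else 0)}"
    using u by (auto simp: space_P split: if_splits)
  finally show "{x \<in> space P. a < (if u < fst x then Z (snd x) else 0)} \<in> sets P" .
qed

lemma predictableI: "(\<lambda>x. C (fst x) (snd x)) \<in> borel_measurable P \<Longrightarrow> predictable (space M) F C"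
  by (simp add: predictable_def case_prod_beta')

lemma predictableD: "predictable (space M) F C \<Longrightarrow> (\<lambda>x. C (fst x) (snd x)) \<in> borel_measurable P"
  by (simp add: predictable_def case_prod_beta')

end

text \<open>Cutting the kernel off at \<open>0\<close> loses nothing, as its values on \<open>s \<le> 0\<close> do not enter the intensity.\<close>

locale hawkes_cut = hawkes_process M F \<tau> \<mu>\<^sub>0 \<phi>
  for M :: "'a measure" and F :: "real \<Rightarrow> 'a measure" and \<tau> :: "nat \<Rightarrow> 'a \<Rightarrow> ereal"
    and \<mu>\<^sub>0 :: real and \<phi> :: "real \<Rightarrow> real" +
  assumes mu0: "0 < \<mu>\<^sub>0"
    and phi_borel [measurable]: "\<phi> \<in> borel_measurable borel"
    and phi_nonneg: "\<And>s. 0 \<le> \<phi> s"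
    and phi_zero: "\<And>s. s \<le> 0 \<Longrightarrow> \<phi> s = 0"
begin

definition p :: "real \<Rightarrow> ennreal" where "p s = ennreal (\<phi> s)"

lemma p_measurable [measurable]: "p \<in> borel_measurable borel"
  unfolding p_def by measurable

lemma p_zero: "s \<le> 0 \<Longrightarrow> p s = 0"
  by (simp add: p_def phi_zero)

text \<open>Summed over the arrivals, this is the integral of \<open>g\<close> against dN; an
  arrival at infinity is an event that does not happen.\<close>

definition at_arrival :: "(real \<Rightarrow> ennreal) \<Rightarrow> ereal \<Rightarrow> ennreal" where
  "at_arrival g x = (if x < \<infinity> then g (real_of_ereal x) else 0)"

lemma at_arrival_measurable [measurable]:
  assumes [measurable]: "g \<in> borel_measurable borel"
  shows "at_arrival g \<in> borel_measurable borel"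
  unfolding at_arrival_def by measurable

abbreviation excite :: "real \<Rightarrow> nat \<Rightarrow> 'a \<Rightarrow> ennreal" where
  "excite s i w \<equiv> at_arrival (\<lambda>r. p (s - r)) (\<tau> i w)"

abbreviation hit :: "real \<Rightarrow> nat \<Rightarrow> 'a \<Rightarrow> ennreal" where
  "hit t i w \<equiv> if \<tau> i w \<le> ereal t then 1 else 0"

text \<open>The intensity as a full series: the terms of present and future arrivals vanish because
  \<open>p\<close> is 0 on nonpositive arguments.\<close>

definition Lam :: "real \<Rightarrow> 'a \<Rightarrow> ennreal" where
  "Lam s w = ennreal \<mu>\<^sub>0 + (\<Sum>i. excite s i w)"

lemma Lam_measurable [measurable (raw)]:
  assumes [measurable]: "g \<in> borel_measurable N" "h \<in> N \<rightarrow>\<^sub>M M"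
  shows "(\<lambda>x. Lam (g x) (h x)) \<in> borel_measurable N"
  unfolding Lam_def at_arrival_def by measurable

text \<open>As \<open>p\<close> vanishes on nonpositive arguments, an arrival not strictly before
  \<open>s\<close> may be moved to infinity; the right-hand side then uses only what is known at
  time \<open>s\<close>.\<close>

lemma Lam_past: "w \<in> space M \<Longrightarrow> Lam s w = ennreal \<mu>\<^sub>0 + (\<Sum>i. at_arrival (\<lambda>r. p (s - r)) (past_arrival i s w))"
proof -
  assume w: "w \<in> space M"
  have "excite s i w = at_arrival (\<lambda>r. p (s - r)) (past_arrival i s w)" for i
    using arrival_pos[OF w, of i]
    by (cases "\<tau> i w") (auto simp: at_arrival_def past_arrival_def p_zero)
  then show ?thesis by (simp add: Lam_def)
qed

lemma Lam_adapted: "0 \<le> s \<Longrightarrow> Lam s \<in> borel_measurable (F s)"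
proof -
  assume s: "0 \<le> s"
  note [measurable] = borel_measurable_past_arrival[OF s]
  have "(\<lambda>w. ennreal \<mu>\<^sub>0 + (\<Sum>i. at_arrival (\<lambda>r. p (s - r)) (past_arrival i s w))) \<in> borel_measurable (F s)"
    by measurable
  then show ?thesis
    by (rule measurable_cong[THEN iffD1, rotated]) (simp add: space_F Lam_past)
qed

lemma Lam_eq:
  assumes w: "w \<in> space M"
  shows "ennreal (hawkes_intensity \<mu>\<^sub>0 \<phi> \<tau> s w) = Lam s w"
proof -
  define A where "A = {i. 0 < \<tau> i w \<and> \<tau> i w < ereal s}"
  have A: "finite A"
    by (rule finite_subset[OF _ locally_finite[OF w, of s]]) (auto simp: A_def)
  have "(\<Sum>i. excite s i w) = (\<Sum>i\<in>A. excite s i w)"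
  proof (rule suminf_finite[OF A])
    fix i assume "i \<notin> A"
    then show "excite s i w = 0"
      using arrival_pos[OF w, of i] by (cases "\<tau> i w") (auto simp: A_def at_arrival_def p_zero)
  qed
  also have "\<dots> = (\<Sum>i\<in>A. ennreal (\<phi> (s - real_of_ereal (\<tau> i w))))"
    by (intro sum.cong) (auto simp: A_def at_arrival_def p_def)
  also have "\<dots> = ennreal (\<Sum>i\<in>A. \<phi> (s - real_of_ereal (\<tau> i w)))"
    by (rule sum_ennreal) (simp add: phi_nonneg)
  finally show ?thesis
    using mu0 by (simp add: Lam_def hawkes_intensity_def A_def[symmetric] sum_nonneg phi_nonneg)
qed

section \<open>Compensation formula and second moment of the stopped process\<close>

abbreviation Lam0 :: "real \<Rightarrow> 'a \<Rightarrow> ennreal" where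
  "Lam0 s w \<equiv> indicator {0..} s * Lam s w"

lemma intensity_formula:
  assumes "predictable (space M) F C"
  shows "(\<integral>\<^sup>+w. (\<Sum>i. at_arrival (\<lambda>r. C r w) (\<tau> i w)) \<partial>M)
    = (\<integral>\<^sup>+w. (\<integral>\<^sup>+s. C s w * Lam0 s w \<partial>lborel) \<partial>M)"
proof -
  have "(\<integral>\<^sup>+w. (\<Sum>i. if \<tau> i w < \<infinity> then C (real_of_ereal (\<tau> i w)) w else 0) \<partial>M)
     = (\<integral>\<^sup>+w. (\<integral>\<^sup>+s\<in>{0..}. C s w * ennreal (hawkes_intensity \<mu>\<^sub>0 \<phi> \<tau> s w) \<partial>lborel) \<partial>M)"
    using intensity assms by (simp add: has_intensity_def)
  also have "\<dots> = (\<integral>\<^sup>+w. (\<integral>\<^sup>+s. C s w * Lam0 s w \<partial>lborel) \<partial>M)"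
    by (intro nn_integral_cong) (simp add: Lam_eq mult_ac)
  finally show ?thesis by (simp add: at_arrival_def)
qed

text \<open>The density in \<open>s\<close> of the compensator of \<open>psum n f\<close>. The bound
  s \<le> \<tau> n includes the arrival \<tau> n itself, and \<open>not_past_iff\<close> makes it a
  predictable condition.\<close>

definition stopped :: "nat \<Rightarrow> (real \<Rightarrow> ennreal) \<Rightarrow> real \<Rightarrow> 'a \<Rightarrow> ennreal" where
  "stopped n f s w = indicator {0..} s * (if ereal s \<le> \<tau> n w then f s * Lam s w else 0)"

lemma stopped_measurable [measurable (raw)]:
  assumes [measurable]: "f \<in> borel_measurable borel" "g \<in> borel_measurable N" "h \<in> N \<rightarrow>\<^sub>M M"
  shows "(\<lambda>x. stopped n f (g x) (h x)) \<in> borel_measurable N"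
  unfolding stopped_def by measurable

lemma not_past_iff: "ereal s \<le> \<tau> n w \<longleftrightarrow> past_arrival n s w = \<infinity>"
  by (auto simp: past_arrival_def not_less)

lemma stopped_adapted:
  assumes [measurable]: "f \<in> borel_measurable borel" and s: "0 \<le> s"
  shows "stopped n f s \<in> borel_measurable (F s)"
proof -
  note [measurable] = borel_measurable_past_arrival[OF s] Lam_adapted[OF s]
  show ?thesis
    unfolding stopped_def not_past_iff by measurable
qed

definition psum :: "nat \<Rightarrow> (real \<Rightarrow> ennreal) \<Rightarrow> 'a \<Rightarrow> ennreal" where
  "psum n f w = (\<Sum>i\<le>n. at_arrival f (\<tau> i w))"

lemma psum_measurable [measurable]:
  assumes [measurable]: "f \<in> borel_measurable borel"
  shows "psum n f \<in> borel_measurable M"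
  unfolding psum_def by measurable

text \<open>The cut-off s \<le> \<tau> n is put into the predictable integrand; at a finite arrival
  \<tau> i it holds exactly when i \<le> n, which turns the series into a finite sum.\<close>

lemma stopped_formula:
  assumes [measurable]: "f \<in> borel_measurable borel" and D: "predictable (space M) F D"
  shows "(\<integral>\<^sup>+w. (\<Sum>i\<le>n. at_arrival (\<lambda>r. f r * D r w) (\<tau> i w)) \<partial>M)
    = (\<integral>\<^sup>+w. (\<integral>\<^sup>+s. D s w * stopped n f s w \<partial>lborel) \<partial>M)"
proof -
  define C where "C s w = (if ereal s \<le> \<tau> n w then f s * D s w else 0)" for s w
  note [measurable] = predictableD[OF D]
  have "predictable (space M) F C"
    unfolding C_def not_past_iff by (rule predictableI) measurable
  note intensity_formula[OF this]
  moreover have "(\<integral>\<^sup>+w. (\<Sum>i. at_arrival (\<lambda>r. C r w) (\<tau> i w)) \<partial>M)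
     = (\<integral>\<^sup>+w. (\<Sum>i\<le>n. at_arrival (\<lambda>r. f r * D r w) (\<tau> i w)) \<partial>M)"
  proof (rule nn_integral_cong)
    fix w assume w: "w \<in> space M"
    have real: "ereal (real_of_ereal (\<tau> i w)) = \<tau> i w" if "\<tau> i w < \<infinity>" for i
      using that arrival_pos[OF w, of i] by (cases "\<tau> i w") auto
    have "(\<Sum>i. at_arrival (\<lambda>r. C r w) (\<tau> i w)) = (\<Sum>i\<le>n. at_arrival (\<lambda>r. C r w) (\<tau> i w))"
    proof (rule suminf_finite)
      fix i assume "i \<notin> {..n}"
      then have "n < i" by simp
      then have "\<tau> n w < \<tau> i w" if "\<tau> i w < \<infinity>"
        using arrival_less_iff[OF w that] by simp
      then show "at_arrival (\<lambda>r. C r w) (\<tau> i w) = 0"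
        using real[of i] by (auto simp: at_arrival_def C_def)
    qed simp
    also have "\<dots> = (\<Sum>i\<le>n. at_arrival (\<lambda>r. f r * D r w) (\<tau> i w))"
    proof (rule sum.cong)
      fix i assume "i \<in> {..n}"
      then have "\<tau> i w \<le> \<tau> n w" using arrival_mono[OF w] by simp
      then show "at_arrival (\<lambda>r. C r w) (\<tau> i w) = at_arrival (\<lambda>r. f r * D r w) (\<tau> i w)"
        using real[of i] by (auto simp: at_arrival_def C_def)
    qed simp
    finally show "(\<Sum>i. at_arrival (\<lambda>r. C r w) (\<tau> i w)) = (\<Sum>i\<le>n. at_arrival (\<lambda>r. f r * D r w) (\<tau> i w))" .
  qed
  moreover have "(\<integral>\<^sup>+w. (\<integral>\<^sup>+s. C s w * Lam0 s w \<partial>lborel) \<partial>M)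
     = (\<integral>\<^sup>+w. (\<integral>\<^sup>+s. D s w * stopped n f s w \<partial>lborel) \<partial>M)"
    by (intro nn_integral_cong) (simp add: C_def stopped_def mult_ac)
  ultimately show ?thesis by simp
qed

lemma square_sum_ennreal:
  fixes x :: "nat \<Rightarrow> ennreal"
  shows "(\<Sum>i\<le>n. x i) ^ 2 = (\<Sum>i\<le>n. x i ^ 2) + 2 * (\<Sum>i\<le>n. x i * (\<Sum>j<i. x j))"
proof (induction n)
  case (Suc n)
  have "(\<Sum>i\<le>Suc n. x i) ^ 2 = (\<Sum>i\<le>n. x i) ^ 2 + x (Suc n) ^ 2 + 2 * (x (Suc n) * (\<Sum>i\<le>n. x i))"
    by (simp add: power2_eq_square distrib_left distrib_right mult_2 add_ac mult_ac)
  also have "\<dots> = (\<Sum>i\<le>Suc n. x i ^ 2) + 2 * (\<Sum>i\<le>Suc n. x i * (\<Sum>j<i. x j))"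
    unfolding Suc by (simp add: distrib_left add_ac lessThan_Suc_atMost)
  finally show ?case .
qed simp

text \<open>The left limit at \<open>s\<close> of the running sum of \<open>f\<close> over the
  arrivals; leaving out an arrival at \<open>s\<close> itself makes it predictable.\<close>

definition past_sum :: "nat \<Rightarrow> (real \<Rightarrow> ennreal) \<Rightarrow> real \<Rightarrow> 'a \<Rightarrow> ennreal" where
  "past_sum n f s w = (\<Sum>j\<le>n. at_arrival f (past_arrival j s w))"

lemma past_sum_measurable [measurable (raw)]:
  assumes [measurable]: "f \<in> borel_measurable borel" "g \<in> borel_measurable N" "h \<in> N \<rightarrow>\<^sub>M M"
  shows "(\<lambda>x. past_sum n f (g x) (h x)) \<in> borel_measurable N"
  unfolding past_sum_def past_arrival_def by measurable

lemma past_sum_predictable: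
  assumes [measurable]: "f \<in> borel_measurable borel"
  shows "predictable (space M) F (past_sum n f)"
  unfolding past_sum_def[abs_def] by (rule predictableI) measurable

text \<open>The sum of \<open>f\<close> over the arrivals after \<open>u\<close>, times the
  compensator density at \<open>u\<close>. For fixed \<open>u\<close> that density is known at
  \<open>u\<close>, so \<open>stopped_formula\<close> applies in the variable
  \<open>r\<close>.\<close>

definition cross_sum :: "nat \<Rightarrow> (real \<Rightarrow> ennreal) \<Rightarrow> real \<Rightarrow> 'a \<Rightarrow> ennreal" where
  "cross_sum n f u w = (\<Sum>i\<le>n. at_arrival (\<lambda>r. f r * (if u < r then stopped n f u w else 0)) (\<tau> i w))"

lemma cross_sum_measurable [measurable (raw)]:
  assumes [measurable]: "f \<in> borel_measurable borel" "g \<in> borel_measurable N" "h \<in> N \<rightarrow>\<^sub>M M"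
  shows "(\<lambda>x. cross_sum n f (g x) (h x)) \<in> borel_measurable N"
  unfolding cross_sum_def at_arrival_def by measurable

text \<open>
  With \<open>X = psum n f\<close> and its compensator \<open>Y\<close>, this is \<open>E (X - Y)\<^sup>2 = E \<integral> f\<^sup>2 \<Lambda>\<close>
  (up to the stopping time \<open>\<tau> n\<close>), arranged so that no term is subtracted and no
  integrability is needed.
\<close>

lemma second_moment_identity:
  fixes n :: nat
  assumes [measurable]: "f \<in> borel_measurable borel"
  defines "Y \<equiv> \<lambda>w. \<integral>\<^sup>+s. stopped n f s w \<partial>lborel"
  shows "(\<integral>\<^sup>+w. psum n f w ^ 2 \<partial>M) + (\<integral>\<^sup>+w. Y w ^ 2 \<partial>M)
    = (\<integral>\<^sup>+w. (\<integral>\<^sup>+s. f s * stopped n f s w \<partial>lborel) \<partial>M) + 2 * (\<integral>\<^sup>+w. psum n f w * Y w \<partial>M)"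
proof -
  interpret LM: pair_sigma_finite lborel M ..
  let ?l = "stopped n f"
  let ?q = "\<lambda>u w. \<integral>\<^sup>+s. (if u < s then ?l u w else 0) * ?l s w \<partial>lborel"
  let ?Xm = "past_sum n f"
  \<comment> \<open>With X for \<open>psum n f\<close>, \<open>d\<close> is the diagonal part,
    \<open>e\<close> the expected integral of X(s-) against dY(s), and \<open>h\<close> half of E
    Y^2. The proof finds E X^2 = d + 2e, E XY = e + h and E Y^2 = 2h, so both sides equal d + 2e +
    2h.\<close>
  define d where "d = (\<integral>\<^sup>+w. (\<integral>\<^sup>+s. f s * ?l s w \<partial>lborel) \<partial>M)"
  define e where "e = (\<integral>\<^sup>+w. (\<integral>\<^sup>+s. ?Xm s w * ?l s w \<partial>lborel) \<partial>M)"
  define h where "h = (\<integral>\<^sup>+w. (\<integral>\<^sup>+u. ?q u w \<partial>lborel) \<partial>M)"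
  have Y_meas [measurable]: "Y \<in> borel_measurable M"
    unfolding Y_def by measurable
  have XX: "(\<integral>\<^sup>+w. psum n f w ^ 2 \<partial>M) = d + 2 * e"
  proof -
    have pw: "psum n f w ^ 2 = (\<Sum>i\<le>n. at_arrival (\<lambda>r. f r * f r) (\<tau> i w)) + 2 * (\<Sum>i\<le>n. at_arrival (\<lambda>r. f r * ?Xm r w) (\<tau> i w))"
      if w: "w \<in> space M" for w
    proof -
      have "at_arrival f (\<tau> i w) * (\<Sum>j<i. at_arrival f (\<tau> j w)) = at_arrival (\<lambda>r. f r * ?Xm r w) (\<tau> i w)"
        if i: "i \<le> n" for i
      proof (cases "\<tau> i w < \<infinity>")
        case True
        then have r: "ereal (real_of_ereal (\<tau> i w)) = \<tau> i w"
          using arrival_pos[OF w, of i] by (cases "\<tau> i w") auto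
        have "?Xm (real_of_ereal (\<tau> i w)) w = (\<Sum>j\<le>n. if j < i then at_arrival f (\<tau> j w) else 0)"
          unfolding past_sum_def past_arrival_def r arrival_less_iff[OF w True]
          by (intro sum.cong) (auto simp: at_arrival_def)
        also have "\<dots> = (\<Sum>j<i. at_arrival f (\<tau> j w))"
          using i by (subst sum.inter_filter[symmetric]) (auto intro!: sum.cong)
        finally show ?thesis using True by (simp add: at_arrival_def)
      qed (simp add: at_arrival_def)
      moreover have "at_arrival f (\<tau> i w) ^ 2 = at_arrival (\<lambda>r. f r * f r) (\<tau> i w)" for i
        by (simp add: at_arrival_def power2_eq_square)
      ultimately show ?thesis
        unfolding psum_def square_sum_ennreal by simp
    qed
    have "(\<integral>\<^sup>+w. psum n f w ^ 2 \<partial>M) = (\<integral>\<^sup>+w. (\<Sum>i\<le>n. at_arrival (\<lambda>r. f r * f r) (\<tau> i w)) + 2 * (\<Sum>i\<le>n. at_arrival (\<lambda>r. f r * ?Xm r w) (\<tau> i w)) \<partial>M)"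
      by (intro nn_integral_cong pw)
    also have "\<dots> = (\<integral>\<^sup>+w. (\<Sum>i\<le>n. at_arrival (\<lambda>r. f r * f r) (\<tau> i w)) \<partial>M) + 2 * (\<integral>\<^sup>+w. (\<Sum>i\<le>n. at_arrival (\<lambda>r. f r * ?Xm r w) (\<tau> i w)) \<partial>M)"
    proof -
      have [measurable]: "(\<lambda>w. \<Sum>i\<le>n. at_arrival (\<lambda>r. f r * ?Xm r w) (\<tau> i w)) \<in> borel_measurable M"
        unfolding at_arrival_def by measurable
      show ?thesis by (simp add: nn_integral_add nn_integral_cmult)
    qed
    also have "(\<integral>\<^sup>+w. (\<Sum>i\<le>n. at_arrival (\<lambda>r. f r * f r) (\<tau> i w)) \<partial>M) = d"
      unfolding d_def by (rule stopped_formula, simp, rule predictableI, measurable)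
    also have "(\<integral>\<^sup>+w. (\<Sum>i\<le>n. at_arrival (\<lambda>r. f r * ?Xm r w) (\<tau> i w)) \<partial>M) = e"
      unfolding e_def by (rule stopped_formula[OF assms(1) past_sum_predictable[OF assms(1)]])
    finally show ?thesis .
  qed
  have XY: "(\<integral>\<^sup>+w. psum n f w * Y w \<partial>M) = e + h"
  proof -
    let ?B = "cross_sum n f"
    \<comment> \<open>The arrivals are split at the integration time u: those before u form
      \<open>past_sum\<close>, those after it \<open>cross_sum\<close>, and the finitely many u that
      are arrivals form a null set.\<close>
    have pw: "psum n f w * Y w = (\<integral>\<^sup>+u. ?Xm u w * ?l u w \<partial>lborel) + (\<integral>\<^sup>+u. ?B u w \<partial>lborel)" if w: "w \<in> space M" for w
    proof -
      have "psum n f w * Y w = (\<integral>\<^sup>+u. psum n f w * ?l u w \<partial>lborel)"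
        unfolding Y_def using w by (intro nn_integral_cmult[symmetric]) simp
      also have "\<dots> = (\<integral>\<^sup>+u. ?Xm u w * ?l u w + ?B u w \<partial>lborel)"
      proof (rule nn_integral_cong_AE)
        have "AE u in lborel. u \<notin> (\<lambda>i. real_of_ereal (\<tau> i w)) ` {..n}"
          by (intro AE_not_in finite_imp_null_set_lborel) auto
        then show "AE u in lborel. psum n f w * ?l u w = ?Xm u w * ?l u w + ?B u w"
        proof eventually_elim
          case (elim u)
          have "at_arrival f (\<tau> i w) * ?l u w = at_arrival f (past_arrival i u w) * ?l u w
              + at_arrival (\<lambda>r. f r * (if u < r then ?l u w else 0)) (\<tau> i w)" if "i \<le> n" for i
          proof -
            have "real_of_ereal (\<tau> i w) \<noteq> u" using elim that by auto
            then show ?thesis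
              using arrival_pos[OF w, of i] by (cases "\<tau> i w") (auto simp: at_arrival_def past_arrival_def)
          qed
          then show ?case
            by (simp add: psum_def past_sum_def cross_sum_def sum_distrib_right sum.distrib[symmetric])
        qed
      qed
      also have "\<dots> = (\<integral>\<^sup>+u. ?Xm u w * ?l u w \<partial>lborel) + (\<integral>\<^sup>+u. ?B u w \<partial>lborel)"
        using w by (intro nn_integral_add) simp_all
      finally show ?thesis .
    qed
    have "(\<integral>\<^sup>+w. psum n f w * Y w \<partial>M) = (\<integral>\<^sup>+w. (\<integral>\<^sup>+u. ?Xm u w * ?l u w \<partial>lborel) + (\<integral>\<^sup>+u. ?B u w \<partial>lborel) \<partial>M)"
      by (intro nn_integral_cong pw)
    also have "\<dots> = e + (\<integral>\<^sup>+w. (\<integral>\<^sup>+u. ?B u w \<partial>lborel) \<partial>M)"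
      unfolding e_def by (rule nn_integral_add) measurable
    also have "(\<integral>\<^sup>+w. (\<integral>\<^sup>+u. ?B u w \<partial>lborel) \<partial>M) = (\<integral>\<^sup>+u. (\<integral>\<^sup>+w. ?B u w \<partial>M) \<partial>lborel)"
      by (rule LM.Fubini') measurable
    \<comment> \<open>Now \<open>u\<close> is fixed, and compensation replaces the sum over the
      arrivals after \<open>u\<close> by an integral of the compensator density; for u < 0 both
      sides are 0.\<close>
    also have "\<dots> = (\<integral>\<^sup>+u. (\<integral>\<^sup>+w. ?q u w \<partial>M) \<partial>lborel)"
    proof (rule nn_integral_cong)
      fix u :: real
      show "(\<integral>\<^sup>+w. ?B u w \<partial>M) = (\<integral>\<^sup>+w. ?q u w \<partial>M)"
      proof (cases "0 \<le> u")
        case True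
        show ?thesis
          unfolding cross_sum_def
          by (rule stopped_formula, simp, rule predictableI, rule predictable_after[OF True])
            (rule stopped_adapted[OF _ True], simp)
      next
        case False
        then have "?l u w = 0" for w by (simp add: stopped_def)
        then show ?thesis by (simp add: cross_sum_def at_arrival_def cong: if_cong)
      qed
    qed
    also have "\<dots> = h"
      unfolding h_def by (rule LM.Fubini'[symmetric]) measurable
    finally show ?thesis .
  qed
  have YY: "(\<integral>\<^sup>+w. Y w ^ 2 \<partial>M) = 2 * h"
  proof -
    \<comment> \<open>The square is a double integral, cut along the null diagonal into two halves
      that Tonelli's theorem identifies.\<close>
    have "Y w ^ 2 = 2 * (\<integral>\<^sup>+u. ?q u w \<partial>lborel)"
      if w: "w \<in> space M" for w
    proof -
      have "Y w ^ 2 = (\<integral>\<^sup>+u. (\<integral>\<^sup>+s. ?l u w * ?l s w \<partial>lborel) \<partial>lborel)"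
        using w by (simp add: Y_def power2_eq_square nn_integral_cmult nn_integral_multc)
      also have "\<dots> = (\<integral>\<^sup>+u. (\<integral>\<^sup>+s. (if u < s then ?l u w else 0) * ?l s w + (if s < u then ?l s w else 0) * ?l u w \<partial>lborel) \<partial>lborel)"
      proof (rule nn_integral_cong, rule nn_integral_cong_AE)
        fix u :: real
        have "AE s in lborel. s \<noteq> u" by (rule AE_lborel_singleton)
        then show "AE s in lborel. ?l u w * ?l s w = (if u < s then ?l u w else 0) * ?l s w + (if s < u then ?l s w else 0) * ?l u w"
          by eventually_elim (auto simp: mult.commute)
      qed
      also have "\<dots> = (\<integral>\<^sup>+u. ?q u w \<partial>lborel)
          + (\<integral>\<^sup>+u. (\<integral>\<^sup>+s. (if s < u then ?l s w else 0) * ?l u w \<partial>lborel) \<partial>lborel)"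
        using w by (simp add: nn_integral_add)
      also have "(\<integral>\<^sup>+u. (\<integral>\<^sup>+s. (if s < u then ?l s w else 0) * ?l u w \<partial>lborel) \<partial>lborel)
          = (\<integral>\<^sup>+s. (\<integral>\<^sup>+u. (if s < u then ?l s w else 0) * ?l u w \<partial>lborel) \<partial>lborel)"
        using w by (intro lborel_pair.Fubini') simp
      finally show ?thesis by (simp add: mult_2)
    qed
    then have "(\<integral>\<^sup>+w. Y w ^ 2 \<partial>M) = (\<integral>\<^sup>+w. 2 * (\<integral>\<^sup>+u. ?q u w \<partial>lborel) \<partial>M)"
      by (intro nn_integral_cong)
    also have "\<dots> = 2 * h"
      unfolding h_def by (rule nn_integral_cmult) measurable
    finally show ?thesis .
  qed
  show ?thesis
    unfolding XX XY YY d_def[symmetric] by (simp add: distrib_left add_ac)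
qed

end

section \<open>Mean and variance of a Hawkes process\<close>

text \<open>The way back from a subtraction-free identity to a genuine second moment: integrable
  squares make the product integrable, so every term is finite, and \<open>d\<close> is finite as a
  consequence.\<close>

lemma (in prob_space) square_difference_identity:
  fixes X Y :: "'a \<Rightarrow> real"
  assumes [measurable]: "X \<in> borel_measurable M" "Y \<in> borel_measurable M"
    and nn: "\<And>w. w \<in> space M \<Longrightarrow> 0 \<le> X w" "\<And>w. w \<in> space M \<Longrightarrow> 0 \<le> Y w"
    and int: "integrable M (\<lambda>w. X w ^ 2)" "integrable M (\<lambda>w. Y w ^ 2)"
    and id: "(\<integral>\<^sup>+w. ennreal (X w ^ 2) \<partial>M) + (\<integral>\<^sup>+w. ennreal (Y w ^ 2) \<partial>M) = d + 2 * (\<integral>\<^sup>+w. ennreal (X w * Y w) \<partial>M)"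
  shows "integrable M (\<lambda>w. (X w - Y w) ^ 2)" "ennreal (\<integral>w. (X w - Y w) ^ 2 \<partial>M) = d"
proof -
  have iXY: "integrable M (\<lambda>w. X w * Y w)"
  proof (rule Bochner_Integration.integrable_bound)
    show "integrable M (\<lambda>w. X w ^ 2 + Y w ^ 2)" using int by simp
    have "\<bar>X w * Y w\<bar> \<le> X w ^ 2 + Y w ^ 2" for w
    proof -
      have "2 * (\<bar>X w\<bar> * \<bar>Y w\<bar>) \<le> X w ^ 2 + Y w ^ 2"
        using sum_squares_bound[of "\<bar>X w\<bar>" "\<bar>Y w\<bar>"] by simp
      moreover have "0 \<le> \<bar>X w\<bar> * \<bar>Y w\<bar>" by simp
      ultimately show ?thesis unfolding abs_mult by linarith
    qed
    then show "AE w in M. norm (X w * Y w) \<le> norm (X w ^ 2 + Y w ^ 2)"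
      by simp
  qed simp
  have eq: "(\<lambda>w. (X w - Y w) ^ 2) = (\<lambda>w. X w ^ 2 + Y w ^ 2 - 2 * (X w * Y w))"
    by (simp add: power2_diff algebra_simps)
  show "integrable M (\<lambda>w. (X w - Y w) ^ 2)"
    unfolding eq using int iXY by simp
  have I: "(\<integral>w. (X w - Y w) ^ 2 \<partial>M) = (\<integral>w. X w ^ 2 \<partial>M) + (\<integral>w. Y w ^ 2 \<partial>M) - 2 * (\<integral>w. X w * Y w \<partial>M)"
    unfolding eq using int iXY by simp
  have n: "(\<integral>\<^sup>+w. ennreal (X w ^ 2) \<partial>M) = ennreal (\<integral>w. X w ^ 2 \<partial>M)"
    "(\<integral>\<^sup>+w. ennreal (Y w ^ 2) \<partial>M) = ennreal (\<integral>w. Y w ^ 2 \<partial>M)"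
    "(\<integral>\<^sup>+w. ennreal (X w * Y w) \<partial>M) = ennreal (\<integral>w. X w * Y w \<partial>M)"
    using int iXY nn by (auto intro!: nn_integral_eq_integral AE_I2)
  have nn': "0 \<le> (\<integral>w. X w ^ 2 \<partial>M)" "0 \<le> (\<integral>w. Y w ^ 2 \<partial>M)" "0 \<le> (\<integral>w. X w * Y w \<partial>M)"
    using nn by (auto intro!: integral_nonneg_AE AE_I2)
  have *: "ennreal ((\<integral>w. X w ^ 2 \<partial>M) + (\<integral>w. Y w ^ 2 \<partial>M)) = d + ennreal (2 * (\<integral>w. X w * Y w \<partial>M))"
    using id nn' unfolding n by (simp add: ennreal_mult')
  then have "d \<noteq> \<infinity>" by (auto simp: top_add)
  then obtain r where r: "d = ennreal r" "0 \<le> r"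
    by (cases d) auto
  have "(\<integral>w. X w ^ 2 \<partial>M) + (\<integral>w. Y w ^ 2 \<partial>M) = r + 2 * (\<integral>w. X w * Y w \<partial>M)"
    using * nn' r by (simp add: ennreal_plus[symmetric] del: ennreal_plus)
  then show "ennreal (\<integral>w. (X w - Y w) ^ 2 \<partial>M) = d"
    unfolding I r by simp
qed

locale hawkes_finite = hawkes_cut M F \<tau> \<mu>\<^sub>0 \<phi>
  for M :: "'a measure" and F :: "real \<Rightarrow> 'a measure" and \<tau> :: "nat \<Rightarrow> 'a \<Rightarrow> ereal"
    and \<mu>\<^sub>0 :: real and \<phi> :: "real \<Rightarrow> real" +
  assumes J_finite: "\<And>t. renewal_fun p t < \<infinity>"
begin

abbreviation J :: "real \<Rightarrow> ennreal" where "J \<equiv> renewal_fun p"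

text \<open>
  The deterministic integrand with \<open>N(t) - E N(t) = \<integral> wt t s (dN(s) - \<Lambda>(s) ds)\<close>.
\<close>

definition wt :: "real \<Rightarrow> real \<Rightarrow> ennreal" where
  "wt t u = indicator {0..} u * J (t - u)"

definition mean :: "real \<Rightarrow> ennreal" where
  "mean t = ennreal \<mu>\<^sub>0 * (\<integral>\<^sup>+s. wt t s \<partial>lborel)"

definition count :: "real \<Rightarrow> 'a \<Rightarrow> ennreal" where
  "count t w = (\<Sum>i. hit t i w)"

definition total :: "real \<Rightarrow> 'a \<Rightarrow> ennreal" where
  "total t w = (\<Sum>i. at_arrival (wt t) (\<tau> i w))"

text \<open>The compensator of \<open>total t\<close>.\<close>

definition comp :: "real \<Rightarrow> 'a \<Rightarrow> ennreal" where
  "comp t w = (\<integral>\<^sup>+s. wt t s * Lam0 s w \<partial>lborel)"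

lemma wt_measurable [measurable]: "wt t \<in> borel_measurable borel"
  unfolding wt_def by measurable

lemma count_measurable [measurable]: "count t \<in> borel_measurable M"
  unfolding count_def by measurable

lemma total_measurable [measurable]: "total t \<in> borel_measurable M"
  unfolding total_def by measurable

lemma comp_measurable [measurable]: "comp t \<in> borel_measurable M"
  unfolding comp_def by measurable

lemma wt_zero: "t < u \<Longrightarrow> wt t u = 0"
  by (simp add: wt_def renewal_fun_neg p_zero)

lemma wt_le: "wt t u \<le> J t"
  using monoD[OF mono_renewal_fun, of "t - u" t p] by (cases "0 \<le> u") (auto simp: wt_def)

lemma count_eq: "w \<in> space M \<Longrightarrow> count t w = ennreal (real (event_count \<tau> t w))"
proof -
  assume w: "w \<in> space M"
  have "count t w = (\<Sum>i<event_count \<tau> t w. hit t i w)"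
    unfolding count_def by (rule suminf_finite) (auto simp: arrival_le_iff[OF w])
  also have "\<dots> = of_nat (event_count \<tau> t w)"
    by (simp add: arrival_le_iff[OF w])
  finally show ?thesis by (simp add: ennreal_of_nat_eq_real_of_nat)
qed

lemma real_arrival:
  assumes "w \<in> space M" "\<tau> i w < \<infinity>"
  obtains r where "\<tau> i w = ereal r" "0 < r"
  using assms arrival_pos[OF assms(1), of i] by (cases "\<tau> i w") auto

text \<open>The renewal equation of J seen from the horizon \<open>t\<close>: the weight of an event
  at \<open>r\<close> counts the event itself if r \<le> t, plus the weights of the later times at
  which it raises the intensity.\<close>

lemma wt_renewal:
  assumes "0 \<le> r"
  shows "wt t r = (if r \<le> t then 1 else 0) + (\<integral>\<^sup>+s. p (s - r) * wt t s \<partial>lborel)"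
proof -
  have "wt t r = indicator {0..} (t - r) + (\<integral>\<^sup>+v. p v * J (t - r - v) \<partial>lborel)"
    using assms by (simp add: wt_def renewal_equation[of p "t - r"])
  also have "(\<integral>\<^sup>+v. p v * J (t - r - v) \<partial>lborel) = (\<integral>\<^sup>+s. p (s - r) * J (t - r - (s - r)) \<partial>lborel)"
    by (rule nn_integral_lborel_shift[symmetric]) measurable
  also have "\<dots> = (\<integral>\<^sup>+s. p (s - r) * wt t s \<partial>lborel)"
  proof (rule nn_integral_cong)
    fix s
    show "p (s - r) * J (t - r - (s - r)) = p (s - r) * wt t s"
      using assms p_zero[of "s - r"] by (cases "s \<le> r") (auto simp: wt_def)
  qed
  finally show ?thesis by (simp add: indicator_def)
qed

lemma wt_at_arrival:
  assumes "w \<in> space M"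
  shows "at_arrival (wt t) (\<tau> i w) = hit t i w
    + (\<integral>\<^sup>+s. wt t s * excite s i w \<partial>lborel)"
proof (cases "\<tau> i w < \<infinity>")
  case True
  then obtain r where "\<tau> i w = ereal r" "0 < r" using real_arrival assms by blast
  then show ?thesis using wt_renewal[of r t] by (simp add: at_arrival_def mult.commute)
qed (simp add: at_arrival_def)

text \<open>Summing \<open>wt_renewal\<close> over the arrivals produces the excited part of the
  intensity, and \<open>mean t\<close> supplies the part due to \<open>\<mu>\<^sub>0\<close>. It is
  the relation N - mean = total - comp with all terms moved to the side where they are
  positive.\<close>

lemma total_decomposition:
  assumes "w \<in> space M"
  shows "total t w + mean t = count t w + comp t w"
proof -
  have [measurable]: "(\<lambda>s. excite s i w) \<in> borel_measurable borel" for i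
    unfolding at_arrival_def by measurable
  have "total t w = count t w + (\<Sum>i. \<integral>\<^sup>+s. wt t s * excite s i w \<partial>lborel)"
    unfolding total_def count_def wt_at_arrival[OF assms] by (rule suminf_add[symmetric]) auto
  also have "(\<Sum>i. \<integral>\<^sup>+s. wt t s * excite s i w \<partial>lborel)
      = (\<integral>\<^sup>+s. wt t s * (\<Sum>i. excite s i w) \<partial>lborel)"
    by (subst nn_integral_suminf[symmetric]) simp_all
  finally have 1: "total t w = count t w + (\<integral>\<^sup>+s. wt t s * (\<Sum>i. excite s i w) \<partial>lborel)" .
  have "comp t w = (\<integral>\<^sup>+s. ennreal \<mu>\<^sub>0 * wt t s + wt t s * (\<Sum>i. excite s i w) \<partial>lborel)"
    unfolding comp_def Lam_def
    by (intro nn_integral_cong) (auto simp: wt_def indicator_def distrib_left mult_ac)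
  also have "\<dots> = mean t + (\<integral>\<^sup>+s. wt t s * (\<Sum>i. excite s i w) \<partial>lborel)"
    unfolding mean_def by (subst nn_integral_add) (simp_all add: nn_integral_cmult)
  finally show ?thesis using 1 by (simp add: add_ac)
qed

text \<open>
  The stopped form of the previous identity; combined with \<open>E X = E Y < \<infinity>\<close> it excludes
  the infinite solution of the renewal equation for \<open>E N\<close>.
\<close>

lemma psum_decomposition:
  assumes w: "w \<in> space M"
  shows "(\<Sum>i\<le>n. hit t i w) + (\<integral>\<^sup>+s. stopped n (wt t) s w \<partial>lborel) \<le> psum n (wt t) w + mean t"
proof -
  have [measurable]: "(\<lambda>s. excite s i w) \<in> borel_measurable borel" for i
    unfolding at_arrival_def by measurable
  have "psum n (wt t) w = (\<Sum>i\<le>n. hit t i w)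
      + (\<Sum>i\<le>n. \<integral>\<^sup>+s. wt t s * excite s i w \<partial>lborel)"
    unfolding psum_def wt_at_arrival[OF w] by (rule sum.distrib)
  also have "(\<Sum>i\<le>n. \<integral>\<^sup>+s. wt t s * excite s i w \<partial>lborel)
      = (\<integral>\<^sup>+s. wt t s * (\<Sum>i\<le>n. excite s i w) \<partial>lborel)"
    by (subst nn_integral_sum[symmetric]) (simp_all add: sum_distrib_left)
  finally have 1: "psum n (wt t) w = (\<Sum>i\<le>n. hit t i w)
      + (\<integral>\<^sup>+s. wt t s * (\<Sum>i\<le>n. excite s i w) \<partial>lborel)" .
  \<comment> \<open>Only an inequality, as the left integrand is 0 after \<tau> n. Up to \<tau> n,
    arrivals of index above n do not act yet.\<close>
  have "(\<integral>\<^sup>+s. stopped n (wt t) s w \<partial>lborel)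
      \<le> (\<integral>\<^sup>+s. ennreal \<mu>\<^sub>0 * wt t s + wt t s * (\<Sum>i\<le>n. excite s i w) \<partial>lborel)"
  proof (rule nn_integral_mono)
    fix s
    show "stopped n (wt t) s w \<le> ennreal \<mu>\<^sub>0 * wt t s + wt t s * (\<Sum>i\<le>n. excite s i w)"
    proof (cases "ereal s \<le> \<tau> n w")
      case True
      have "(\<Sum>i. excite s i w) = (\<Sum>i\<le>n. excite s i w)"
      proof (rule suminf_finite)
        fix i assume "i \<notin> {..n}"
        then have "ereal s \<le> \<tau> i w" using True arrival_mono[OF w, of n i] by simp
        then show "excite s i w = 0"
          using arrival_pos[OF w, of i] by (cases "\<tau> i w") (auto simp: at_arrival_def p_zero)
      qed simp
      then show ?thesis
        using True by (auto simp: stopped_def Lam_def distrib_left mult_ac wt_def indicator_def)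
    qed (simp add: stopped_def)
  qed
  also have "\<dots> = mean t + (\<integral>\<^sup>+s. wt t s * (\<Sum>i\<le>n. excite s i w) \<partial>lborel)"
    unfolding mean_def by (subst nn_integral_add) (simp_all add: nn_integral_cmult)
  finally show ?thesis unfolding 1 by (simp add: add_ac add_left_mono)
qed

lemma psum_le: "psum n (wt t) w \<le> of_nat (Suc n) * J t"
proof -
  have "psum n (wt t) w \<le> (\<Sum>i\<le>n. J t)"
    unfolding psum_def by (intro sum_mono) (simp add: at_arrival_def wt_le)
  then show ?thesis by simp
qed

lemma mean_finite: "mean t < \<infinity>"
proof -
  have "(\<integral>\<^sup>+s. wt t s \<partial>lborel) \<le> (\<integral>\<^sup>+s. J t * indicator {0..t} s \<partial>lborel)"
  proof (rule nn_integral_mono)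
    fix s show "wt t s \<le> J t * indicator {0..t} s"
      using wt_le[of t s] wt_zero[of t s] by (cases "s \<in> {0..t}") (auto simp: wt_def)
  qed
  also have "\<dots> < \<infinity>"
    using J_finite[of t] by (simp add: nn_integral_cmult_indicator ennreal_mult_less_top emeasure_lborel_Icc_eq)
  finally show ?thesis by (simp add: mean_def ennreal_mult_less_top)
qed

lemma bounded_psum: "of_nat (Suc n) * J t < \<infinity>"
  using J_finite[of t] by (simp add: ennreal_mult_less_top of_nat_less_top)

section \<open>Finiteness and value of the mean\<close>

lemma predictable_deterministic: "f \<in> borel_measurable borel \<Longrightarrow> predictable (space M) F (\<lambda>s w. f s)"
  by (rule predictableI) simp

text \<open>\<open>psum n\<close> and its compensator have the same expectation, finite because
  \<open>psum n\<close> is bounded by (n + 1) J(t), so it cancels in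
  \<open>psum_decomposition\<close>. What remains is a bound uniform in n.\<close>

lemma expectation_count_le: "(\<integral>\<^sup>+w. count t w \<partial>M) \<le> mean t"
proof -
  have "(\<Sum>i\<le>n. \<integral>\<^sup>+w. hit t i w \<partial>M) \<le> mean t" for n
  proof -
    let ?X = "\<integral>\<^sup>+w. psum n (wt t) w \<partial>M"
    have eq: "?X = (\<integral>\<^sup>+w. (\<integral>\<^sup>+s. stopped n (wt t) s w \<partial>lborel) \<partial>M)"
      using stopped_formula[OF wt_measurable predictable_deterministic[of "\<lambda>_. 1"], where t1 = t and n = n] by (simp add: psum_def)
    have "?X \<le> (\<integral>\<^sup>+w. of_nat (Suc n) * J t \<partial>M)"
      by (intro nn_integral_mono psum_le)
    also have "\<dots> < \<infinity>" using bounded_psum[where n = n and t = t] by (simp add: emeasure_space_1)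
    finally have fin: "?X < \<infinity>" .
    have "(\<integral>\<^sup>+w. (\<Sum>i\<le>n. hit t i w) + (\<integral>\<^sup>+s. stopped n (wt t) s w \<partial>lborel) \<partial>M)
        \<le> (\<integral>\<^sup>+w. psum n (wt t) w + mean t \<partial>M)"
      by (intro nn_integral_mono psum_decomposition)
    then have "?X + (\<integral>\<^sup>+w. (\<Sum>i\<le>n. hit t i w) \<partial>M) \<le> ?X + mean t"
      by (simp add: nn_integral_add emeasure_space_1 eq[symmetric] add.commute)
    then have "(\<integral>\<^sup>+w. (\<Sum>i\<le>n. hit t i w) \<partial>M) \<le> mean t"
      using fin by (auto simp: ennreal_add_left_cancel_le)
    then show ?thesis by (simp add: nn_integral_sum)
  qed
  note partial = this
  have "(\<Sum>i. \<integral>\<^sup>+w. hit t i w \<partial>M) \<le> mean t"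
  proof (rule suminf_le_const)
    show "(\<Sum>i<n. \<integral>\<^sup>+w. hit t i w \<partial>M) \<le> mean t" for n
      by (rule order_trans[OF sum_mono2 partial[of n]]) auto
  qed simp
  then show ?thesis by (simp add: count_def nn_integral_suminf)
qed

lemma total_le: "w \<in> space M \<Longrightarrow> total t w \<le> J t * count t w"
proof -
  assume w: "w \<in> space M"
  have "at_arrival (wt t) (\<tau> i w) \<le> J t * hit t i w" for i
    using arrival_pos[OF w, of i] wt_le[of t] wt_zero[of t] by (cases "\<tau> i w") (auto simp: at_arrival_def)
  then have "total t w \<le> (\<Sum>i. J t * hit t i w)"
    unfolding total_def by (intro suminf_le) auto
  then show ?thesis by (simp add: count_def)
qed

lemma total_comp: "(\<integral>\<^sup>+w. total t w \<partial>M) = (\<integral>\<^sup>+w. comp t w \<partial>M)"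
  unfolding total_def comp_def
  by (rule intensity_formula[OF predictable_deterministic]) simp

lemma expectation_total_finite: "(\<integral>\<^sup>+w. total t w \<partial>M) < \<infinity>"
proof -
  have "(\<integral>\<^sup>+w. total t w \<partial>M) \<le> (\<integral>\<^sup>+w. J t * count t w \<partial>M)"
    by (intro nn_integral_mono total_le)
  also have "\<dots> \<le> J t * mean t"
    using expectation_count_le[of t] by (simp add: nn_integral_cmult mult_left_mono)
  also have "\<dots> < \<infinity>" using J_finite mean_finite by (simp add: ennreal_mult_less_top)
  finally show ?thesis .
qed

text \<open>Now that the count has finite mean, so has \<open>total\<close>, which is at most J(t)
  times the count; this equals the mean of \<open>comp\<close> and cancels in
  \<open>total_decomposition\<close>.\<close>

lemma expectation_count: "(\<integral>\<^sup>+w. count t w \<partial>M) = mean t"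
proof -
  have "(\<integral>\<^sup>+w. total t w + mean t \<partial>M) = (\<integral>\<^sup>+w. count t w + comp t w \<partial>M)"
    by (intro nn_integral_cong total_decomposition)
  then have "(\<integral>\<^sup>+w. comp t w \<partial>M) + mean t = (\<integral>\<^sup>+w. comp t w \<partial>M) + (\<integral>\<^sup>+w. count t w \<partial>M)"
    by (simp add: nn_integral_add total_comp emeasure_space_1 add.commute)
  then show ?thesis
    using expectation_total_finite[of t] by (auto simp: total_comp ennreal_add_left_cancel)
qed

text \<open>The expected predictable quadratic variation of the compensated integral. One factor
  \<open>wt t s\<close> stands apart to match the shape of
  \<open>second_moment_identity\<close>.\<close>

definition var :: "real \<Rightarrow> ennreal" where
  "var t = (\<integral>\<^sup>+w. (\<integral>\<^sup>+s. wt t s * (wt t s * Lam0 s w) \<partial>lborel) \<partial>M)"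

lemma var_finite: "var t < \<infinity>"
proof -
  have "var t \<le> (\<integral>\<^sup>+w. (\<integral>\<^sup>+s. J t * (wt t s * Lam0 s w) \<partial>lborel) \<partial>M)"
    unfolding var_def by (intro nn_integral_mono mult_right_mono wt_le) simp
  also have "\<dots> = (\<integral>\<^sup>+w. J t * comp t w \<partial>M)"
    unfolding comp_def by (intro nn_integral_cong nn_integral_cmult) measurable
  also have "\<dots> = J t * (\<integral>\<^sup>+w. total t w \<partial>M)"
    by (simp add: nn_integral_cmult total_comp)
  also have "\<dots> < \<infinity>" using J_finite expectation_total_finite by (simp add: ennreal_mult_less_top)
  finally show ?thesis .
qed

section \<open>Square integrability and the variance\<close>

lemma stopped_le: "stopped n (wt t) s w \<le> wt t s * Lam0 s w"
  by (auto simp: stopped_def indicator_def)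

text \<open>From the index \<open>event_count\<close> on, \<tau> n lies beyond \<open>t\<close>,
  where \<open>wt t\<close> vanishes, so stopping there changes nothing.\<close>

lemma eventually_stopped:
  assumes w: "w \<in> space M" and n: "event_count \<tau> t w \<le> n"
  shows "stopped n (wt t) s w = wt t s * Lam0 s w" "psum n (wt t) w = total t w"
proof -
  have late: "\<not> \<tau> i w \<le> ereal t" if "n \<le> i" for i
    using that n by (simp add: arrival_le_iff[OF w])
  show "stopped n (wt t) s w = wt t s * Lam0 s w"
  proof (cases "s \<le> t")
    case True
    then have "ereal s \<le> \<tau> n w"
      using late[of n] by (cases "\<tau> n w") auto
    then show ?thesis by (simp add: stopped_def mult_ac)
  qed (simp add: stopped_def wt_zero)
  have "total t w = (\<Sum>i\<le>n. at_arrival (wt t) (\<tau> i w))"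
    unfolding total_def
  proof (rule suminf_finite)
    fix i assume "i \<notin> {..n}"
    then show "at_arrival (wt t) (\<tau> i w) = 0"
      using late[of i] arrival_pos[OF w, of i] by (cases "\<tau> i w") (auto simp: at_arrival_def wt_zero)
  qed simp
  then show "psum n (wt t) w = total t w" by (simp add: psum_def)
qed

definition scomp :: "real \<Rightarrow> nat \<Rightarrow> 'a \<Rightarrow> ennreal" where
  "scomp t n w = (\<integral>\<^sup>+s. stopped n (wt t) s w \<partial>lborel)"

lemma scomp_measurable [measurable]: "scomp t n \<in> borel_measurable M"
  unfolding scomp_def by measurable

lemma scomp_eventually: "w \<in> space M \<Longrightarrow> event_count \<tau> t w \<le> n \<Longrightarrow> scomp t n w = comp t w"
  unfolding scomp_def comp_def by (simp add: eventually_stopped)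

lemma stopped_mono: "w \<in> space M \<Longrightarrow> m \<le> n \<Longrightarrow> stopped m f s w \<le> stopped n f s w"
  using arrival_mono[of w m n] by (auto simp: stopped_def)

lemma scomp_mono: "w \<in> space M \<Longrightarrow> m \<le> n \<Longrightarrow> scomp t m w \<le> scomp t n w"
  unfolding scomp_def by (intro nn_integral_mono stopped_mono)

lemma psum_mono: "m \<le> n \<Longrightarrow> psum m f w \<le> psum n f w"
  unfolding psum_def by (intro sum_mono2) auto

text \<open>Monotone convergence for stopped quantities: each path becomes constant in
  \<open>n\<close> after finitely many steps, at an index depending on the path.\<close>

lemma nn_integral_limit:
  assumes [measurable]: "\<And>n. f n \<in> borel_measurable M"
    and "\<And>m n w. w \<in> space M \<Longrightarrow> m \<le> n \<Longrightarrow> f m w \<le> f n w"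
    and ev: "\<And>n w. w \<in> space M \<Longrightarrow> event_count \<tau> t w \<le> n \<Longrightarrow> f n w = g w"
  shows "(\<lambda>n. \<integral>\<^sup>+w. f n w \<partial>M) \<longlonglongrightarrow> (\<integral>\<^sup>+w. (g w :: ennreal) \<partial>M)"
proof -
  have sup: "g w = (SUP n. f n w)" if w: "w \<in> space M" for w
  proof (rule LIMSEQ_unique)
    show "(\<lambda>n. f n w) \<longlonglongrightarrow> (SUP n. f n w)"
      using assms(2)[OF w] by (intro LIMSEQ_SUP) (simp add: incseq_def)
    have "\<forall>\<^sub>F n in sequentially. f n w = g w"
      using eventually_ge_at_top[of "event_count \<tau> t w"] by eventually_elim (rule ev[OF w])
    then show "(\<lambda>n. f n w) \<longlonglongrightarrow> g w" by (rule tendsto_eventually)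
  qed
  have "(\<integral>\<^sup>+w. g w \<partial>M) = (\<integral>\<^sup>+w. (SUP n. f n w) \<partial>M)"
    by (intro nn_integral_cong sup)
  also have "\<dots> = (SUP n. \<integral>\<^sup>+w. f n w \<partial>M)"
    by (rule nn_integral_monotone_convergence_SUP_AE) (auto intro!: AE_I2 assms(2))
  finally show ?thesis
    by (simp only:) (intro LIMSEQ_SUP, auto simp: incseq_def intro!: nn_integral_mono assms(2))
qed

text \<open>All four terms of the stopped identity increase with \<open>n\<close>, so it passes to
  the limit even though the terms may still be infinite.\<close>

lemma second_moment_total:
  "(\<integral>\<^sup>+w. total t w ^ 2 \<partial>M) + (\<integral>\<^sup>+w. comp t w ^ 2 \<partial>M) = var t + 2 * (\<integral>\<^sup>+w. total t w * comp t w \<partial>M)"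
proof (rule LIMSEQ_unique)
  have 1: "(\<lambda>n. \<integral>\<^sup>+w. psum n (wt t) w ^ 2 \<partial>M) \<longlonglongrightarrow> (\<integral>\<^sup>+w. total t w ^ 2 \<partial>M)"
    by (rule nn_integral_limit[where t = t]) (auto intro: power_mono psum_mono simp: eventually_stopped)
  have 2: "(\<lambda>n. \<integral>\<^sup>+w. scomp t n w ^ 2 \<partial>M) \<longlonglongrightarrow> (\<integral>\<^sup>+w. comp t w ^ 2 \<partial>M)"
    by (rule nn_integral_limit[where t = t]) (auto intro: power_mono scomp_mono simp: scomp_eventually)
  have 3: "(\<lambda>n. \<integral>\<^sup>+w. psum n (wt t) w * scomp t n w \<partial>M) \<longlonglongrightarrow> (\<integral>\<^sup>+w. total t w * comp t w \<partial>M)"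
    by (rule nn_integral_limit[where t = t]) (auto intro: mult_mono scomp_mono psum_mono simp: scomp_eventually eventually_stopped)
  have 4: "(\<lambda>n. \<integral>\<^sup>+w. (\<integral>\<^sup>+s. wt t s * stopped n (wt t) s w \<partial>lborel) \<partial>M) \<longlonglongrightarrow> var t"
    unfolding var_def
    by (rule nn_integral_limit[where t = t])
      (auto intro!: nn_integral_mono mult_left_mono stopped_mono simp: eventually_stopped)
  show "(\<lambda>n. (\<integral>\<^sup>+w. psum n (wt t) w ^ 2 \<partial>M) + (\<integral>\<^sup>+w. scomp t n w ^ 2 \<partial>M))
    \<longlonglongrightarrow> (\<integral>\<^sup>+w. total t w ^ 2 \<partial>M) + (\<integral>\<^sup>+w. comp t w ^ 2 \<partial>M)"
    by (intro tendsto_add 1 2)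
  have "(\<lambda>n. (\<integral>\<^sup>+w. (\<integral>\<^sup>+s. wt t s * stopped n (wt t) s w \<partial>lborel) \<partial>M) + 2 * (\<integral>\<^sup>+w. psum n (wt t) w * scomp t n w \<partial>M))
    \<longlonglongrightarrow> var t + 2 * (\<integral>\<^sup>+w. total t w * comp t w \<partial>M)"
    by (intro tendsto_add 4 ennreal_tendsto_cmult 3) simp
  then show "(\<lambda>n. (\<integral>\<^sup>+w. psum n (wt t) w ^ 2 \<partial>M) + (\<integral>\<^sup>+w. scomp t n w ^ 2 \<partial>M))
    \<longlonglongrightarrow> var t + 2 * (\<integral>\<^sup>+w. total t w * comp t w \<partial>M)"
    using second_moment_identity[OF wt_measurable, of _ t] by (simp add: scomp_def)
qed

lemma count_eq_real: "w \<in> space M \<Longrightarrow> enn2real (count t w) = real (event_count \<tau> t w)"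
  by (simp add: count_eq)

lemma pathwise_finite:
  assumes "w \<in> space M"
  shows "count t w < \<infinity>" "total t w < \<infinity>" "comp t w < \<infinity>"
proof -
  show 1: "count t w < \<infinity>" using assms by (simp add: count_eq)
  have "total t w \<le> J t * count t w" by (rule total_le[OF assms])
  also have "\<dots> < \<infinity>" using 1 J_finite[of t] by (simp add: ennreal_mult_less_top)
  finally show 2: "total t w < \<infinity>" .
  have "comp t w \<le> total t w + mean t" unfolding total_decomposition[OF assms] by simp
  also have "\<dots> < \<infinity>" using 2 mean_finite[of t] by simp
  finally show "comp t w < \<infinity>" .
qed

lemma scomp_le: "scomp t n w \<le> comp t w"
  unfolding scomp_def comp_def by (intro nn_integral_mono stopped_le)

text \<open>By \<open>psum_decomposition\<close> the stopped compensator is bounded by a constant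
  for fixed \<open>n\<close>; this makes subtraction legitimate before the limit.\<close>

lemma scomp_bound:
  assumes "w \<in> space M"
  shows "scomp t n w \<le> of_nat (Suc n) * J t + mean t"
proof -
  have "scomp t n w \<le> (\<Sum>i\<le>n. hit t i w) + scomp t n w"
    by simp
  also have "\<dots> \<le> psum n (wt t) w + mean t"
    using psum_decomposition[OF assms] by (simp add: scomp_def)
  also have "\<dots> \<le> of_nat (Suc n) * J t + mean t"
    by (intro add_right_mono psum_le)
  finally show ?thesis .
qed

lemma integrable_bounded_square:
  assumes [measurable]: "X \<in> borel_measurable M" and "\<And>w. w \<in> space M \<Longrightarrow> X w \<le> B" "B < \<infinity>"
  shows "integrable M (\<lambda>w. enn2real (X w) ^ 2)"
proof (rule integrable_const_bound[where B = "enn2real B ^ 2"])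
  show "AE w in M. norm (enn2real (X w) ^ 2) \<le> enn2real B ^ 2"
    using assms(2,3) by (auto intro!: AE_I2 power_mono enn2real_mono)
qed simp

lemma enn2real_square: "x < \<infinity> \<Longrightarrow> y < \<infinity> \<Longrightarrow> ennreal (enn2real x * enn2real y) = x * y"
  by (cases x; cases y) (auto simp: ennreal_mult)

lemma nn_integral_enn2real_mult:
  assumes "\<And>w. w \<in> space M \<Longrightarrow> f w < \<infinity>" "\<And>w. w \<in> space M \<Longrightarrow> g w < \<infinity>"
  shows "(\<integral>\<^sup>+w. ennreal (enn2real (f w) * enn2real (g w)) \<partial>M) = (\<integral>\<^sup>+w. f w * g w \<partial>M)"
  using assms by (intro nn_integral_cong enn2real_square)

text \<open>At fixed \<open>n\<close> both variables are bounded, so the second moment of their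
  difference can be computed, and \<open>var t\<close> dominates it uniformly in
  \<open>n\<close>.\<close>

lemma stopped_second_moment:
  defines "X \<equiv> \<lambda>t n w. enn2real (psum n (wt t) w)" and "Y \<equiv> \<lambda>t n w. enn2real (scomp t n w)"
  shows "(\<integral>\<^sup>+w. ennreal ((X t n w - Y t n w) ^ 2) \<partial>M) \<le> var t"
proof -
  have fin: "psum n (wt t) w < \<infinity>" "scomp t n w < \<infinity>" if "w \<in> space M" for w
    using le_less_trans[OF psum_le bounded_psum] le_less_trans[OF scomp_le pathwise_finite(3)[OF that]] by auto
  have bd: "of_nat (Suc n) * J t + mean t < \<infinity>"
    using bounded_psum[where n = n and t = t] mean_finite[of t] by simp
  have 1: "integrable M (\<lambda>w. X t n w ^ 2)" "integrable M (\<lambda>w. Y t n w ^ 2)"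
    unfolding X_def Y_def
    by (rule integrable_bounded_square[OF _ psum_le bounded_psum], simp)
      (rule integrable_bounded_square[OF _ scomp_bound bd], simp_all)
  have id: "(\<integral>\<^sup>+w. ennreal (X t n w ^ 2) \<partial>M) + (\<integral>\<^sup>+w. ennreal (Y t n w ^ 2) \<partial>M)
    = (\<integral>\<^sup>+w. (\<integral>\<^sup>+s. wt t s * stopped n (wt t) s w \<partial>lborel) \<partial>M) + 2 * (\<integral>\<^sup>+w. ennreal (X t n w * Y t n w) \<partial>M)"
    using second_moment_identity[OF wt_measurable, of n t]
    by (simp add: X_def Y_def power2_eq_square scomp_def[symmetric] nn_integral_enn2real_mult[OF fin(1) fin(1)]
        nn_integral_enn2real_mult[OF fin(2) fin(2)] nn_integral_enn2real_mult[OF fin])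
  have meas: "X t n \<in> borel_measurable M" "Y t n \<in> borel_measurable M"
    unfolding X_def Y_def by measurable
  note sq = square_difference_identity[OF meas _ _ 1 id]
  have "(\<integral>\<^sup>+w. ennreal ((X t n w - Y t n w) ^ 2) \<partial>M) = (\<integral>\<^sup>+w. (\<integral>\<^sup>+s. wt t s * stopped n (wt t) s w \<partial>lborel) \<partial>M)"
    using sq by (subst nn_integral_eq_integral) (auto simp: X_def Y_def)
  also have "\<dots> \<le> var t"
    unfolding var_def by (intro nn_integral_mono mult_left_mono stopped_le) simp
  finally show ?thesis .
qed

lemma difference_eq:
  assumes "w \<in> space M"
  shows "enn2real (total t w) - enn2real (comp t w) = real (event_count \<tau> t w) - enn2real (mean t)"
proof -
  have "enn2real (total t w + mean t) = enn2real (count t w + comp t w)"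
    by (simp add: total_decomposition[OF assms])
  then show ?thesis
    using pathwise_finite[OF assms, of t] mean_finite[of t] by (simp add: enn2real_plus count_eq_real[OF assms])
qed

text \<open>Fatou's lemma for the stopped differences, whose pathwise limit is N(t) minus its mean.
  At this point \<open>total\<close> and \<open>comp\<close> are not yet known to be square
  integrable one by one.\<close>

lemma count_square_integrable: "integrable M (\<lambda>w. (real (event_count \<tau> t w) - enn2real (mean t)) ^ 2)"
proof -
  let ?Z = "\<lambda>n w. (enn2real (psum n (wt t) w) - enn2real (scomp t n w)) ^ 2"
  let ?W = "\<lambda>w. (enn2real (total t w) - enn2real (comp t w)) ^ 2"
  have lim: "(\<lambda>n. ennreal (?Z n w)) \<longlonglongrightarrow> ennreal (?W w)" if "w \<in> space M" for w
  proof (rule tendsto_eventually)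
    show "\<forall>\<^sub>F n in sequentially. ennreal (?Z n w) = ennreal (?W w)"
      using eventually_ge_at_top[of "event_count \<tau> t w"]
      by eventually_elim (simp add: eventually_stopped[OF that] scomp_eventually[OF that])
  qed
  have "(\<integral>\<^sup>+w. ennreal (?W w) \<partial>M) = (\<integral>\<^sup>+w. liminf (\<lambda>n. ennreal (?Z n w)) \<partial>M)"
    by (intro nn_integral_cong lim_imp_Liminf[symmetric] lim) simp_all
  also have "\<dots> \<le> liminf (\<lambda>n. \<integral>\<^sup>+w. ennreal (?Z n w) \<partial>M)"
    by (rule nn_integral_liminf) simp
  also have "\<dots> \<le> liminf (\<lambda>n. var t)"
    by (intro Liminf_mono always_eventually allI stopped_second_moment)
  also have "\<dots> < \<infinity>" using var_finite by (simp add: Liminf_const)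
  finally have "integrable M ?W" by (intro integrableI_bounded) simp_all
  then show ?thesis
    by (rule Bochner_Integration.integrable_cong[THEN iffD1, rotated 2]) (simp_all add: difference_eq)
qed

lemma event_count_measurable [measurable]: "(\<lambda>w. real (event_count \<tau> t w)) \<in> borel_measurable M"
proof -
  have "(\<lambda>w. enn2real (count t w)) \<in> borel_measurable M" by measurable
  then show ?thesis by (rule measurable_cong[THEN iffD1, rotated]) (rule count_eq_real)
qed

lemma square_integrable_add:
  fixes f g :: "'a \<Rightarrow> real"
  assumes [measurable]: "f \<in> borel_measurable M" "g \<in> borel_measurable M"
    and "integrable M (\<lambda>w. f w ^ 2)" "integrable M (\<lambda>w. g w ^ 2)"
  shows "integrable M (\<lambda>w. (f w + g w) ^ 2)"
proof (rule Bochner_Integration.integrable_bound)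
  show "integrable M (\<lambda>w. 2 * f w ^ 2 + 2 * g w ^ 2)" using assms by simp
  have "(f w + g w) ^ 2 \<le> 2 * f w ^ 2 + 2 * g w ^ 2" for w
    using sum_squares_bound[of "f w" "g w"] by (simp add: power2_sum)
  then show "AE w in M. norm ((f w + g w) ^ 2) \<le> norm (2 * f w ^ 2 + 2 * g w ^ 2)" by simp
qed simp

lemma square_integrable_le:
  fixes f g :: "'a \<Rightarrow> real"
  assumes [measurable]: "f \<in> borel_measurable M" and g: "integrable M (\<lambda>w. g w ^ 2)"
    and "\<And>w. w \<in> space M \<Longrightarrow> 0 \<le> f w" "\<And>w. w \<in> space M \<Longrightarrow> f w \<le> g w"
  shows "integrable M (\<lambda>w. f w ^ 2)"
  by (rule Bochner_Integration.integrable_bound[OF g]) (auto intro!: AE_I2 power_mono assms)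

text \<open>Square integrability travels from the count to \<open>total\<close>, which is at most
  J(t) times it, and on to \<open>comp\<close>, which is at most \<open>total\<close> plus the mean.
  Then the terms of \<open>second_moment_total\<close> may be subtracted.\<close>

lemma variance_count:
  "ennreal (\<integral>w. (real (event_count \<tau> t w) - enn2real (mean t)) ^ 2 \<partial>M) = var t"
proof -
  define m where "m = enn2real (mean t)"
  let ?N = "\<lambda>w. real (event_count \<tau> t w)"
  let ?X = "\<lambda>w. enn2real (total t w)" and ?Y = "\<lambda>w. enn2real (comp t w)"
  have "integrable M (\<lambda>w. ((?N w - m) + m) ^ 2)"
    using count_square_integrable[of t] by (intro square_integrable_add) (simp_all add: m_def)
  then have N: "integrable M (\<lambda>w. ?N w ^ 2)" by simp
  then have JN: "integrable M (\<lambda>w. (enn2real (J t) * ?N w) ^ 2)" by (simp add: power_mult_distrib)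
  have iX: "integrable M (\<lambda>w. ?X w ^ 2)"
  proof (rule square_integrable_le[OF _ JN])
    fix w assume w: "w \<in> space M"
    have "enn2real (total t w) \<le> enn2real (J t * count t w)"
      using total_le[OF w, of t] pathwise_finite(1)[OF w, of t] J_finite[of t]
      by (intro enn2real_mono) (auto simp: ennreal_mult_less_top)
    then show "?X w \<le> enn2real (J t) * ?N w" by (simp add: enn2real_mult count_eq_real[OF w])
  qed simp_all
  have "integrable M (\<lambda>w. (?X w + m) ^ 2)"
    using iX by (intro square_integrable_add) simp_all
  then have iY: "integrable M (\<lambda>w. ?Y w ^ 2)"
  proof (rule square_integrable_le[rotated])
    fix w assume w: "w \<in> space M"
    show "?Y w \<le> ?X w + m" using difference_eq[OF w, of t] by (simp add: m_def)
  qed simp_all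
  have "ennreal (\<integral>w. (?X w - ?Y w) ^ 2 \<partial>M) = var t"
  proof (rule square_difference_identity(2)[OF _ _ _ _ iX iY])
    show "(\<integral>\<^sup>+w. ennreal (?X w ^ 2) \<partial>M) + (\<integral>\<^sup>+w. ennreal (?Y w ^ 2) \<partial>M)
      = var t + 2 * (\<integral>\<^sup>+w. ennreal (?X w * ?Y w) \<partial>M)"
      using second_moment_total[of t]
      by (simp add: power2_eq_square nn_integral_enn2real_mult[OF pathwise_finite(2,2)]
          nn_integral_enn2real_mult[OF pathwise_finite(3,3)] nn_integral_enn2real_mult[OF pathwise_finite(2,3)])
  qed simp_all
  moreover have "(\<integral>w. (?X w - ?Y w) ^ 2 \<partial>M) = (\<integral>w. (?N w - m) ^ 2 \<partial>M)"
    by (intro Bochner_Integration.integral_cong) (simp_all add: difference_eq m_def)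
  ultimately show ?thesis by (simp add: m_def)
qed

section \<open>Mean and variance as integrals of the renewal function\<close>

lemma mean_eq: "mean t = ennreal \<mu>\<^sub>0 * (\<integral>\<^sup>+u. indicator {0..t} u * J u \<partial>lborel)"
proof -
  have "(\<integral>\<^sup>+s. wt t s \<partial>lborel) = (\<integral>\<^sup>+u. wt t (t - u) \<partial>lborel)"
    using nn_integral_real_affine[of "wt t" "-1" t] by simp
  also have "\<dots> = (\<integral>\<^sup>+u. indicator {0..t} u * J u \<partial>lborel)"
    by (intro nn_integral_cong) (auto simp: wt_def indicator_def renewal_fun_neg p_zero)
  finally show ?thesis by (simp add: mean_def)
qed

text \<open>Both measures give the mass \<open>mean t\<close> to each half-line up to
  \<open>t\<close>, the left one by the intensity identity for the indicator of [0, t]. This encodes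
  E \<Lambda>(s) = \<open>\<mu>\<^sub>0\<close> J(s) for almost every s \<ge> 0.\<close>

lemma intensity_density:
  "density lborel (\<lambda>s. indicator {0..} s * (\<integral>\<^sup>+w. Lam s w \<partial>M)) = density lborel (\<lambda>s. ennreal \<mu>\<^sub>0 * (indicator {0..} s * J s))"
    (is "?A = ?B")
proof -
  interpret LM: pair_sigma_finite lborel M ..
  have A: "emeasure ?A {..t} = mean t" for t
  proof -
    have "emeasure ?A {..t} = (\<integral>\<^sup>+s. (\<integral>\<^sup>+w. indicator {0..t} s * Lam0 s w \<partial>M) \<partial>lborel)"
      by (subst emeasure_density) (auto simp: nn_integral_cmult[symmetric] indicator_def intro!: nn_integral_cong)
    also have "\<dots> = (\<integral>\<^sup>+w. (\<integral>\<^sup>+s. indicator {0..t} s * Lam0 s w \<partial>lborel) \<partial>M)"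
      by (rule LM.Fubini'[symmetric]) measurable
    also have "\<dots> = (\<integral>\<^sup>+w. (\<Sum>i. at_arrival (indicator {0..t}) (\<tau> i w)) \<partial>M)"
      by (rule intensity_formula[OF predictable_deterministic, symmetric]) simp
    also have "\<dots> = (\<integral>\<^sup>+w. count t w \<partial>M)"
    proof (rule nn_integral_cong)
      fix w assume w: "w \<in> space M"
      have "at_arrival (indicator {0..t}) (\<tau> i w) = hit t i w" for i
        using arrival_pos[OF w, of i] by (cases "\<tau> i w") (auto simp: at_arrival_def)
      then show "(\<Sum>i. at_arrival (indicator {0..t}) (\<tau> i w)) = count t w" by (simp add: count_def)
    qed
    finally show ?thesis by (simp add: expectation_count)
  qed
  have B: "emeasure ?B {..t} = mean t" for t
  proof -
    have "emeasure ?B {..t} = (\<integral>\<^sup>+s. ennreal \<mu>\<^sub>0 * (indicator {0..t} s * J s) \<partial>lborel)"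
      by (subst emeasure_density) (auto simp: indicator_def intro!: nn_integral_cong)
    then show ?thesis by (simp add: nn_integral_cmult mean_eq)
  qed
  show ?thesis
  proof (rule measure_eqI_generator_eq[where E = "range atMost" and \<Omega> = UNIV and A = "\<lambda>n. {..real n}"])
    show "Int_stable (range (atMost :: real \<Rightarrow> real set))"
      by (auto simp: Int_stable_def)
    show "(\<Union>n. {..real n}) = UNIV"
      using real_arch_simple by auto
    show "emeasure ?A {..real n} \<noteq> \<infinity>" for n
      using mean_finite[of "real n"] by (simp add: A)
  qed (auto simp: A B borel_eq_atMost sets_measure_of_conv)
qed

text \<open>After Tonelli's theorem the expected intensity appears as a density, and
  \<open>intensity_density\<close> replaces it by the renewal function.\<close>

lemma var_eq: "var t = ennreal \<mu>\<^sub>0 * (\<integral>\<^sup>+s. indicator {0..t} s * (J (t - s) ^ 2 * J s) \<partial>lborel)"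
proof -
  interpret LM: pair_sigma_finite lborel M ..
  have "var t = (\<integral>\<^sup>+s. (\<integral>\<^sup>+w. wt t s * (wt t s * Lam0 s w) \<partial>M) \<partial>lborel)"
    unfolding var_def by (rule LM.Fubini') measurable
  also have "\<dots> = (\<integral>\<^sup>+s. wt t s ^ 2 \<partial>density lborel (\<lambda>s. indicator {0..} s * (\<integral>\<^sup>+w. Lam s w \<partial>M)))"
    by (subst nn_integral_density) (auto simp: nn_integral_cmult power2_eq_square mult_ac intro!: nn_integral_cong)
  also have "\<dots> = (\<integral>\<^sup>+s. ennreal \<mu>\<^sub>0 * (indicator {0..t} s * (J (t - s) ^ 2 * J s)) \<partial>lborel)"
    unfolding intensity_density
    by (subst nn_integral_density)
      (auto simp: wt_def indicator_def mult_ac renewal_fun_neg p_zero intro!: nn_integral_cong)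
  finally show ?thesis by (simp add: nn_integral_cmult)
qed

definition j :: "real \<Rightarrow> real" where "j t = enn2real (J t)"

lemma ennreal_j: "ennreal (j t) = J t"
  using J_finite[of t] by (simp add: j_def)

lemma j_nonneg: "0 \<le> j t"
  by (simp add: j_def)

lemma expectation_eq_mean: "expectation (\<lambda>w. real (event_count \<tau> t w)) = enn2real (mean t)"
proof -
  have "expectation (\<lambda>w. real (event_count \<tau> t w)) = enn2real (\<integral>\<^sup>+w. ennreal (real (event_count \<tau> t w)) \<partial>M)"
    by (rule integral_eq_nn_integral) simp_all
  also have "(\<integral>\<^sup>+w. ennreal (real (event_count \<tau> t w)) \<partial>M) = mean t"
    unfolding expectation_count[symmetric] by (intro nn_integral_cong) (simp add: count_eq)
  finally show ?thesis .
qed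

theorem expectation_event_count:
  "expectation (\<lambda>w. real (event_count \<tau> t w)) = \<mu>\<^sub>0 * cumulative j t"
proof -
  have "enn2real (mean t) = \<mu>\<^sub>0 * enn2real (\<integral>\<^sup>+u. ennreal (indicator {0..t} u * j u) \<partial>lborel)"
    using mu0 by (simp add: mean_eq enn2real_mult ennreal_mult' ennreal_j ennreal_indicator)
  also have "enn2real (\<integral>\<^sup>+u. ennreal (indicator {0..t} u * j u) \<partial>lborel) = cumulative j t"
    by (rule integral_eq_nn_integral[symmetric]) (simp_all add: j_def)
  finally show ?thesis by (simp only: expectation_eq_mean)
qed

theorem variance_event_count:
  "variance (\<lambda>w. real (event_count \<tau> t w)) = \<mu>\<^sub>0 * square_convolution j t"
proof -
  have "variance (\<lambda>w. real (event_count \<tau> t w)) = enn2real (var t)"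
    unfolding expectation_eq_mean variance_count[symmetric] by (simp add: integral_nonneg_AE)
  also have "\<dots> = \<mu>\<^sub>0 * enn2real (\<integral>\<^sup>+u. ennreal (indicator {0..t} u * (j (t - u) ^ 2 * j u)) \<partial>lborel)"
    using mu0 by (simp add: var_eq enn2real_mult ennreal_mult' ennreal_j ennreal_indicator ennreal_power[symmetric] j_nonneg)
  also have "enn2real (\<integral>\<^sup>+u. ennreal (indicator {0..t} u * (j (t - u) ^ 2 * j u)) \<partial>lborel)
      = square_convolution j t"
    by (rule integral_eq_nn_integral[symmetric]) (simp_all add: j_def)
  finally show ?thesis .
qed

end

section \<open>Asymptotics\<close>

locale hawkes_asymp = hawkes_cut M F \<tau> \<mu>\<^sub>0 \<phi> + kern: hawkes_kernel \<phi>
  for M :: "'a measure" and F :: "real \<Rightarrow> 'a measure" and \<tau> :: "nat \<Rightarrow> 'a \<Rightarrow> ereal"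
    and \<mu>\<^sub>0 :: real and \<phi> :: "real \<Rightarrow> real"
begin

lemma laplace_renewal:
  assumes "0 < z"
  shows "laplace (renewal_fun p) z = ennreal (1 / (z * (1 - kern.lap z)))"
proof (rule laplace_renewal_fun)
  have "laplace p z = (\<integral>\<^sup>+s. ennreal (exp (- z * s) * \<phi> s) \<partial>lborel)"
    by (simp add: laplace_def p_def ennreal_mult')
  also have "\<dots> = ennreal (kern.lap z)"
    unfolding kern.lap_def using phi_nonneg
    by (intro nn_integral_eq_integral kern.lap_integrable assms) simp
  finally show "laplace p z = ennreal (kern.lap z)" .
qed (use assms kern.lap_less_1 kern.lap_nonneg in auto)

sublocale hawkes_finite M F \<tau> \<mu>\<^sub>0 \<phi>
proof
  show "renewal_fun p t < \<infinity>" for t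
    \<comment> \<open>One finite transform suffices; at z = 1 it is finite because
      \<open>lap\<close> is below 1 there, also when the mass is 1.\<close>
    by (rule renewal_fun_finite[of p 1]) (simp_all add: laplace_renewal)
qed

lemma mono_j: "mono j"
  using mono_renewal_fun[of p] J_finite
  by (auto simp: mono_def j_def intro!: enn2real_mono)

lemma j_pos: "0 < t \<Longrightarrow> 0 < j t"
  using renewal_fun_ge_1[of p t] J_finite[of t]
  by (auto simp: j_def enn2real_positive_iff intro: less_le_trans[OF zero_less_one])

lemma laplace_j:
  assumes "0 < z"
  shows "has_bochner_integral lborel (\<lambda>t. indicator {0..} t * (exp (- z * t) * j t)) (1 / (z * (1 - kern.lap z)))"
proof (rule has_bochner_integral_nn_integral)
  have [measurable]: "j \<in> borel_measurable borel" unfolding j_def by measurable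
  show "(\<lambda>t. indicator {0..} t * (exp (- z * t) * j t)) \<in> borel_measurable lborel" by measurable
  have "(\<integral>\<^sup>+t. ennreal (indicator {0..} t * (exp (- z * t) * j t)) \<partial>lborel) = laplace J z"
    unfolding laplace_def
  proof (rule nn_integral_cong)
    fix t
    show "ennreal (indicator {0..} t * (exp (- z * t) * j t)) = ennreal (exp (- z * t)) * J t"
      by (cases "0 \<le> t") (simp_all add: ennreal_mult' ennreal_j renewal_fun_neg p_zero)
  qed
  then show "(\<integral>\<^sup>+t. ennreal (indicator {0..} t * (exp (- z * t) * j t)) \<partial>lborel) = ennreal (1 / (z * (1 - kern.lap z)))"
    by (simp add: laplace_renewal[OF assms])
  show "0 \<le> 1 / (z * (1 - kern.lap z))"
    using assms kern.lap_less_1[OF assms] by simp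
qed (simp add: j_nonneg)

abbreviation EN :: "real \<Rightarrow> real" where
  "EN t \<equiv> expectation (\<lambda>\<omega>. real (event_count \<tau> t \<omega>))"

abbreviation VarN :: "real \<Rightarrow> real" where
  "VarN t \<equiv> variance (\<lambda>\<omega>. real (event_count \<tau> t \<omega>))"

lemma asymp_equiv_divideI:
  fixes f h :: "real \<Rightarrow> real"
  assumes "((\<lambda>t. f t * h t) \<longlongrightarrow> c) at_top" "c \<noteq> 0"
  shows "f \<sim>[at_top] (\<lambda>t. c / h t)"
proof (rule asymp_equivI')
  have "((\<lambda>t. f t * h t / c) \<longlongrightarrow> c / c) at_top"
    using assms by (intro tendsto_intros)
  then show "((\<lambda>t. f t / (c / h t)) \<longlongrightarrow> 1) at_top" using assms by simp
qed

text \<open>The form common to all regimes: \<open>G\<close> is an explicit function to which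
  \<open>K\<close> is asymptotic, so each regime has only to provide the index \<rho> and
  \<open>G\<close>.\<close>

theorem moments_asymp_equiv:
  assumes RV: "\<And>x. 0 < x \<Longrightarrow> ((\<lambda>T. kern.K (T * x) / kern.K T) \<longlongrightarrow> x powr \<rho>) at_top" and \<rho>: "0 \<le> \<rho>" "\<rho> \<le> 1"
    and G: "((\<lambda>t. kern.K t / G t) \<longlongrightarrow> 1) at_top"
  shows "EN \<sim>[at_top] (\<lambda>t. \<mu>\<^sub>0 / (Gamma (1 + \<rho>) * Gamma (3 - \<rho>)) / (G t / t ^ 2))"
    and "VarN \<sim>[at_top] (\<lambda>t. \<mu>\<^sub>0 * Beta (3 - 2 * \<rho>) (2 - \<rho>) / (Gamma (1 + \<rho>) * Gamma (2 - \<rho>)) ^ 3 / (G t ^ 3 / t ^ 4))"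
proof -
  have pos: "Gamma (1 + \<rho>) > 0" "Gamma (2 - \<rho>) > 0" "Gamma (3 - \<rho>) > 0" "Beta (3 - 2 * \<rho>) (2 - \<rho>) > 0"
    using \<rho> by (auto intro!: Gamma_real_pos simp: Beta_def)
  note mg = kern.moment_growth[OF mono_j j_nonneg j_pos laplace_j RV \<rho>]
  \<comment> \<open>Since a quotient by 0 is 0, this bound also shows that \<open>G\<close> is
    eventually nonzero.\<close>
  have "\<forall>\<^sub>F t in at_top. 1 / 2 < kern.K t / G t"
    by (rule order_tendstoD(1)[OF G]) simp
  then have G0: "\<forall>\<^sub>F t in at_top. 0 < t \<and> G t \<noteq> 0"
    using eventually_gt_at_top[of 0] by eventually_elim auto
  have "((\<lambda>t. \<mu>\<^sub>0 * (cumulative j t * (kern.K t / t ^ 2)) / (kern.K t / G t))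
      \<longlongrightarrow> \<mu>\<^sub>0 * (1 / (Gamma (1 + \<rho>) * Gamma (3 - \<rho>))) / 1) at_top"
    by (intro tendsto_intros mg G) auto
  moreover have "\<forall>\<^sub>F t in at_top. \<mu>\<^sub>0 * (cumulative j t * (kern.K t / t ^ 2)) / (kern.K t / G t) = EN t * (G t / t ^ 2)"
    using G0
  proof eventually_elim
    case (elim t)
    then show ?case using kern.K_pos[of t] by (simp add: expectation_event_count)
  qed
  ultimately have "((\<lambda>t. EN t * (G t / t ^ 2)) \<longlongrightarrow> \<mu>\<^sub>0 * (1 / (Gamma (1 + \<rho>) * Gamma (3 - \<rho>))) / 1) at_top"
    by (rule Lim_transform_eventually)
  from asymp_equiv_divideI[OF this]
  show "EN \<sim>[at_top] (\<lambda>t. \<mu>\<^sub>0 / (Gamma (1 + \<rho>) * Gamma (3 - \<rho>)) / (G t / t ^ 2))"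
    using pos mu0 by simp
  have "((\<lambda>t. \<mu>\<^sub>0 * (square_convolution j t * (kern.K t ^ 3 / t ^ 4)) / (kern.K t / G t) ^ 3)
      \<longlongrightarrow> \<mu>\<^sub>0 * (Beta (3 - 2 * \<rho>) (2 - \<rho>) / (Gamma (1 + \<rho>) * Gamma (2 - \<rho>)) ^ 3) / 1 ^ 3) at_top"
    by (intro tendsto_intros mg G) auto
  moreover have "\<forall>\<^sub>F t in at_top. \<mu>\<^sub>0 * (square_convolution j t * (kern.K t ^ 3 / t ^ 4)) / (kern.K t / G t) ^ 3
      = VarN t * (G t ^ 3 / t ^ 4)"
    using G0
  proof eventually_elim
    case (elim t)
    then show ?case using kern.K_pos[of t] by (simp add: variance_event_count power_divide)
  qed
  ultimately have "((\<lambda>t. VarN t * (G t ^ 3 / t ^ 4)) \<longlongrightarrow> \<mu>\<^sub>0 * (Beta (3 - 2 * \<rho>) (2 - \<rho>) / (Gamma (1 + \<rho>) * Gamma (2 - \<rho>)) ^ 3) / 1 ^ 3) at_top"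
    by (rule Lim_transform_eventually)
  from asymp_equiv_divideI[OF this]
  show "VarN \<sim>[at_top] (\<lambda>t. \<mu>\<^sub>0 * Beta (3 - 2 * \<rho>) (2 - \<rho>) / (Gamma (1 + \<rho>) * Gamma (2 - \<rho>)) ^ 3 / (G t ^ 3 / t ^ 4))"
    using pos mu0 by simp
qed

lemma asymp_equiv_cong_pos:
  fixes f g h :: "real \<Rightarrow> real"
  assumes "f \<sim>[at_top] g" "\<And>t. 0 < t \<Longrightarrow> g t = h t"
  shows "f \<sim>[at_top] h"
proof (rule asymp_equiv_trans[OF assms(1)], rule asymp_equiv_refl_ev)
  show "\<forall>\<^sub>F t in at_top. g t = h t"
    using eventually_gt_at_top[of 0] by eventually_elim (rule assms(2))
qed

lemma Gamma_small: "Gamma (2::real) = 1" "Gamma (3::real) = 2" "Gamma (5::real) = 24"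
  using Gamma_fact[of 1, where 'a = real] Gamma_fact[of 2, where 'a = real] Gamma_fact[of 4, where 'a = real]
  by (simp_all add: fact_numeral)

lemma Beta_3_2: "Beta (3::real) 2 = 1 / 12"
  by (simp add: Beta_def Gamma_small)

section \<open>The four regimes\<close>

lemma subcritical:
  assumes "kern.mass < 1"
  shows "EN \<sim>[at_top] (\<lambda>t. \<mu>\<^sub>0 * t / (1 - kern.mass))"
    and "VarN \<sim>[at_top] (\<lambda>t. \<mu>\<^sub>0 * t / (1 - kern.mass) ^ 3)"
proof -
  note lim = kern.K_limit_subcritical
  have RV: "((\<lambda>T. kern.K (T * x) / kern.K T) \<longlongrightarrow> x powr 1) at_top" if x: "0 < x" for x
  proof -
    have "filterlim (\<lambda>T. T * x) at_top at_top" using x by real_asymp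
    note lim' = filterlim_compose[OF lim this]
    have "((\<lambda>T. (kern.K (T * x) / (T * x)) / (kern.K T / T) * x) \<longlongrightarrow> (1 - kern.mass) / (1 - kern.mass) * x) at_top"
      using assms by (intro tendsto_intros lim lim') auto
    moreover have "\<forall>\<^sub>F T in at_top. (kern.K (T * x) / (T * x)) / (kern.K T / T) * x = kern.K (T * x) / kern.K T"
      using eventually_gt_at_top[of 0] by eventually_elim (use x in simp)
    ultimately show ?thesis using assms x by (auto elim: Lim_transform_eventually)
  qed
  have "((\<lambda>t. kern.K t / t / (1 - kern.mass)) \<longlongrightarrow> (1 - kern.mass) / (1 - kern.mass)) at_top"
    using assms by (intro tendsto_intros lim) auto
  then have G: "((\<lambda>t. kern.K t / ((1 - kern.mass) * t)) \<longlongrightarrow> 1) at_top"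
    using assms by (simp add: mult.commute)
  \<comment> \<open>With \<rho> = 1 and G(t) = (1 - mass) t, all Gamma and Beta factors equal
    1.\<close>
  note ma = moments_asymp_equiv[OF RV _ _ G, simplified]
  show "EN \<sim>[at_top] (\<lambda>t. \<mu>\<^sub>0 * t / (1 - kern.mass))"
    by (rule asymp_equiv_cong_pos[OF ma(1)]) (use assms in \<open>simp add: Gamma_small power2_eq_square\<close>)
  show "VarN \<sim>[at_top] (\<lambda>t. \<mu>\<^sub>0 * t / (1 - kern.mass) ^ 3)"
    by (rule asymp_equiv_cong_pos[OF ma(2)])
      (use assms in \<open>simp add: Gamma_small Beta_def power_mult_distrib power_numeral_reduce\<close>)
qed

text \<open>Here \<open>K\<close> converges to \<sigma>, so \<rho> = 0; the constants come from
  \<Gamma>(3) = 2 and Beta(3, 2) = 1/12.\<close>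

lemma weakly_critical:
  assumes m: "kern.mass = 1" and i: "integrable lborel (\<lambda>s. s * \<phi> s)" and \<sigma>: "0 < \<sigma>" "\<sigma> = (LBINT s. s * \<phi> s)"
  shows "EN \<sim>[at_top] (\<lambda>t. \<mu>\<^sub>0 / (2 * \<sigma>) * t ^ 2)"
    and "VarN \<sim>[at_top] (\<lambda>t. \<mu>\<^sub>0 / (12 * \<sigma> ^ 3) * t ^ 4)"
proof -
  have lim: "(kern.K \<longlongrightarrow> \<sigma>) at_top"
    using kern.K_limit_finite_mean[OF m i] by (simp add: \<sigma>)
  have RV: "((\<lambda>T. kern.K (T * x) / kern.K T) \<longlongrightarrow> x powr 0) at_top" if x: "0 < x" for x
  proof -
    have "filterlim (\<lambda>T. T * x) at_top at_top" using x by real_asymp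
    note lim' = filterlim_compose[OF lim this]
    have "((\<lambda>T. kern.K (T * x) / kern.K T) \<longlongrightarrow> \<sigma> / \<sigma>) at_top"
      using \<sigma>(1) by (intro tendsto_intros lim lim') auto
    then show ?thesis using \<sigma>(1) x by simp
  qed
  have "((\<lambda>t. kern.K t / \<sigma>) \<longlongrightarrow> \<sigma> / \<sigma>) at_top"
    using \<sigma>(1) by (intro tendsto_intros lim) auto
  then have G: "((\<lambda>t. kern.K t / \<sigma>) \<longlongrightarrow> 1) at_top"
    using \<sigma>(1) by simp
  note ma = moments_asymp_equiv[OF RV _ _ G, simplified]
  show "EN \<sim>[at_top] (\<lambda>t. \<mu>\<^sub>0 / (2 * \<sigma>) * t ^ 2)"
    by (rule asymp_equiv_cong_pos[OF ma(1)]) (simp add: Gamma_small)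
  show "VarN \<sim>[at_top] (\<lambda>t. \<mu>\<^sub>0 / (12 * \<sigma> ^ 3) * t ^ 4)"
    by (rule asymp_equiv_cong_pos[OF ma(2)]) (simp add: Gamma_small Beta_3_2)
qed

text \<open>Here \<rho> = 1 - \<alpha> and G(t) = t tail(t)/(1 - \<alpha>); the factor 1 - \<alpha>
  is absorbed by \<Gamma>(2 - \<alpha>) = (1 - \<alpha>) \<Gamma>(1 - \<alpha>).\<close>

lemma strongly_critical:
  assumes m: "kern.mass = 1" and \<alpha>: "0 \<le> \<alpha>" "\<alpha> < 1"
    and RV: "\<And>x. 0 < x \<Longrightarrow> ((\<lambda>t. kern.tail (t * x) / kern.tail t) \<longlongrightarrow> x powr (- \<alpha>)) at_top"
  shows "EN \<sim>[at_top] (\<lambda>t. \<mu>\<^sub>0 / (Gamma (1 - \<alpha>) * Gamma (2 + \<alpha>)) * (t / kern.tail t))"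
    and "VarN \<sim>[at_top] (\<lambda>t. \<mu>\<^sub>0 * Beta (2 * \<alpha> + 1) (\<alpha> + 1) / \<bar>Gamma (1 - \<alpha>) * Gamma (1 + \<alpha>)\<bar> ^ 3 * (t / \<bar>kern.tail t\<bar> ^ 3))"
proof -
  note pos = kern.tail_pos[OF RV]
  note lim = kern.K_limit_rv_tail[OF m \<alpha> RV]
  have K_RV: "((\<lambda>T. kern.K (T * x) / kern.K T) \<longlongrightarrow> x powr (1 - \<alpha>)) at_top" if x: "0 < x" for x
  proof -
    have "filterlim (\<lambda>T. T * x) at_top at_top" using x by real_asymp
    note lim' = filterlim_compose[OF lim this]
    have "((\<lambda>T. (kern.K (T * x) / (T * x * kern.tail (T * x))) / (kern.K T / (T * kern.tail T)) * (x * (kern.tail (T * x) / kern.tail T)))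
        \<longlongrightarrow> (1 / (1 - \<alpha>)) / (1 / (1 - \<alpha>)) * (x * x powr (- \<alpha>))) at_top"
      using \<alpha> x by (intro tendsto_intros lim lim' RV) auto
    moreover have "(1 / (1 - \<alpha>)) / (1 / (1 - \<alpha>)) * (x * x powr (- \<alpha>)) = x powr (1 - \<alpha>)"
      using \<alpha> x by (simp add: powr_diff powr_minus divide_inverse)
    moreover have "\<forall>\<^sub>F T in at_top. (kern.K (T * x) / (T * x * kern.tail (T * x))) / (kern.K T / (T * kern.tail T)) * (x * (kern.tail (T * x) / kern.tail T))
        = kern.K (T * x) / kern.K T"
      using eventually_gt_at_top[of 0]
    proof eventually_elim
      case (elim T)
      then show ?case using x pos[of T] pos[of "T * x"] by simp
    qed
    ultimately show ?thesis by (auto elim: Lim_transform_eventually)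
  qed
  have "((\<lambda>t. kern.K t / (t * kern.tail t) * (1 - \<alpha>)) \<longlongrightarrow> 1 / (1 - \<alpha>) * (1 - \<alpha>)) at_top"
    by (intro tendsto_intros lim)
  then have G: "((\<lambda>t. kern.K t / (t * kern.tail t / (1 - \<alpha>))) \<longlongrightarrow> 1) at_top"
    using \<alpha> by simp
  have \<rho>: "0 \<le> 1 - \<alpha>" "1 - \<alpha> \<le> 1" using \<alpha> by auto
  have g: "Gamma (2 - \<alpha>) = (1 - \<alpha>) * Gamma (1 - \<alpha>)"
    using Gamma_plus1[of "1 - \<alpha>"] \<alpha> by (auto simp: nonpos_Ints_def)
  have Gp: "0 < Gamma (1 - \<alpha>)" "0 < Gamma (1 + \<alpha>)" "0 < Gamma (2 + \<alpha>)"
    using \<alpha> by (auto intro!: Gamma_real_pos)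
  have args: "1 + (1 - \<alpha>) = 2 - \<alpha>" "3 - (1 - \<alpha>) = 2 + \<alpha>" "3 - 2 * (1 - \<alpha>) = 2 * \<alpha> + 1" "2 - (1 - \<alpha>) = 1 + \<alpha>" "\<alpha> + 1 = 1 + \<alpha>"
    by simp_all
  note ma = moments_asymp_equiv[OF K_RV \<rho> G, unfolded args g]
  show "EN \<sim>[at_top] (\<lambda>t. \<mu>\<^sub>0 / (Gamma (1 - \<alpha>) * Gamma (2 + \<alpha>)) * (t / kern.tail t))"
  proof (rule asymp_equiv_cong_pos[OF ma(1)])
    fix t :: real assume t: "0 < t"
    show "\<mu>\<^sub>0 / ((1 - \<alpha>) * Gamma (1 - \<alpha>) * Gamma (2 + \<alpha>)) / (t * kern.tail t / (1 - \<alpha>) / t ^ 2)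
      = \<mu>\<^sub>0 / (Gamma (1 - \<alpha>) * Gamma (2 + \<alpha>)) * (t / kern.tail t)"
    proof -
      have alg: "m / (\<beta> * g * h) / (t * w / \<beta> / t ^ 2) = m / (g * h) * (t / w)"
        if "\<beta> \<noteq> 0" for m \<beta> g h w :: real
        using t that by (simp add: power2_eq_square)
      show ?thesis by (rule alg) (use \<alpha> in simp)
    qed
  qed
  show "VarN \<sim>[at_top] (\<lambda>t. \<mu>\<^sub>0 * Beta (2 * \<alpha> + 1) (\<alpha> + 1) / \<bar>Gamma (1 - \<alpha>) * Gamma (1 + \<alpha>)\<bar> ^ 3 * (t / \<bar>kern.tail t\<bar> ^ 3))"
    unfolding args
  proof (rule asymp_equiv_cong_pos[OF ma(2)])
    fix t :: real assume t: "0 < t"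
    have abs: "\<bar>Gamma (1 - \<alpha>) * Gamma (1 + \<alpha>)\<bar> = Gamma (1 - \<alpha>) * Gamma (1 + \<alpha>)" "\<bar>kern.tail t\<bar> = kern.tail t"
      using Gp pos[of t] by (simp_all add: abs_mult)
    show "\<mu>\<^sub>0 * Beta (2 * \<alpha> + 1) (1 + \<alpha>) / ((1 - \<alpha>) * Gamma (1 - \<alpha>) * Gamma (1 + \<alpha>)) ^ 3 / ((t * kern.tail t / (1 - \<alpha>)) ^ 3 / t ^ 4)
      = \<mu>\<^sub>0 * Beta (2 * \<alpha> + 1) (1 + \<alpha>) / \<bar>Gamma (1 - \<alpha>) * Gamma (1 + \<alpha>)\<bar> ^ 3 * (t / \<bar>kern.tail t\<bar> ^ 3)"
    proof -
      have alg: "m / (\<beta> * g * h) ^ 3 / ((t * w / \<beta>) ^ 3 / t ^ 4) = m / (g * h) ^ 3 * (t / w ^ 3)"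
        if "\<beta> \<noteq> 0" for m \<beta> g h w :: real
        using t that by (simp add: power_mult_distrib power_divide power_numeral_reduce)
      show ?thesis unfolding abs by (rule alg) (use \<alpha> in simp)
    qed
  qed
qed

text \<open>Here \<rho> = 0 and \<open>G\<close> is \<open>Psi1\<close>: the difference of
  \<open>K\<close> and \<open>Psi1\<close> is t tail(t), negligible against \<open>K\<close>. The
  constants are those of \<open>weakly_critical\<close>, with Psi1(t) in the place of
  \<sigma>.\<close>

lemma strongly_critical_boundary:
  assumes m: "kern.mass = 1"
    and RV: "\<And>x. 0 < x \<Longrightarrow> ((\<lambda>t. kern.tail (t * x) / kern.tail t) \<longlongrightarrow> x powr (- 1)) at_top"
  shows "EN \<sim>[at_top] (\<lambda>t. \<mu>\<^sub>0 / 2 * (t ^ 2 / kern.Psi1 t))"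
    and "VarN \<sim>[at_top] (\<lambda>t. \<mu>\<^sub>0 / 12 * (t ^ 4 / \<bar>kern.Psi1 t\<bar> ^ 3))"
proof -
  have K_RV: "((\<lambda>T. kern.K (T * x) / kern.K T) \<longlongrightarrow> x powr 0) at_top" if x: "0 < x" for x
    using kern.K_limit_rv_minus_one(2)[OF m RV x] x by simp
  have "((\<lambda>t. 1 / (1 - t * kern.tail t / kern.K t)) \<longlongrightarrow> 1 / (1 - 0)) at_top"
    by (intro tendsto_intros kern.K_limit_rv_minus_one(1)[OF m RV]) auto
  moreover have "\<forall>\<^sub>F t in at_top. 1 / (1 - t * kern.tail t / kern.K t) = kern.K t / kern.Psi1 t"
    using eventually_gt_at_top[of 0]
  proof eventually_elim
    case (elim t)
    have "1 - t * kern.tail t / kern.K t = kern.Psi1 t / kern.K t"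
      using kern.K_pos[OF elim] elim by (simp add: kern.Psi1_eq[OF m] diff_divide_distrib)
    then show ?case by simp
  qed
  ultimately have G: "((\<lambda>t. kern.K t / kern.Psi1 t) \<longlongrightarrow> 1) at_top"
    by (auto elim: Lim_transform_eventually)
  have "0 \<le> kern.Psi1 t" for t
    unfolding kern.Psi1_def using phi_nonneg
    by (intro integral_nonneg_AE AE_I2) (auto simp: indicator_def)
  then have abs: "\<bar>kern.Psi1 t\<bar> = kern.Psi1 t" for t by simp
  note ma = moments_asymp_equiv[OF K_RV _ _ G, simplified]
  show "EN \<sim>[at_top] (\<lambda>t. \<mu>\<^sub>0 / 2 * (t ^ 2 / kern.Psi1 t))"
    by (rule asymp_equiv_cong_pos[OF ma(1)]) (simp add: Gamma_small)
  show "VarN \<sim>[at_top] (\<lambda>t. \<mu>\<^sub>0 / 12 * (t ^ 4 / \<bar>kern.Psi1 t\<bar> ^ 3))"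
    by (rule asymp_equiv_cong_pos[OF ma(2)]) (simp add: Gamma_small Beta_3_2 abs)
qed

end

theorem theorem5p4:
  fixes M :: "'a measure" and F :: "real \<Rightarrow> 'a measure" and \<tau> :: "nat \<Rightarrow> 'a \<Rightarrow> ereal"
    and \<mu>\<^sub>0 :: real and \<phi> :: "real \<Rightarrow> real"
  defines "EN \<equiv> \<lambda>t. prob_space.expectation M (\<lambda>\<omega>. real (event_count \<tau> t \<omega>))"
    and "VarN \<equiv> \<lambda>t. prob_space.variance M (\<lambda>\<omega>. real (event_count \<tau> t \<omega>))"
    and "m \<equiv> kernel_mass \<phi>"
    and "\<Phi> \<equiv> kernel_tail \<phi>"
    and "\<Psi>\<^sub>1 \<equiv> kernel_Psi1 \<phi>"
    and "\<sigma> \<equiv> kernel_sigma \<phi>"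
  assumes mu0: "0 < \<mu>\<^sub>0"
    and phi_nonneg: "\<And>s. 0 \<le> s \<Longrightarrow> 0 \<le> \<phi> s"
    and phi_L1: "set_integrable lborel {0..} \<phi>"
    and sigma_pos: "0 < \<sigma>"
    and hawkes: "hawkes_process M F \<tau> \<mu>\<^sub>0 \<phi>"
  shows
    "(m < 1 \<longrightarrow>
        EN \<sim>[at_top] (\<lambda>t. \<mu>\<^sub>0 * t / (1 - m)) \<and>
        VarN \<sim>[at_top] (\<lambda>t. \<mu>\<^sub>0 * t / (1 - m) ^ 3)) \<and>
     (m = 1 \<and> \<sigma> < \<infinity> \<longrightarrow>
        EN \<sim>[at_top] (\<lambda>t. \<mu>\<^sub>0 / (2 * enn2real \<sigma>) * t ^ 2) \<and>
        VarN \<sim>[at_top] (\<lambda>t. \<mu>\<^sub>0 / (12 * enn2real \<sigma> ^ 3) * t ^ 4)) \<and>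
     (m = 1 \<and> \<sigma> = \<infinity> \<longrightarrow>
        (\<forall>\<alpha>\<in>{0..<1::real}. \<Phi> \<in> RV_infinity (- \<alpha>) \<longrightarrow>
           EN \<sim>[at_top] (\<lambda>t. \<mu>\<^sub>0 / (Gamma (1 - \<alpha>) * Gamma (2 + \<alpha>)) * (t / \<Phi> t)) \<and>
           VarN \<sim>[at_top] (\<lambda>t. \<mu>\<^sub>0 * Beta (2 * \<alpha> + 1) (\<alpha> + 1)
              / \<bar>Gamma (1 - \<alpha>) * Gamma (1 + \<alpha>)\<bar> ^ 3 * (t / \<bar>\<Phi> t\<bar> ^ 3))) \<and>
        (\<Phi> \<in> RV_infinity (- 1) \<longrightarrow>
           EN \<sim>[at_top] (\<lambda>t. \<mu>\<^sub>0 / 2 * (t ^ 2 / \<Psi>\<^sub>1 t)) \<and>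
           VarN \<sim>[at_top] (\<lambda>t. \<mu>\<^sub>0 / 12 * (t ^ 4 / \<bar>\<Psi>\<^sub>1 t\<bar> ^ 3))))"
proof (cases "m \<le> 1")
  \<comment> \<open>Every regime requires m \<le> 1, so for m > 1 all implications are
    vacuous.\<close>
  case False
  then show ?thesis by simp
next
  case m1: True
  interpret hawkes_process M F \<tau> \<mu>\<^sub>0 \<phi> by (rule hawkes)
  \<comment> \<open>The intensity evaluates the kernel at t - \<tau> with \<tau> < t, hence at
    positive arguments only; the kernel may therefore be set to 0 also at the point 0.\<close>
  define \<psi> where "\<psi> s = indicator {0<..} s * (indicator {0..} s *\<^sub>R \<phi> s)" for s
  have \<psi>_pos: "\<psi> s = \<phi> s" if "0 < s" for s using that by (simp add: \<psi>_def)
  have \<psi>_zero: "\<psi> s = 0" if "s \<le> 0" for s using that by (simp add: \<psi>_def)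
  have \<psi>_nonneg: "0 \<le> \<psi> s" for s using phi_nonneg by (simp add: \<psi>_def indicator_def)
  have \<psi>_int: "integrable lborel \<psi>"
    using integrable_mult_indicator[OF _ phi_L1[unfolded set_integrable_def], of "{0<..}"]
    by (simp add: \<psi>_def[abs_def])
  have AE0: "AE s in lborel. s \<noteq> (0::real)" by (rule AE_lborel_singleton)
  have [measurable]: "(\<lambda>s. indicator {0..} s * \<phi> s) \<in> borel_measurable borel"
    using borel_measurable_integrable[OF phi_L1[unfolded set_integrable_def]] by simp
  have mass: "(LBINT s. \<psi> s) = m"
    unfolding m_def kernel_mass_def set_lebesgue_integral_def
  proof (rule integral_cong_AE)
    show "AE s in lborel. \<psi> s = indicator {0..} s *\<^sub>R \<phi> s"
      using AE0 by eventually_elim (auto simp: \<psi>_def indicator_def)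
  qed (use \<psi>_int in auto)
  have sigma: "\<sigma> = (\<integral>\<^sup>+s. ennreal (s * \<psi> s) \<partial>lborel)"
    unfolding \<sigma>_def kernel_sigma_def
    by (intro nn_integral_cong) (auto simp: \<psi>_def indicator_def)
  \<comment> \<open>With m = 0 the kernel would vanish almost everywhere, and \<sigma> = 0 would
    contradict \<open>sigma_pos\<close>. The result supplies \<open>phi_pos\<close> of
    \<open>hawkes_kernel\<close>.\<close>
  have "m \<noteq> 0"
  proof
    assume "m = 0"
    then have "AE s in lborel. \<psi> s = 0"
      using integral_nonneg_eq_0_iff_AE[OF \<psi>_int] \<psi>_nonneg mass by auto
    then have "(\<integral>\<^sup>+s. ennreal (s * \<psi> s) \<partial>lborel) = (\<integral>\<^sup>+s. 0 \<partial>(lborel :: real measure))"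
      by (intro nn_integral_cong_AE) (auto elim: eventually_mono)
    then show False using sigma sigma_pos by simp
  qed
  moreover have "0 \<le> m" unfolding mass[symmetric] using \<psi>_nonneg by simp
  ultimately have m0: "0 < m" by simp
  have "hawkes_intensity \<mu>\<^sub>0 \<phi> \<tau> = hawkes_intensity \<mu>\<^sub>0 \<psi> \<tau>"
  proof (intro ext)
    fix t \<omega>
    have "(\<Sum>i | 0 < \<tau> i \<omega> \<and> \<tau> i \<omega> < ereal t. \<phi> (t - real_of_ereal (\<tau> i \<omega>)))
        = (\<Sum>i | 0 < \<tau> i \<omega> \<and> \<tau> i \<omega> < ereal t. \<psi> (t - real_of_ereal (\<tau> i \<omega>)))"
    proof (rule sum.cong)
      fix i assume "i \<in> {i. 0 < \<tau> i \<omega> \<and> \<tau> i \<omega> < ereal t}"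
      then have "0 < t - real_of_ereal (\<tau> i \<omega>)" by (cases "\<tau> i \<omega>") auto
      then show "\<phi> (t - real_of_ereal (\<tau> i \<omega>)) = \<psi> (t - real_of_ereal (\<tau> i \<omega>))" by (simp add: \<psi>_pos)
    qed simp
    then show "hawkes_intensity \<mu>\<^sub>0 \<phi> \<tau> t \<omega> = hawkes_intensity \<mu>\<^sub>0 \<psi> \<tau> t \<omega>"
      by (simp add: hawkes_intensity_def)
  qed
  then interpret H: hawkes_asymp M F \<tau> \<mu>\<^sub>0 \<psi>
    using intensity mu0 \<psi>_int \<psi>_nonneg \<psi>_zero m0 m1 mass
    by unfold_locales auto
  have mass': "H.kern.mass = m" by (simp add: H.kern.mass_def mass)
  \<comment> \<open>For t < 0, \<Phi>(t) may involve arbitrary values of \<phi> on the negative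
    axis; agreement for positive t is enough for limits at infinity.\<close>
  have tail: "\<Phi> t = H.kern.tail t" if "0 < t" for t
    unfolding \<Phi>_def kernel_tail_def H.kern.tail_def set_lebesgue_integral_def
    using that by (intro Bochner_Integration.integral_cong) (auto simp: \<psi>_def indicator_def)
  have Psi: "\<Psi>\<^sub>1 = H.kern.Psi1"
    unfolding \<Psi>\<^sub>1_def kernel_Psi1_def[abs_def] H.kern.Psi1_def[abs_def] set_lebesgue_integral_def
    by (intro ext Bochner_Integration.integral_cong) (auto simp: \<psi>_def indicator_def)
  have RV: "((\<lambda>t. H.kern.tail (t * x) / H.kern.tail t) \<longlongrightarrow> x powr \<beta>) at_top"
    if "\<Phi> \<in> RV_infinity \<beta>" "0 < x" for \<beta> x
  proof -
    have "((\<lambda>t. \<Phi> (t * x) / \<Phi> t) \<longlongrightarrow> x powr \<beta>) at_top"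
      using that by (auto simp: RV_infinity_def)
    moreover have "\<forall>\<^sub>F t in at_top. \<Phi> (t * x) / \<Phi> t = H.kern.tail (t * x) / H.kern.tail t"
      using eventually_gt_at_top[of 0] by eventually_elim (use that(2) tail in simp)
    ultimately show ?thesis by (rule Lim_transform_eventually)
  qed
  have "EN \<sim>[at_top] (\<lambda>t. \<mu>\<^sub>0 / (2 * enn2real \<sigma>) * t ^ 2) \<and> VarN \<sim>[at_top] (\<lambda>t. \<mu>\<^sub>0 / (12 * enn2real \<sigma> ^ 3) * t ^ 4)"
    if m: "m = 1" and fin: "\<sigma> < \<infinity>"
  proof -
    have nn: "0 \<le> s * \<psi> s" for s using \<psi>_nonneg[of s] \<psi>_zero[of s] by (cases "s \<le> 0") auto
    have [measurable]: "\<psi> \<in> borel_measurable borel" using \<psi>_int by auto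
    have i: "integrable lborel (\<lambda>s. s * \<psi> s)"
      using fin nn by (intro integrableI_bounded) (simp_all add: sigma)
    have "enn2real \<sigma> = (LBINT s. s * \<psi> s)"
      unfolding sigma using nn by (intro integral_eq_nn_integral[symmetric]) auto
    moreover have "0 < enn2real \<sigma>" using fin sigma_pos by (simp add: enn2real_positive_iff)
    ultimately show ?thesis
      using H.weakly_critical[OF _ i] m mass' by (simp add: EN_def VarN_def)
  qed
  moreover have "EN \<sim>[at_top] (\<lambda>t. \<mu>\<^sub>0 * t / (1 - m)) \<and> VarN \<sim>[at_top] (\<lambda>t. \<mu>\<^sub>0 * t / (1 - m) ^ 3)" if "m < 1"
    using H.subcritical that by (simp add: EN_def VarN_def mass')
  moreover have "EN \<sim>[at_top] (\<lambda>t. \<mu>\<^sub>0 / (Gamma (1 - \<alpha>) * Gamma (2 + \<alpha>)) * (t / \<Phi> t)) \<and>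
           VarN \<sim>[at_top] (\<lambda>t. \<mu>\<^sub>0 * Beta (2 * \<alpha> + 1) (\<alpha> + 1)
              / \<bar>Gamma (1 - \<alpha>) * Gamma (1 + \<alpha>)\<bar> ^ 3 * (t / \<bar>\<Phi> t\<bar> ^ 3))"
    if "m = 1" "0 \<le> \<alpha>" "\<alpha> < 1" "\<Phi> \<in> RV_infinity (- \<alpha>)" for \<alpha>
  proof -
    note sc = H.strongly_critical[OF _ that(2,3) RV[OF that(4)]]
    show ?thesis
      unfolding EN_def VarN_def
      by (intro conjI H.asymp_equiv_cong_pos[OF sc(1)] H.asymp_equiv_cong_pos[OF sc(2)])
        (use that mass' tail in auto)
  qed
  moreover have "EN \<sim>[at_top] (\<lambda>t. \<mu>\<^sub>0 / 2 * (t ^ 2 / \<Psi>\<^sub>1 t)) \<and> VarN \<sim>[at_top] (\<lambda>t. \<mu>\<^sub>0 / 12 * (t ^ 4 / \<bar>\<Psi>\<^sub>1 t\<bar> ^ 3))"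
    if "m = 1" "\<Phi> \<in> RV_infinity (- 1)"
    using H.strongly_critical_boundary[OF _ RV[OF that(2)]] that mass' by (simp add: EN_def VarN_def Psi)
  ultimately show ?thesis by auto
qed

end
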